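(* Let $p\ge1$ be an integer, let $k,d$ be integers with $1\le k\le d/2$, let $V_1,\dots,V_n\in\mathcal{G}_{k,d}$, and let $\omega_1,\dots,\omega_n$ be positive weights with $\sum_{j=1}^n\omega_j=1$. The following properties are equivalent: (1) $\{(V_j,\omega_j)\}_{j=1}^n$ is a tight $p$-fusion frame. (2) For all $f\in \mathrm{Pol}^1_{\le 2p}(\mathcal{G}_{k,d})$, $\displaystyle\int_{\mathcal{G}_{k,d}}f(V)\,d\sigma_k(V)=\sum_{j=1}^n\omega_jf(V_j)$. (3) For every integer $\ell$ with $1\le\ell\le p$ and every $f\in H_{k,d}^{(2\ell)}$, $\displaystyle\sum_{j=1}^n\omega_jf(V_j)=0$. (4) For every integer $\ell$ with $1\le\ell\le p$, $\displaystyle\sum_{i,j=1}^n\omega_i\omega_jP_{(\ell)}(y_1(V_i,V_j),\dots,y_k(V_i,V_j))=0$.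
   Context: $\mathcal{G}_{k,d}$ is the real Grassmann space of $k$-dimensional linear subspaces of $\mathbb{R}^d$, and $\sigma_k$ is the $O(\mathbb{R}^d)$-invariant probability measure on it. $P_V$ denotes the orthogonal projection onto $V$. $\{(V_j,\omega_j)\}_{j=1}^n$ is a tight $p$-fusion frame if there is a constant $A>0$ such that $\sum_{j=1}^n\omega_j\|P_{V_j}(x)\|^{2p}=A\|x\|^{2p}$ for all $x\in\mathbb{R}^d$. For a partition $\mu=(\mu_1\ge\mu_2\ge\dots\ge\mu_d\ge0)$, its degree $\deg(\mu)$ is the sum of its parts and its length $l(\mu)$ is the number of nonzero parts; zero parts are usually omitted. $V_d^{\mu}$ denotes the complex irreducible representation of the orthogonal group $O(\mathbb{R}^d)$ canonically associated with $\mu$ (traceless tensors of symmetry type $\mu$; e.g. $V_d^{(0)}$ is trivial and $V_d^{(\ell)}$ is the space of homogeneous harmonic polynomials of degree $\ell$ in $d$ variables). For $k\le d/2$, the space $L^2(\mathcal{G}_{k,d})$ of complex-valued square-integrable functions decomposes without multiplicities under $O(\mathbb{R}^d)$ as $$L^2(\mathcal{G}_{k,d})=\bigoplus_{l(\mu)\le k}H_{k,d}^{2\mu},\qquad H_{k,d}^{2\mu}\simeq V_d^{2\mu},$$ where $2\mu=(2\mu_1,\dots,2\mu_d)$; the finite-dimensional spaces $H_{k,d}^{2\mu}$ consist of continuous functions. For $\mu=(\ell)$ one writes $H_{k,d}^{(2\ell)}$. Define $$\mathrm{Pol}^1_{\le 2p}(\mathcal{G}_{k,d}):=\bigoplus_{0\le\ell\le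 p}H_{k,d}^{(2\ell)}.$$ For $V,W\in\mathcal{G}_{k,d}$ with principal angles $\theta_1,\dots,\theta_k\in[0,\pi/2]$, put $y_i(V,W)=\cos^2\theta_i$ (so the $y_i(V,W)$ are the eigenvalues of $P_VP_WP_V$ restricted to $V$, counted with multiplicity). For each $\mu$ with $l(\mu)\le k$, $P_\mu(y_1,\dots,y_k)$ denotes the zonal spherical polynomial: the symmetric polynomial of degree $\deg(\mu)$ uniquely determined by $P_\mu(1,\dots,1)=1$ and the condition that, for each $W\in\mathcal{G}_{k,d}$, the function $V\mapsto P_\mu(y_1(V,W),\dots,y_k(V,W))$ belongs to $H_{k,d}^{2\mu}$ (it depends on $k$ and $d$, which are suppressed in the notation). *)

theory Defs
  imports
    "HOL-Probability.Probability"
    "HOL-Combinatorics.Permutations"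
    "HOL-Library.Poly_Mapping"
begin

text \<open>
  Several objects below are determined uniquely by a characteristic property: the invariant
  measure, the spaces \<open>grassmann_H\<close>, the zonal polynomials. They are picked with \<open>SOME\<close>, which
  coincides with \<open>THE\<close> whenever the object is unique.
\<close>

section \<open>The Grassmann space and its invariant measure\<close>

definition grassmannian :: "nat \<Rightarrow> (real ^ 'd) set set" where
  "grassmannian k = {V. subspace V \<and> dim V = k}"

definition oproj :: "(real ^ 'd) set \<Rightarrow> real ^ 'd \<Rightarrow> real ^ 'd" where
  "oproj V x = (THE y. y \<in> V \<and> (\<forall>v\<in>V. orthogonal (x - y) v))"

text \<open>
  The topology of the Grassmann space is the one inherited from the space of matrices through
  the injection that sends a subspace to its projection matrix.
\<close>

definition grassmann_topology :: "nat \<Rightarrow> (real ^ 'd) set topology" where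
  "grassmann_topology k = pullback_topology (grassmannian k) (\<lambda>V. matrix (oproj V)) euclidean"

definition is_grassmann_measure :: "nat \<Rightarrow> (real ^ 'd) set measure \<Rightarrow> bool" where
  "is_grassmann_measure k M \<longleftrightarrow>
     prob_space M \<and>
     sets M = sets (sigma (grassmannian k) {U. openin (grassmann_topology k) U}) \<and>
     (\<forall>g. orthogonal_transformation g \<longrightarrow> distr M M (\<lambda>V. g ` V) = M)"

definition grassmann_measure :: "nat \<Rightarrow> (real ^ 'd) set measure" where
  "grassmann_measure k = (SOME M. is_grassmann_measure k M)"

section \<open>Tight fusion frames\<close>

definition tight_fusion_frame ::
    "nat \<Rightarrow> nat \<Rightarrow> (nat \<Rightarrow> (real ^ 'd) set) \<Rightarrow> (nat \<Rightarrow> real) \<Rightarrow> bool" where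
  "tight_fusion_frame p n V \<omega> \<longleftrightarrow>
     (\<exists>A>0. \<forall>x. (\<Sum>j=1..n. \<omega> j * norm (oproj (V j) x) ^ (2 * p)) = A * norm x ^ (2 * p))"

section \<open>Decomposition of the functions on the Grassmann space\<close>

definition laplacian :: "(real ^ 'd \<Rightarrow> complex) \<Rightarrow> real ^ 'd \<Rightarrow> complex" where
  "laplacian h x =
     (\<Sum>b\<in>Basis. vector_derivative
        (\<lambda>t. vector_derivative (\<lambda>s. h (x + s *\<^sub>R b)) (at t)) (at 0))"

text \<open>The representation of the orthogonal group associated with the one-part partition \<open>(m)\<close>.\<close>

definition harmonics :: "nat \<Rightarrow> (real ^ 'd \<Rightarrow> complex) set" where
  "harmonics m =
     {h. polynomial_function h \<and>
         (\<forall>c x. h (c *\<^sub>R x) = of_real c ^ m * h x) \<and>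
         (\<forall>x. laplacian h x = 0)}"

text \<open>
  Functions on the Grassmann space are total functions that vanish outside of it, so that
  they form a vector space under pointwise operations.
\<close>

definition grassmann_C :: "nat \<Rightarrow> ((real ^ 'd) set \<Rightarrow> complex) set" where
  "grassmann_C k =
     {f. continuous_map (grassmann_topology k) euclidean f \<and> (\<forall>V. V \<notin> grassmannian k \<longrightarrow> f V = 0)}"

text \<open>
  \<open>is_harmonic_copy k m U\<close>: \<open>U\<close> is a complex subspace of the continuous functions on the Grassmann
  space, invariant under the orthogonal group and isomorphic to \<open>harmonics m\<close> as a representation;
  that \<open>U\<close> is an invariant subspace follows from its being the image of \<open>T\<close>.
  The group acts by \<open>(g \<cdot> h) x = h (g\<inverse> x)\<close> and \<open>(g \<cdot> f) V = f (g\<inverse> V)\<close>.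
  Continuous functions suffice, because the finite-dimensional invariant subspaces of
  the square-integrable functions consist of (classes of) continuous functions.
\<close>

definition is_harmonic_copy :: "nat \<Rightarrow> nat \<Rightarrow> ((real ^ 'd) set \<Rightarrow> complex) set \<Rightarrow> bool" where
  "is_harmonic_copy k m U \<longleftrightarrow>
     U \<subseteq> grassmann_C k \<and>
     (\<exists>T. bij_betw T (harmonics m) U \<and>
          (\<forall>h\<^sub>1\<in>harmonics m. \<forall>h\<^sub>2\<in>harmonics m.
             T (\<lambda>x. h\<^sub>1 x + h\<^sub>2 x) = (\<lambda>V. T h\<^sub>1 V + T h\<^sub>2 V)) \<and>
          (\<forall>a. \<forall>h\<in>harmonics m. T (\<lambda>x. a * h x) = (\<lambda>V. a * T h V)) \<and>
          (\<forall>g. orthogonal_transformation g \<longrightarrow>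
             (\<forall>h\<in>harmonics m. T (\<lambda>x. h (inv g x)) = (\<lambda>V. T h (inv g ` V)))))"

text \<open>
  \<open>grassmann_H k l\<close> is the summand of type \<open>(2l)\<close>; it is unique since the decomposition is
  multiplicity free.
\<close>

definition grassmann_H :: "nat \<Rightarrow> nat \<Rightarrow> ((real ^ 'd) set \<Rightarrow> complex) set" where
  "grassmann_H k l = (SOME U. is_harmonic_copy k (2 * l) U)"

text \<open>\<open>Pol1 k p\<close> is the sum of the summands of type \<open>(2l)\<close>, \<open>0 \<le> l \<le> p\<close>.\<close>

definition Pol1 :: "nat \<Rightarrow> nat \<Rightarrow> ((real ^ 'd) set \<Rightarrow> complex) set" where
  "Pol1 k p = {\<lambda>V. \<Sum>l\<le>p. f l V | f. \<forall>l\<le>p. f l \<in> grassmann_H k l}"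

section \<open>Principal angles and zonal polynomials\<close>

text \<open>
  \<open>is_cos2_angles k V W y\<close>: the numbers \<open>y 0, \<dots>, y (k - 1)\<close> are the eigenvalues of the self-adjoint
  operator \<open>P\<^sub>V P\<^sub>W P\<^sub>V\<close> restricted to \<open>V\<close>, each listed as often as the dimension of its eigenspace;
  equivalently, the squared cosines of the principal angles.
\<close>

definition is_cos2_angles ::
    "nat \<Rightarrow> (real ^ 'd) set \<Rightarrow> (real ^ 'd) set \<Rightarrow> (nat \<Rightarrow> real) \<Rightarrow> bool" where
  "is_cos2_angles k V W y \<longleftrightarrow>
     (\<forall>c. card {i. i < k \<and> y i = c} = dim {v \<in> V. oproj V (oproj W (oproj V v)) = c *\<^sub>R v})"

text \<open>The order of the values is left open; only symmetric polynomials are evaluated at them.\<close>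

definition cos2_angles :: "nat \<Rightarrow> (real ^ 'd) set \<Rightarrow> (real ^ 'd) set \<Rightarrow> nat \<Rightarrow> real" where
  "cos2_angles k V W = (SOME y. is_cos2_angles k V W y)"

text \<open>
  Real polynomials in the variables \<open>y 0, y 1, \<dots>\<close>; monomials are finitely supported exponent
  functions.
\<close>

type_synonym rpoly = "(nat \<Rightarrow>\<^sub>0 nat) \<Rightarrow>\<^sub>0 real"

definition rpoly_eval :: "rpoly \<Rightarrow> (nat \<Rightarrow> real) \<Rightarrow> real" where
  "rpoly_eval P y =
     (\<Sum>m\<in>Poly_Mapping.keys P. Poly_Mapping.lookup P m *
        (\<Prod>i\<in>Poly_Mapping.keys m. y i ^ Poly_Mapping.lookup m i))"

definition rpoly_degree :: "rpoly \<Rightarrow> nat" where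
  "rpoly_degree P =
     Max (insert 0 ((\<lambda>m. \<Sum>i\<in>Poly_Mapping.keys m. Poly_Mapping.lookup m i) ` Poly_Mapping.keys P))"

definition rpoly_symmetric :: "nat \<Rightarrow> rpoly \<Rightarrow> bool" where
  "rpoly_symmetric k P \<longleftrightarrow>
     (\<forall>m\<in>Poly_Mapping.keys P. Poly_Mapping.keys m \<subseteq> {..<k}) \<and>
     (\<forall>\<pi> y. \<pi> permutes {..<k} \<longrightarrow> rpoly_eval P (y \<circ> \<pi>) = rpoly_eval P y)"

text \<open>
  The zonal polynomial of the one-part partition \<open>(l)\<close>. It depends on the dimension \<open>d\<close>, which is
  passed as a type.
\<close>

definition is_zonal_poly :: "'d::finite itself \<Rightarrow> nat \<Rightarrow> nat \<Rightarrow> rpoly \<Rightarrow> bool" where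
  "is_zonal_poly _ k l P \<longleftrightarrow>
     rpoly_symmetric k P \<and> rpoly_degree P = l \<and> rpoly_eval P (\<lambda>_. 1) = 1 \<and>
     (\<forall>W \<in> (grassmannian k :: (real ^ 'd) set set).
        (\<lambda>V. if V \<in> grassmannian k then of_real (rpoly_eval P (cos2_angles k V W)) else 0)
          \<in> grassmann_H k l)"

definition zonal_poly :: "'d::finite itself \<Rightarrow> nat \<Rightarrow> nat \<Rightarrow> rpoly" where
  "zonal_poly d k l = (SOME P. is_zonal_poly d k l P)"

end

theory Submission
  imports Defs
begin

text \<open>
  To a subspace \<open>V\<close> of dimension \<open>k\<close> belongs, in each even degree \<open>2 * l\<close>, a zonal harmonic: a
  harmonic polynomial \<open>zonal V l\<close> that is fixed by the stabilizer of \<open>V\<close> in the orthogonal group.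
  Given points \<open>V j\<close> with weights \<open>\<omega> j\<close>, let \<open>Z l\<close> be the weighted sum of their zonal harmonics of
  degree \<open>2 * l\<close>. Each of the four properties \<open>S1\<close> to \<open>S4\<close> says that \<open>Z l = 0\<close> for
  \<open>1 \<le> l \<le> p\<close>.

  The harmonic polynomials of one degree form a finite-dimensional space with an invariant inner
  product, the integral over the unit ball. Two facts about this space carry the proof. First, a
  harmonic polynomial fixed by the stabilizer of \<open>V\<close> is determined by its value at one unit vector
  of \<open>V\<close> (\<open>invariant_harmonic_eq_0\<close>): it is a form in the squared norms of the two components of
  its argument, and harmonicity is a two-term recursion for the coefficients. By the Riesz
  representation theorem, which makes invariant vectors of invariant functionals, every functional
  fixed by the stabilizer is then a multiple of the pairing with \<open>zonal V l\<close>
  (\<open>stabilizer_invariant_functional\<close>). Second, these pairings separate the harmonic polynomials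
  (\<open>zonal_separates\<close>).

  Hence \<open>h \<mapsto> (V \<mapsto> \<langle>h, zonal V l\<rangle>)\<close> is an equivariant embedding of the harmonic polynomials into
  the continuous functions on the Grassmann space, and the only one up to a factor, which identifies
  the summand of type \<open>(2 * l)\<close> (\<open>grassmann_H_eq\<close>). The weighted sum of the values of the function
  coming from \<open>h\<close> is \<open>\<langle>h, Z l\<rangle>\<close>, so \<open>S3\<close> is the vanishing of all \<open>Z l\<close>. \<open>S2\<close>
  differs from it by the integrals of the summands, which are zero for \<open>l \<ge> 1\<close> since no radial
  polynomial of positive degree is harmonic. The sum in \<open>S4\<close> is \<open>\<langle>Z l, Z l\<rangle>\<close> up to a positive
  factor, because \<open>\<langle>zonal W l, zonal V l\<rangle>\<close> is, up to this factor, the zonal polynomial of the squared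
  cosines of the principal angles.

  For \<open>S1\<close>, let \<open>F i\<close> be the weighted sum of the functions \<open>x \<mapsto> norm (oproj (V j) x) ^ (2 * i)\<close>.
  The polynomial \<open>Z l\<close> is a combination of the \<open>norm x ^ (2 * (l - i)) * F i x\<close>, where \<open>i \<le> l\<close>, in
  which \<open>F l\<close> has coefficient one. The Laplacian lowers the index of \<open>F i\<close> by one, so a tight frame
  has all \<open>F i\<close> with \<open>i \<le> p\<close> proportional to \<open>norm x ^ (2 * i)\<close>; then \<open>Z l\<close> is radial and harmonic,
  hence zero. Conversely the \<open>F l\<close> are recovered from the \<open>Z l\<close> one after the other.
\<close>

section \<open>Orthogonal projections and reflections\<close>

lemma oproj_eqI:
  assumes "subspace V" "y \<in> V" "\<And>v. v \<in> V \<Longrightarrow> orthogonal (x - y) v"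
  shows "oproj V x = y"
  unfolding oproj_def
proof (rule the_equality)
  show "y \<in> V \<and> (\<forall>v\<in>V. orthogonal (x - y) v)"
    using assms by auto
  fix z assume z: "z \<in> V \<and> (\<forall>v\<in>V. orthogonal (x - z) v)"
  have "y - z \<in> V"
    using assms z by (simp add: subspace_diff)
  then have "(x - z) \<bullet> (y - z) = 0" "(x - y) \<bullet> (y - z) = 0"
    using z assms(3) by (auto simp: orthogonal_def)
  then have "(y - z) \<bullet> (y - z) = 0"
    by (simp add: inner_diff_left)
  then show "z = y"
    by simp
qed

lemma
  assumes "subspace V"
  shows oproj_in: "oproj V x \<in> V"
    and oproj_orthogonal: "v \<in> V \<Longrightarrow> (x - oproj V x) \<bullet> v = 0"
proof -
  obtain y z where yz: "y \<in> span V" "\<And>w. w \<in> span V \<Longrightarrow> orthogonal z w" "x = y + z"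
    using orthogonal_subspace_decomp_exists[of V x] by blast
  have "oproj V x = y"
    by (rule oproj_eqI) (use yz assms in \<open>auto simp: span_eq_iff[THEN iffD2]\<close>)
  then show "oproj V x \<in> V" "v \<in> V \<Longrightarrow> (x - oproj V x) \<bullet> v = 0"
    using yz assms by (auto simp: orthogonal_def span_eq_iff[THEN iffD2])
qed

lemma oproj_ident: "subspace V \<Longrightarrow> x \<in> V \<Longrightarrow> oproj V x = x"
  by (rule oproj_eqI) (auto simp: orthogonal_def)

lemma linear_oproj:
  assumes V: "subspace V"
  shows "linear (oproj V)"
proof
  fix x y :: "real ^ 'a" and c :: real
  show "oproj V (x + y) = oproj V x + oproj V y"
  proof (rule oproj_eqI[OF V])
    show "oproj V x + oproj V y \<in> V"
      by (simp add: V oproj_in subspace_add)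
    fix v assume "v \<in> V"
    then show "orthogonal (x + y - (oproj V x + oproj V y)) v"
      using oproj_orthogonal[OF V, of v x] oproj_orthogonal[OF V, of v y]
      by (simp add: orthogonal_def algebra_simps)
  qed
  show "oproj V (c *\<^sub>R x) = c *\<^sub>R oproj V x"
  proof (rule oproj_eqI[OF V])
    show "c *\<^sub>R oproj V x \<in> V"
      by (simp add: V oproj_in subspace_scale)
    fix v assume "v \<in> V"
    then show "orthogonal (c *\<^sub>R x - c *\<^sub>R oproj V x) v"
      using oproj_orthogonal[OF V, of v x]
      by (simp add: orthogonal_def algebra_simps)
  qed
qed

lemma oproj_self_adjoint:
  assumes "subspace V"
  shows "oproj V x \<bullet> y = oproj V x \<bullet> oproj V y" "x \<bullet> oproj V y = oproj V x \<bullet> oproj V y"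
proof -
  have "(y - oproj V y) \<bullet> oproj V x = 0" "(x - oproj V x) \<bullet> oproj V y = 0"
    by (rule oproj_orthogonal[OF assms oproj_in[OF assms]])+
  then show "oproj V x \<bullet> y = oproj V x \<bullet> oproj V y" "x \<bullet> oproj V y = oproj V x \<bullet> oproj V y"
    by (simp_all add: inner_diff_left inner_commute[of "oproj V x" y] inner_commute[of "oproj V x" "oproj V y"])
qed

lemma oproj_idem: "subspace V \<Longrightarrow> oproj V (oproj V x) = oproj V x"
  by (simp add: oproj_ident oproj_in)

lemma norm_oproj_le:
  assumes "subspace V"
  shows "norm (oproj V x) \<le> norm x"
proof (cases "norm (oproj V x) = 0")
  case False
  have "norm (oproj V x) ^ 2 = x \<bullet> oproj V x"
    using oproj_self_adjoint[OF assms] by (simp add: power2_norm_eq_inner)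
  also have "\<dots> \<le> norm x * norm (oproj V x)"
    by (rule norm_cauchy_schwarz)
  finally show ?thesis
    using False by (simp add: power2_eq_square)
qed auto

lemma oproj_image:
  assumes g: "orthogonal_transformation g" and V: "subspace V"
  shows "oproj (g ` V) (g x) = g (oproj V x)"
proof (rule oproj_eqI)
  have lg: "linear g"
    by (rule orthogonal_transformation_linear[OF g])
  show "subspace (g ` V)"
    by (simp add: V lg linear_subspace_image)
  show "g (oproj V x) \<in> g ` V"
    by (simp add: V oproj_in)
  fix v assume "v \<in> g ` V"
  then show "orthogonal (g x - g (oproj V x)) v"
    using g oproj_orthogonal[OF V]
    by (auto simp: orthogonal_def orthogonal_transformation_def simp flip: linear_diff[OF lg])
qed

lemma oproj_orthogonal_comp:
  assumes "subspace V"
  shows "oproj (orthogonal_comp V) x = x - oproj V x"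
proof (rule oproj_eqI)
  show "subspace (orthogonal_comp V)"
    by (rule subspace_orthogonal_comp)
  show "x - oproj V x \<in> orthogonal_comp V"
    using oproj_orthogonal[OF assms] by (auto simp: orthogonal_comp_def orthogonal_def inner_commute)
  fix v assume "v \<in> orthogonal_comp V"
  then show "orthogonal (x - (x - oproj V x)) v"
    using oproj_in[OF assms] by (auto simp: orthogonal_comp_def)
qed

lemma dim_orthogonal_comp:
  fixes V :: "(real ^ 'd) set"
  assumes "subspace V"
  shows "dim (orthogonal_comp V) + dim V = CARD('d)"
  using dim_subspace_orthogonal_to_vectors[OF assms subspace_UNIV] by (simp add: orthogonal_comp_def)

lemma oproj_orthonormal_expansion:
  assumes B: "pairwise orthogonal B" "\<And>x. x \<in> B \<Longrightarrow> norm x = 1" "finite B"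
  shows "oproj (span B) x = (\<Sum>v\<in>B. (x \<bullet> v) *\<^sub>R v)"
proof (rule oproj_eqI)
  show "(\<Sum>v\<in>B. (x \<bullet> v) *\<^sub>R v) \<in> span B"
    by (intro span_sum span_scale span_base)
  have "orthogonal (x - (\<Sum>v\<in>B. (x \<bullet> v) *\<^sub>R v)) w" if "w \<in> B" for w
  proof -
    have "(\<Sum>v\<in>B. (x \<bullet> v) * (v \<bullet> w)) = (\<Sum>v\<in>B. if v = w then x \<bullet> w else 0)"
    proof (rule sum.cong[OF refl])
      fix v assume "v \<in> B"
      show "(x \<bullet> v) * (v \<bullet> w) = (if v = w then x \<bullet> w else 0)"
        using B(1,2) \<open>v \<in> B\<close> that
        by (auto simp: pairwise_def orthogonal_def norm_eq_1)
    qed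
    also have "\<dots> = x \<bullet> w"
      using that B(3) by simp
    finally show ?thesis
      by (simp add: orthogonal_def inner_diff_left inner_sum_left)
  qed
  then show "orthogonal (x - (\<Sum>v\<in>B. (x \<bullet> v) *\<^sub>R v)) w" if "w \<in> span B" for w
    using orthogonal_to_span[OF that] by blast
qed auto

text \<open>The sum is the trace of the projection.\<close>

lemma sum_norm_oproj_Basis:
  assumes "subspace V"
  shows "(\<Sum>b\<in>Basis. norm (oproj V b) ^ 2) = real (dim V)"
proof -
  obtain B where B: "pairwise orthogonal B" "\<And>x. x \<in> B \<Longrightarrow> norm x = 1"
    "independent B" "card B = dim V" "span B = V"
    using orthonormal_basis_subspace[OF assms] by metis
  have fin: "finite B"
    using B(3) independent_imp_finite by blast
  have "norm (oproj V b) ^ 2 = (\<Sum>v\<in>B. (v \<bullet> b)^2)" for b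
  proof -
    have "norm (oproj V b) ^ 2 = oproj V b \<bullet> b"
      using oproj_self_adjoint[OF assms] by (simp add: power2_norm_eq_inner)
    then show ?thesis
      using oproj_orthonormal_expansion[OF B(1,2) fin, of b] B(5)
      by (simp add: inner_sum_left power2_eq_square inner_commute[of b])
  qed
  then have "(\<Sum>b\<in>Basis. norm (oproj V b) ^ 2) = (\<Sum>b\<in>Basis. \<Sum>v\<in>B. (v \<bullet> b)^2)"
    by simp
  also have "\<dots> = (\<Sum>v\<in>B. \<Sum>b\<in>Basis. (v \<bullet> b)^2)"
    by (rule sum.swap)
  also have "\<dots> = (\<Sum>v\<in>B. 1)"
  proof (rule sum.cong[OF refl])
    fix v assume "v \<in> B"
    have "(\<Sum>b\<in>Basis. (v \<bullet> b)^2) = v \<bullet> v"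
      by (simp add: euclidean_inner[of v v] power2_eq_square)
    then show "(\<Sum>b\<in>Basis. (v \<bullet> b)^2) = 1"
      using B(2)[OF \<open>v \<in> B\<close>] by (simp add: norm_eq_1)
  qed
  finally show ?thesis
    using B(4) by simp
qed

definition reflection :: "real ^ 'd \<Rightarrow> real ^ 'd \<Rightarrow> real ^ 'd" where
  "reflection w x = x - (2 * (x \<bullet> w) / (w \<bullet> w)) *\<^sub>R w"

lemma orthogonal_transformation_reflection: "orthogonal_transformation (reflection w)"
  unfolding orthogonal_transformation_def
proof
  show "linear (reflection w)"
    by (rule linearI) (auto simp: reflection_def algebra_simps add_divide_distrib)
  show "\<forall>u v. reflection w u \<bullet> reflection w v = u \<bullet> v"
  proof (cases "w = 0")
    case False
    then have ww: "2 / (w \<bullet> w) * (w \<bullet> w) = 2" by simp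
    have "reflection w u \<bullet> reflection w v = u \<bullet> v" for u v
    proof -
      define c where "c = 2 / (w \<bullet> w)"
      have r: "reflection w x = x - (c * (x \<bullet> w)) *\<^sub>R w" for x
        by (simp add: reflection_def c_def)
      have "reflection w u \<bullet> reflection w v =
        u \<bullet> v - 2 * c * (u \<bullet> w) * (v \<bullet> w) + c * (c * (w \<bullet> w)) * (u \<bullet> w) * (v \<bullet> w)"
        unfolding r inner_diff_left inner_diff_right inner_scaleR_left inner_scaleR_right inner_commute[of w v]
        by (simp only: algebra_simps)
      also have "c * (w \<bullet> w) = 2"
        using ww by (simp add: c_def)
      finally show ?thesis
        by simp
    qed
    then show ?thesis
      by blast
  qed (simp add: reflection_def)
qed

lemma reflection_orthogonal: "x \<bullet> w = 0 \<Longrightarrow> reflection w x = x"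
  by (simp add: reflection_def)

lemma reflection_swap:
  assumes "norm a = norm b"
  shows "reflection (a - b) a = b"
proof (cases "a = b")
  case False
  have ab: "a \<bullet> a = b \<bullet> b"
    using assms by (simp add: norm_eq)
  have ne: "((a - b) \<bullet> (a - b) = 0) = False"
    using False by simp
  have eq: "2 * (a \<bullet> (a - b)) = (a - b) \<bullet> (a - b)"
    by (simp add: algebra_simps ab inner_commute)
  have "2 * (a \<bullet> (a - b)) / ((a - b) \<bullet> (a - b)) = 1"
    by (simp only: eq divide_self_if ne if_False)
  then have "reflection (a - b) a = a - 1 *\<^sub>R (a - b)"
    unfolding reflection_def by (simp only:)
  then show ?thesis
    by simp
qed (simp add: reflection_def)

lemma linear_reflection: "linear (reflection w)"
  by (rule orthogonal_transformation_linear[OF orthogonal_transformation_reflection])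

lemma oproj_reflection:
  assumes V: "subspace V" and w: "w \<in> V \<union> orthogonal_comp V"
  shows "oproj V (reflection w x) = reflection w (oproj V x)"
proof -
  have "oproj V (reflection w x) = oproj V x - (2 * (x \<bullet> w) / (w \<bullet> w)) *\<^sub>R oproj V w"
    by (simp add: reflection_def linear_diff[OF linear_oproj[OF V]] linear_scale[OF linear_oproj[OF V]])
  also have "\<dots> = reflection w (oproj V x)"
  proof (cases "w \<in> V")
    case True
    then have "oproj V x \<bullet> w = x \<bullet> w" "oproj V w = w"
      using oproj_self_adjoint[OF V, of x w] oproj_ident[OF V, of w] by auto
    then show ?thesis
      by (simp add: reflection_def)
  next
    case False
    then have *: "\<And>v. v \<in> V \<Longrightarrow> v \<bullet> w = 0"
      using w by (auto simp: orthogonal_comp_def orthogonal_def)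
    have "oproj V w = 0"
      by (rule oproj_eqI[OF V]) (use V * in \<open>auto simp: subspace_0 orthogonal_def inner_commute\<close>)
    then show ?thesis
      using *[OF oproj_in[OF V, of x]] by (simp add: reflection_def)
  qed
  finally show ?thesis .
qed

text \<open>Reflections in vectors of \<open>V\<close> and of its complement generate the stabilizer of \<open>V\<close>, and they are
  easier to handle than its other elements.\<close>

definition stabilizer_invariant :: "(real ^ 'd) set \<Rightarrow> (real ^ 'd \<Rightarrow> 'b) \<Rightarrow> bool" where
  "stabilizer_invariant V f \<longleftrightarrow> (\<forall>w\<in>V \<union> orthogonal_comp V. \<forall>x. f (reflection w x) = f x)"

text \<open>A reflection in a vector of \<open>V\<close> moves a given vector of \<open>V\<close> to any other one of the same norm and
  fixes the complement; so only the norms of the two components of the argument matter.\<close>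

lemma stabilizer_invariant_normal_form:
  assumes V: "subspace V" and f: "stabilizer_invariant V f"
    and e: "e \<in> V" "norm e = 1" and e': "e' \<in> orthogonal_comp V" "norm e' = 1"
  shows "f x = f (norm (oproj V x) *\<^sub>R e + norm (x - oproj V x) *\<^sub>R e')"
proof -
  define a where "a = oproj V x"
  define c where "c = x - oproj V x"
  have aV: "a \<in> V"
    by (simp add: a_def oproj_in V)
  have cV: "c \<in> orthogonal_comp V"
    using oproj_in[OF subspace_orthogonal_comp, of V x] by (simp add: c_def oproj_orthogonal_comp V)
  have perp: "u \<bullet> v = 0" "v \<bullet> u = 0" if "u \<in> V" "v \<in> orthogonal_comp V" for u v
    using that by (auto simp: orthogonal_comp_def orthogonal_def inner_commute)
  define w where "w = a - norm a *\<^sub>R e"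
  define w' where "w' = c - norm c *\<^sub>R e'"
  have wV: "w \<in> V"
    by (simp add: w_def aV e V subspace_diff subspace_scale)
  have w'V: "w' \<in> orthogonal_comp V"
    by (simp add: w'_def cV e' subspace_orthogonal_comp subspace_diff subspace_scale)
  have "f x = f (reflection w (a + c))"
    using f wV by (simp add: stabilizer_invariant_def a_def c_def)
  also have "reflection w (a + c) = norm a *\<^sub>R e + c"
    using reflection_swap[of a "norm a *\<^sub>R e"] reflection_orthogonal[of c w] perp[OF wV cV] e
    by (simp add: linear_add[OF linear_reflection] w_def)
  also have "f \<dots> = f (reflection w' (norm a *\<^sub>R e + c))"
    using f w'V by (simp add: stabilizer_invariant_def)
  also have "reflection w' (norm a *\<^sub>R e + c) = norm a *\<^sub>R e + norm c *\<^sub>R e'"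
    using reflection_swap[of c "norm c *\<^sub>R e'"] reflection_orthogonal[of e w'] perp[OF e(1) w'V] e'
    by (simp add: linear_add[OF linear_reflection] linear_scale[OF linear_reflection] w'_def)
  finally show ?thesis
    by (simp add: a_def c_def)
qed

definition orthonormal_family :: "nat \<Rightarrow> (nat \<Rightarrow> real ^ 'd) \<Rightarrow> bool" where
  "orthonormal_family k a \<longleftrightarrow> (\<forall>i<k. \<forall>j<k. a i \<bullet> a j = (if i = j then 1 else 0))"

lemma orthogonal_transformation_between_orthonormal_families:
  fixes a b :: "nat \<Rightarrow> real ^ 'd"
  assumes "orthonormal_family k a" "orthonormal_family k b"
  shows "\<exists>g. orthogonal_transformation g \<and> (\<forall>i<k. g (a i) = b i)"
  using assms
proof (induction k)
  case 0
  show ?case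
    using orthogonal_transformation_id by blast
next
  case (Suc k)
  then obtain g where g: "orthogonal_transformation g" "\<And>i. i < k \<Longrightarrow> g (a i) = b i"
    by (force simp: orthonormal_family_def)
  \<comment> \<open>Both \<open>g (a k)\<close> and \<open>b k\<close> are orthogonal to the earlier \<open>b i\<close>, so the reflection that
    exchanges them does not disturb these.\<close>
  define h where "h = reflection (g (a k) - b k)"
  have gi: "g x \<bullet> g y = x \<bullet> y" for x y
    using g(1) by (simp add: orthogonal_transformation_def)
  have "h (g (a k)) = b k"
    unfolding h_def
  proof (rule reflection_swap)
    show "norm (g (a k)) = norm (b k)"
      using Suc.prems by (simp add: norm_eq gi orthonormal_family_def)
  qed
  moreover have "h (g (a i)) = b i" if "i < k" for i
  proof -
    have "b i \<bullet> g (a k) = 0"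
      using g(2)[OF that] gi[of "a i" "a k"] Suc.prems(1) that by (simp add: orthonormal_family_def)
    moreover have "b i \<bullet> b k = 0"
      using Suc.prems(2) that by (simp add: orthonormal_family_def)
    ultimately show ?thesis
      using that by (simp add: h_def g(2) reflection_orthogonal inner_diff_right)
  qed
  ultimately have "\<forall>i<Suc k. (h \<circ> g) (a i) = b i"
    by (simp add: less_Suc_eq)
  moreover have "orthogonal_transformation (h \<circ> g)"
    unfolding h_def by (intro orthogonal_transformation_compose orthogonal_transformation_reflection g)
  ultimately show ?case
    by blast
qed

lemma orthonormal_family_of_subspace:
  fixes V :: "(real ^ 'd) set"
  assumes "subspace V" "dim V = k"
  obtains a where "orthonormal_family k a" "span (a ` {..<k}) = V"
proof -
  obtain B where B: "pairwise orthogonal B" "\<And>x. x \<in> B \<Longrightarrow> norm x = 1"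
    "independent B" "card B = dim V" "span B = V"
    using orthonormal_basis_subspace[OF assms(1)] by metis
  have "finite B"
    using B(3) independent_imp_finite by blast
  then obtain a where a: "bij_betw a {..<k} B"
    using ex_bij_betw_nat_finite[of B] B(4) assms(2) by (auto simp: atLeast0LessThan)
  have "orthonormal_family k a"
    unfolding orthonormal_family_def
  proof (intro allI impI)
    fix i j assume "i < k" "j < k"
    then have "a i \<in> B" "a j \<in> B" "a i = a j \<longleftrightarrow> i = j"
      using bij_betwE[OF a] inj_on_eq_iff[OF bij_betw_imp_inj_on[OF a]] by auto
    then show "a i \<bullet> a j = (if i = j then 1 else 0)"
      using B(1,2) by (auto simp: pairwise_def orthogonal_def norm_eq_1)
  qed
  then show thesis
    using that B(5) bij_betw_imp_surj_on[OF a] by metis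
qed

lemma orthogonal_transformation_transitive:
  fixes V W :: "(real ^ 'd) set"
  assumes "V \<in> grassmannian k" "W \<in> grassmannian k"
  obtains g where "orthogonal_transformation g" "g ` V = W"
proof -
  obtain a where a: "orthonormal_family k a" "span (a ` {..<k}) = V"
    using orthonormal_family_of_subspace assms(1) unfolding grassmannian_def by auto
  obtain b where b: "orthonormal_family k b" "span (b ` {..<k}) = W"
    using orthonormal_family_of_subspace assms(2) unfolding grassmannian_def by auto
  obtain g where g: "orthogonal_transformation g" "\<And>i. i < k \<Longrightarrow> g (a i) = b i"
    using orthogonal_transformation_between_orthonormal_families[OF a(1) b(1)] by metis
  have "g ` V = span (g ` (a ` {..<k}))"
    by (simp add: linear_span_image[OF orthogonal_transformation_linear[OF g(1)]] a(2))
  also have "g ` (a ` {..<k}) = b ` {..<k}"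
    using g(2) by (force simp: image_iff)
  finally show thesis
    using that g(1) b(2) by simp
qed

lemma grassmannian_image:
  assumes "orthogonal_transformation g" "V \<in> grassmannian k"
  shows "g ` V \<in> grassmannian k"
proof -
  have "linear g" "inj g"
    using assms(1) orthogonal_transformation_linear orthogonal_transformation_inj by blast+
  then have "dim (g ` V) = dim V"
    by (intro dim_image_eq) (auto simp: inj_def inj_on_def)
  then show ?thesis
    using assms(2) linear_subspace_image[OF \<open>linear g\<close>] by (simp add: grassmannian_def)
qed

lemma orthogonal_transformation_inv_apply:
  fixes g :: "real ^ 'd \<Rightarrow> real ^ 'd"
  assumes "orthogonal_transformation g"
  shows "g (inv g x) = x" "inv g (g x) = x"
  by (rule surj_f_inv_f[OF orthogonal_transformation_surj[OF assms]],
      rule inv_f_f[OF orthogonal_transformation_inj[OF assms]])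

section \<open>Integration over the unit ball\<close>

lemma orthogonal_transformation_measurable:
  fixes g :: "'a::euclidean_space \<Rightarrow> 'a"
  assumes "orthogonal_transformation g"
  shows "g \<in> borel_measurable borel"
  by (intro borel_measurable_continuous_onI linear_continuous_on)
     (simp add: assms orthogonal_transformation_linear linear_conv_bounded_linear[symmetric])

lemma nn_integral_lborel_translate:
  fixes c :: "'a::euclidean_space"
  assumes "f \<in> borel_measurable borel"
  shows "(\<integral>\<^sup>+x. f (c + x) \<partial>lborel) = (\<integral>\<^sup>+x. f x \<partial>lborel)"
  by (subst (2) lborel_distr_plus[of c, symmetric]) (simp add: assms nn_integral_distr)

text \<open>The usual proof that translation-invariant measures are proportional. With \<open>B\<close> the unit ball, the
  integral of the indicator of \<open>x \<in> A \<and> g y \<in> B\<close> over all pairs \<open>(x, y)\<close> is the measure of \<open>A\<close> times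
  that of \<open>B\<close>. Shifting \<open>x\<close> by \<open>g y\<close> and then \<open>y\<close> by the preimage of \<open>x\<close> turns the condition into
  \<open>g y \<in> A \<and> g y - x \<in> B\<close>, which gives the measure of the preimage of \<open>A\<close> times that of a
  translate of \<open>B\<close>.\<close>

lemma distr_lborel_orthogonal:
  fixes g :: "'a::euclidean_space \<Rightarrow> 'a"
  assumes g: "orthogonal_transformation g"
  shows "distr lborel borel g = lborel"
proof (rule measure_eqI)
  note [measurable] = orthogonal_transformation_measurable[OF g]
  fix A :: "'a set" assume "A \<in> sets (distr lborel borel g)"
  then have [measurable]: "A \<in> sets borel" by simp
  let ?B = "ball 0 1 :: 'a set"
  have [measurable]: "?B \<in> sets borel" by simp
  have lg: "linear g"
    by (rule orthogonal_transformation_linear[OF g])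
  have gB: "g y \<in> ?B \<longleftrightarrow> y \<in> ?B" for y
    by (simp add: orthogonal_transformation_norm[OF g])
  have ball: "emeasure lborel (ball c 1) = emeasure lborel ?B" for c :: 'a
    by (simp add: emeasure_ball)
  have "emeasure lborel A * emeasure lborel ?B =
      (\<integral>\<^sup>+y. \<integral>\<^sup>+x. indicator A x * indicator ?B (g y) \<partial>lborel \<partial>lborel)"
  proof -
    have "indicator ?B (g y) = (indicator ?B y :: ennreal)" for y
      using gB by (simp add: indicator_def)
    then show ?thesis
      by (simp add: nn_integral_multc nn_integral_cmult nn_integral_cmult_indicator)
  qed
  also have "\<dots> = (\<integral>\<^sup>+y. \<integral>\<^sup>+x. indicator A (g y + x) * indicator ?B (g y) \<partial>lborel \<partial>lborel)"
  proof (rule nn_integral_cong)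
    fix y
    show "(\<integral>\<^sup>+x. indicator A x * indicator ?B (g y) \<partial>lborel) =
        (\<integral>\<^sup>+x. indicator A (g y + x) * indicator ?B (g y) \<partial>lborel)"
      by (rule nn_integral_lborel_translate[symmetric, where f = "\<lambda>x. indicator A x * indicator ?B (g y)"]) measurable
  qed
  also have "\<dots> = (\<integral>\<^sup>+x. \<integral>\<^sup>+y. indicator A (g y + x) * indicator ?B (g y) \<partial>lborel \<partial>lborel)"
    by (rule lborel_pair.Fubini') measurable
  also have "\<dots> = (\<integral>\<^sup>+x. \<integral>\<^sup>+y. indicator A (g y) * indicator ?B (g y - x) \<partial>lborel \<partial>lborel)"
  proof (rule nn_integral_cong)
    fix x
    have "(\<integral>\<^sup>+y. indicator A (g y + x) * indicator ?B (g y) \<partial>lborel) =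
        (\<integral>\<^sup>+y. indicator A (g (- inv g x + y) + x) * indicator ?B (g (- inv g x + y)) \<partial>lborel)"
      by (rule nn_integral_lborel_translate[symmetric, where f = "\<lambda>y. indicator A (g y + x) * indicator ?B (g y)"]) measurable
    moreover have "g (- inv g x + y) = g y - x" for y
      using orthogonal_transformation_surj[OF g]
      by (simp add: linear_diff[OF lg] surj_f_inv_f)
    ultimately show "(\<integral>\<^sup>+y. indicator A (g y + x) * indicator ?B (g y) \<partial>lborel) =
        (\<integral>\<^sup>+y. indicator A (g y) * indicator ?B (g y - x) \<partial>lborel)"
      by simp
  qed
  also have "\<dots> = (\<integral>\<^sup>+y. \<integral>\<^sup>+x. indicator A (g y) * indicator ?B (g y - x) \<partial>lborel \<partial>lborel)"
    by (rule lborel_pair.Fubini'[symmetric]) measurable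
  also have "\<dots> = (\<integral>\<^sup>+y. indicator A (g y) * emeasure lborel ?B \<partial>lborel)"
  proof (rule nn_integral_cong)
    fix y
    have "(\<integral>\<^sup>+x. indicator A (g y) * indicator ?B (g y - x) \<partial>lborel) =
        indicator A (g y) * (\<integral>\<^sup>+x. indicator ?B (g y - x) \<partial>lborel)"
      by (rule nn_integral_cmult) measurable
    also have "(\<integral>\<^sup>+x. indicator ?B (g y - x) \<partial>lborel) = (\<integral>\<^sup>+x. indicator (ball (g y) 1) x \<partial>lborel)"
    proof (rule nn_integral_cong)
      fix x
      show "indicator ?B (g y - x) = (indicator (ball (g y) 1) x :: ennreal)"
        by (simp add: indicator_def dist_norm norm_minus_commute[of x "g y"])
    qed
    finally show "(\<integral>\<^sup>+x. indicator A (g y) * indicator ?B (g y - x) \<partial>lborel) =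
        indicator A (g y) * emeasure lborel ?B"
      by (simp add: ball[of "g y"])
  qed
  also have "\<dots> = (\<integral>\<^sup>+y. indicator A (g y) \<partial>lborel) * emeasure lborel ?B"
    by (rule nn_integral_multc) measurable
  also have "(\<integral>\<^sup>+y. indicator A (g y) \<partial>lborel) = emeasure (distr lborel borel g) A"
  proof -
    have "(\<integral>\<^sup>+y. indicator A (g y) \<partial>lborel) = (\<integral>\<^sup>+x. indicator A x \<partial>distr lborel borel g)"
      by (rule nn_integral_distr[symmetric]) measurable
    then show ?thesis by simp
  qed
  finally have "emeasure lborel A * emeasure lborel ?B = emeasure (distr lborel borel g) A * emeasure lborel ?B" .
  moreover have "emeasure lborel ?B \<noteq> 0" "emeasure lborel ?B < \<top>"
    using emeasure_lborel_ball_finite[of "0::'a" 1] by (auto simp: emeasure_ball ennreal_eq_0_iff not_le unit_ball_vol_pos)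
  ultimately show "emeasure (distr lborel borel g) A = emeasure lborel A"
    by (metis ennreal_mult_cancel_left mult.commute less_irrefl)
qed simp

definition ball_integral :: "('a::euclidean_space \<Rightarrow> 'b::{banach, second_countable_topology}) \<Rightarrow> 'b" where
  "ball_integral f = (LINT x|lborel. indicator (cball 0 1) x *\<^sub>R f x)"

lemma ball_integrable:
  fixes f :: "'a::euclidean_space \<Rightarrow> 'b::{banach, second_countable_topology}"
  assumes "continuous_on UNIV f"
  shows "integrable lborel (\<lambda>x. indicator (cball 0 1) x *\<^sub>R f x)"
  using borel_integrable_compact[OF compact_cball continuous_on_subset[OF assms subset_UNIV]] .

lemma ball_integral_add:
  "continuous_on UNIV f \<Longrightarrow> continuous_on UNIV g \<Longrightarrow>
    ball_integral (\<lambda>x. f x + g x) = ball_integral f + ball_integral g"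
  by (simp add: ball_integral_def scaleR_add_right ball_integrable)

lemma ball_integral_mult:
  fixes f :: "'a::euclidean_space \<Rightarrow> 'b::{real_normed_field, banach, second_countable_topology}"
  shows "ball_integral (\<lambda>x. c * f x) = c * ball_integral f"
  by (simp add: ball_integral_def flip: integral_mult_right_zero)

lemma ball_integral_sum:
  assumes "finite I" "\<And>i. i \<in> I \<Longrightarrow> continuous_on UNIV (f i)"
  shows "ball_integral (\<lambda>x. \<Sum>i\<in>I. f i x) = (\<Sum>i\<in>I. ball_integral (f i))"
proof -
  have "ball_integral (\<lambda>x. \<Sum>i\<in>I. f i x) = (LINT x|lborel. (\<Sum>i\<in>I. indicator (cball 0 1) x *\<^sub>R f i x))"
    unfolding ball_integral_def scaleR_sum_right ..
  also have "\<dots> = (\<Sum>i\<in>I. ball_integral (f i))"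
    unfolding ball_integral_def by (rule Bochner_Integration.integral_sum) (use assms ball_integrable in blast)
  finally show ?thesis .
qed

lemma ball_integral_orthogonal:
  fixes f :: "'a::euclidean_space \<Rightarrow> 'b::{banach, second_countable_topology}" and g :: "'a \<Rightarrow> 'a"
  assumes f: "continuous_on UNIV f" and g: "orthogonal_transformation g"
  shows "ball_integral (\<lambda>x. f (g x)) = ball_integral f"
proof -
  have "ball_integral f = (LINT x|distr lborel borel g. indicator (cball 0 1) x *\<^sub>R f x)"
    by (simp add: ball_integral_def distr_lborel_orthogonal[OF g])
  also have "\<dots> = (LINT x|lborel. indicator (cball 0 1) (g x) *\<^sub>R f (g x))"
    using orthogonal_transformation_measurable[OF g] borel_measurable_continuous_onI[OF f]
    by (subst integral_distr) (auto intro!: borel_measurable_scaleR borel_measurable_indicator)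
  also have "\<dots> = ball_integral (\<lambda>x. f (g x))"
    by (simp add: ball_integral_def indicator_def orthogonal_transformation_norm[OF g])
  finally show ?thesis by simp
qed

lemma ball_integral_nonneg:
  fixes f :: "'a::euclidean_space \<Rightarrow> real"
  shows "(\<And>x. 0 \<le> f x) \<Longrightarrow> 0 \<le> ball_integral f"
  unfolding ball_integral_def by (intro Bochner_Integration.integral_nonneg) auto

lemma ball_integral_eq_0D:
  fixes f :: "'a::euclidean_space \<Rightarrow> real"
  assumes f: "continuous_on UNIV f" "\<And>x. 0 \<le> f x" and 0: "ball_integral f = 0" and x: "norm x < 1"
  shows "f x = 0"
proof (rule ccontr)
  assume "f x \<noteq> 0"
  then have "x \<in> ball 0 1 \<inter> {x. 0 < f x}"
    using f(2)[of x] x by auto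
  moreover have "open (ball 0 1 \<inter> {x. 0 < f x})"
    by (intro open_Int open_ball open_Collect_less f continuous_intros)
  ultimately have "\<not> negligible (ball 0 1 \<inter> {x. 0 < f x})"
    using open_not_negligible by blast
  moreover have "AE x in lborel. indicator (cball 0 1) x *\<^sub>R f x = 0"
    using 0 ball_integrable[OF f(1)] unfolding ball_integral_def
    by (subst (asm) integral_nonneg_eq_0_iff_AE) (auto simp: f)
  then have "AE x in lebesgue. x \<notin> ball 0 1 \<inter> {x. 0 < f x}"
    by (intro AE_completion) (auto elim!: eventually_mono simp: indicator_def)
  then have "negligible (ball 0 1 \<inter> {x. 0 < f x})"
    by (simp add: negligible_iff_null_sets completion.AE_iff_null_sets AE_iff_null_sets null_sets_completion_iff2 Int_def)
  ultimately show False by blast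
qed

definition ball_inner :: "('a::euclidean_space \<Rightarrow> complex) \<Rightarrow> ('a \<Rightarrow> complex) \<Rightarrow> complex" where
  "ball_inner f g = ball_integral (\<lambda>x. f x * cnj (g x))"

lemma ball_inner_add_left:
  assumes "continuous_on UNIV f" "continuous_on UNIV f'" "continuous_on UNIV g"
  shows "ball_inner (\<lambda>x. f x + f' x) g = ball_inner f g + ball_inner f' g"
  unfolding ball_inner_def
  by (subst ball_integral_add[symmetric]) (auto intro!: continuous_intros assms simp: algebra_simps)

lemma ball_inner_mult_left: "ball_inner (\<lambda>x. c * f x) g = c * ball_inner f g"
  unfolding ball_inner_def by (subst ball_integral_mult[symmetric]) (simp add: algebra_simps)

lemma ball_inner_commute: "ball_inner g f = cnj (ball_inner f g)"
  unfolding ball_inner_def ball_integral_def Bochner_Integration.integral_cnj[symmetric]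
  by (simp add: scaleR_conv_of_real algebra_simps)

lemma ball_inner_add_right:
  assumes "continuous_on UNIV f" "continuous_on UNIV f'" "continuous_on UNIV g"
  shows "ball_inner g (\<lambda>x. f x + f' x) = ball_inner g f + ball_inner g f'"
  using ball_inner_add_left[OF assms] by (simp add: ball_inner_commute[of g])

lemma ball_inner_mult_right: "ball_inner g (\<lambda>x. c * f x) = cnj c * ball_inner g f"
  by (simp add: ball_inner_commute[of g] ball_inner_mult_left)

lemma ball_inner_sum_left:
  assumes "finite I" "\<And>i. i \<in> I \<Longrightarrow> continuous_on UNIV (f i)" "continuous_on UNIV g"
  shows "ball_inner (\<lambda>x. \<Sum>i\<in>I. f i x) g = (\<Sum>i\<in>I. ball_inner (f i) g)"
  unfolding ball_inner_def
  by (subst ball_integral_sum[symmetric]) (auto intro!: continuous_intros assms simp: sum_distrib_right)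

lemma ball_inner_sum_right:
  assumes "finite I" "\<And>i. i \<in> I \<Longrightarrow> continuous_on UNIV (f i)" "continuous_on UNIV g"
  shows "ball_inner g (\<lambda>x. \<Sum>i\<in>I. f i x) = (\<Sum>i\<in>I. ball_inner g (f i))"
  using ball_inner_sum_left[OF assms] by (simp add: ball_inner_commute[of g])

lemma ball_inner_orthogonal:
  fixes g :: "'a::euclidean_space \<Rightarrow> 'a"
  assumes "continuous_on UNIV f" "continuous_on UNIV h" "orthogonal_transformation g"
  shows "ball_inner (\<lambda>x. f (g x)) (\<lambda>x. h (g x)) = ball_inner f h"
  unfolding ball_inner_def
  by (rule ball_integral_orthogonal[where f = "\<lambda>x. f x * cnj (h x)"]) (auto intro!: continuous_intros assms)

lemma ball_inner_self:
  "ball_inner f f = of_real (ball_integral (\<lambda>x. norm (f x) ^ 2))"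
proof -
  have "indicator (cball 0 1) x *\<^sub>R (f x * cnj (f x)) =
      complex_of_real (indicator (cball 0 1) x *\<^sub>R norm (f x) ^ 2)" for x
    by (simp add: complex_norm_square[symmetric] scaleR_conv_of_real)
  then show ?thesis
    unfolding ball_inner_def ball_integral_def by (simp only: integral_complex_of_real)
qed

lemma ball_inner_self_eq_0D:
  assumes f: "continuous_on UNIV f" and 0: "ball_inner f f = 0" and x: "norm x < 1"
  shows "f x = 0"
proof -
  have "ball_integral (\<lambda>x. norm (f x) ^ 2) = 0"
    using 0 by (simp add: ball_inner_self)
  then have "norm (f x) ^ 2 = 0"
    by (intro ball_integral_eq_0D[where f = "\<lambda>x. norm (f x) ^ 2"] continuous_intros f x) auto
  then show ?thesis by simp
qed

text \<open>The Riesz representation theorem for finite-dimensional spaces of functions. Instead of a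
  basis, the induction carries a finite set of functions whose span contains the space; this lets
  the theorem be applied to subspaces that are only given by a closure property.\<close>

lemma finite_dimensional_riesz:
  fixes b :: "'i \<Rightarrow> 'a::euclidean_space \<Rightarrow> complex" and F :: "('a \<Rightarrow> complex) set"
  assumes "finite I"
    and "(\<lambda>x. 0) \<in> F"
    and "\<And>f g. f \<in> F \<Longrightarrow> g \<in> F \<Longrightarrow> (\<lambda>x. f x + g x) \<in> F"
    and "\<And>c f. f \<in> F \<Longrightarrow> (\<lambda>x. c * f x) \<in> F"
    and "\<And>f. f \<in> F \<Longrightarrow> continuous_on UNIV f"
    and "\<And>f. f \<in> F \<Longrightarrow> ball_inner f f = 0 \<Longrightarrow> f = (\<lambda>x. 0)"
    and "\<And>f. f \<in> F \<Longrightarrow> \<exists>c. f = (\<lambda>x. \<Sum>i\<in>I. c i * b i x)"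
    and "\<And>f g. f \<in> F \<Longrightarrow> g \<in> F \<Longrightarrow> L (\<lambda>x. f x + g x) = L f + L g"
    and "\<And>c f. f \<in> F \<Longrightarrow> L (\<lambda>x. c * f x) = c * L f"
  shows "\<exists>n\<in>F. \<forall>f\<in>F. L f = ball_inner f n"
  using assms
proof (induction I arbitrary: F L rule: finite_induct)
  case empty
  have "f = (\<lambda>x. 0)" if "f \<in> F" for f
    using empty(6)[OF that] by auto
  moreover have "L (\<lambda>x. 0) = 0"
    using empty(8)[of "\<lambda>x. 0" 0] empty(1) by simp
  moreover have "ball_inner (\<lambda>x. 0) (\<lambda>x. 0 :: complex) = 0"
    by (simp add: ball_inner_self ball_integral_def)
  ultimately show ?case
    using empty(1) by metis
next
  case (insert i I)
  note zero = insert.prems(1) and add = insert.prems(2) and scale = insert.prems(3)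
    and cont = insert.prems(4) and definite = insert.prems(5) and spanned = insert.prems(6)
    and Ladd = insert.prems(7) and Lscale = insert.prems(8)
  define F' where "F' = {f \<in> F. \<exists>c. f = (\<lambda>x. \<Sum>i\<in>I. c i * b i x)}"
  have sub: "f \<in> F" if "f \<in> F'" for f
    using that by (simp add: F'_def)
  have zero': "(\<lambda>x. 0) \<in> F'"
    unfolding F'_def using zero by (auto intro!: exI[of _ "\<lambda>_. 0"])
  have add': "(\<lambda>x. f x + g x) \<in> F'" if fg: "f \<in> F'" "g \<in> F'" for f g
  proof -
    obtain c where "f = (\<lambda>x. \<Sum>i\<in>I. c i * b i x)"
      using fg(1) unfolding F'_def by blast
    moreover obtain d where "g = (\<lambda>x. \<Sum>i\<in>I. d i * b i x)"
      using fg(2) unfolding F'_def by blast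
    ultimately have "(\<lambda>x. f x + g x) = (\<lambda>x. \<Sum>i\<in>I. (c i + d i) * b i x)"
      by (simp add: sum.distrib algebra_simps)
    moreover have "(\<lambda>x. f x + g x) \<in> F"
      using that by (intro add sub)
    ultimately show ?thesis
      unfolding F'_def mem_Collect_eq by (intro conjI exI)
  qed
  have scale': "(\<lambda>x. a * f x) \<in> F'" if f: "f \<in> F'" for f a
  proof -
    obtain c where "f = (\<lambda>x. \<Sum>i\<in>I. c i * b i x)"
      using f unfolding F'_def by blast
    then have "(\<lambda>x. a * f x) = (\<lambda>x. \<Sum>i\<in>I. (a * c i) * b i x)"
      by (simp add: sum_distrib_left algebra_simps)
    moreover have "(\<lambda>x. a * f x) \<in> F"
      using that by (intro scale sub)
    ultimately show ?thesis
      unfolding F'_def mem_Collect_eq by (intro conjI exI)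
  qed
  have IH: "\<exists>n\<in>F'. \<forall>f\<in>F'. M f = ball_inner f n"
    if "\<And>f g. f \<in> F' \<Longrightarrow> g \<in> F' \<Longrightarrow> M (\<lambda>x. f x + g x) = M f + M g"
      "\<And>c f. f \<in> F' \<Longrightarrow> M (\<lambda>x. c * f x) = c * M f" for M
  proof (rule insert.IH)
    show "\<exists>c. f = (\<lambda>x. \<Sum>i\<in>I. c i * b i x)" if "f \<in> F'" for f
      using that by (simp add: F'_def)
  qed (use zero' add' scale' sub cont definite that in blast)+
  obtain n' where n': "n' \<in> F'" "\<And>f. f \<in> F' \<Longrightarrow> L f = ball_inner f n'"
    using IH[of L] sub Ladd Lscale by metis
  show ?case
  proof (cases "F \<subseteq> F'")
    case True
    then show ?thesis
      using n' sub by blast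
  next
    case False
    then obtain g where g: "g \<in> F" "g \<notin> F'" by blast
    obtain d where d: "g = (\<lambda>x. \<Sum>i\<in>insert i I. d i * b i x)"
      using spanned[OF g(1)] by blast
    have di: "d i \<noteq> 0"
    proof
      assume "d i = 0"
      then have "g = (\<lambda>x. \<Sum>i\<in>I. d i * b i x)"
        using d insert.hyps by simp
      then show False
        using g by (auto simp: F'_def)
    qed
    have "\<exists>p\<in>F'. \<forall>f\<in>F'. ball_inner f g = ball_inner f p"
      by (rule IH) (simp_all add: ball_inner_add_left ball_inner_mult_left cont sub g)
    then obtain p where p: "p \<in> F'" "\<And>f. f \<in> F' \<Longrightarrow> ball_inner f g = ball_inner f p"
      by blast
    define u where "u = (\<lambda>x. g x + (-1) * p x)"
    have u: "u \<in> F"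
      unfolding u_def by (intro add scale g sub p)
    have u0: "ball_inner f u = 0" if "f \<in> F'" for f
    proof -
      have "continuous_on UNIV (\<lambda>x. - 1 * p x)"
        by (intro cont scale sub p)
      then show ?thesis
        unfolding u_def using that p ball_inner_mult_right[of f "-1" p]
        by (subst ball_inner_add_right) (simp_all add: cont g sub)
    qed
    have uu: "ball_inner u u \<noteq> 0"
    proof
      assume "ball_inner u u = 0"
      then have "u x = 0" for x
        using definite[OF u] by metis
      then have "g = p"
        by (auto simp: u_def fun_eq_iff)
      then show False
        using p(1) g(2) by simp
    qed
    define a where "a = cnj (L u / ball_inner u u)"
    define n where "n = (\<lambda>x. n' x + a * u x)"
    have nF: "n \<in> F"
      unfolding n_def by (intro add scale u sub n')
    have inner_n: "ball_inner f n = ball_inner f n' + cnj a * ball_inner f u" if "f \<in> F" for f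
    proof -
      have "continuous_on UNIV (\<lambda>x. a * u x)"
        by (intro cont scale u)
      then show ?thesis
        unfolding n_def using that
        by (subst ball_inner_add_right) (simp_all add: cont sub n' ball_inner_mult_right)
    qed
    have "L f = ball_inner f n" if f: "f \<in> F" for f
    proof -
      obtain c where c: "f = (\<lambda>x. \<Sum>i\<in>insert i I. c i * b i x)"
        using spanned[OF f] by blast
      define t where "t = c i / d i"
      define f' where "f' = (\<lambda>x. f x + (-t) * g x)"
      have "f' = (\<lambda>x. \<Sum>j\<in>insert i I. (c j - t * d j) * b j x)"
        unfolding f'_def c d
        by (simp only: sum_distrib_left sum.distrib[symmetric]) (simp add: algebra_simps)
      also have "\<dots> = (\<lambda>x. \<Sum>j\<in>I. (c j - t * d j) * b j x)"
        using insert.hyps di by (simp add: t_def)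
      finally have "f' \<in> F'"
        unfolding F'_def f'_def using add[OF f scale[OF g(1), of "-t"]] by auto
      define f'' where "f'' = (\<lambda>x. f' x + t * p x)"
      have f'': "f'' \<in> F'"
        unfolding f''_def by (intro add' scale' p \<open>f' \<in> F'\<close>)
      have fdec: "f = (\<lambda>x. f'' x + t * u x)"
        by (simp add: f''_def f'_def u_def algebra_simps fun_eq_iff)
      have "L f = L f'' + t * L u"
        unfolding fdec by (simp add: Ladd Lscale sub f'' u scale)
      moreover have "ball_inner f n = ball_inner f'' n + t * ball_inner u n"
      proof -
        have "continuous_on UNIV (\<lambda>x. t * u x)"
          by (intro cont scale u)
        then show ?thesis
          unfolding fdec by (simp add: ball_inner_add_left cont sub f'' nF ball_inner_mult_left)
      qed
      moreover have "ball_inner f'' n = L f''"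
        using inner_n[OF sub[OF f'']] u0[OF f''] n'(2)[OF f''] by simp
      moreover have "ball_inner u n = L u"
        using inner_n[OF u] u0[OF n'(1)] uu by (simp add: ball_inner_commute[of u n'] a_def)
      ultimately show ?thesis by simp
    qed
    then show ?thesis
      using nF by blast
  qed
qed

section \<open>Polynomial functions\<close>

text \<open>Monomials are indexed by lists of basis vectors: products correspond to concatenation, and the lists
  of a given length form a finite set.\<close>

definition list_monomial :: "'a::euclidean_space list \<Rightarrow> 'a \<Rightarrow> real" where
  "list_monomial bs x = (\<Prod>b\<leftarrow>bs. x \<bullet> b)"

lemma list_monomial_simps [simp]:
  "list_monomial [] x = 1"
  "list_monomial (b # bs) x = (x \<bullet> b) * list_monomial bs x"
  "list_monomial (as @ bs) x = list_monomial as x * list_monomial bs x"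
  by (simp_all add: list_monomial_def)

lemma list_monomial_scaleR: "list_monomial bs (t *\<^sub>R x) = t ^ length bs * list_monomial bs x"
  by (induction bs) auto

lemma real_polynomial_function_list_monomials:
  fixes f :: "'a::euclidean_space \<Rightarrow> real"
  assumes "real_polynomial_function f"
  shows "\<exists>ps. (\<forall>(c, bs)\<in>set ps. set bs \<subseteq> Basis) \<and> f = (\<lambda>x. \<Sum>(c, bs)\<leftarrow>ps. c * list_monomial bs x)"
  using assms
proof (induction f rule: real_polynomial_function.induct)
  case (linear f)
  obtain xs :: "'a list" where xs: "set xs = Basis" "distinct xs"
    using finite_distinct_list[OF finite_Basis] by blast
  have "f = (\<lambda>x. \<Sum>(c, bs)\<leftarrow>map (\<lambda>b. (f b, [b])) xs. c * list_monomial bs x)"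
  proof
    fix x
    have "f x = f (\<Sum>b\<in>Basis. (x \<bullet> b) *\<^sub>R b)"
      by (simp add: euclidean_representation)
    also have "\<dots> = (\<Sum>b\<in>Basis. f b * (x \<bullet> b))"
      using linear by (simp add: linear_sum[OF bounded_linear.linear] linear_scale[OF bounded_linear.linear] mult.commute)
    also have "\<dots> = (\<Sum>b\<leftarrow>xs. f b * (x \<bullet> b))"
      using xs by (simp add: sum_list_distinct_conv_sum_set)
    finally show "f x = (\<Sum>(c, bs)\<leftarrow>map (\<lambda>b. (f b, [b])) xs. c * list_monomial bs x)"
      by (simp add: o_def)
  qed
  then show ?case
    using xs by (intro exI[of _ "map (\<lambda>b. (f b, [b])) xs"]) auto
next
  case (const c)
  show ?case
    by (rule exI[of _ "[(c, [])]"]) auto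
next
  case (add f g)
  then obtain ps qs where "\<forall>(c, bs)\<in>set ps. set bs \<subseteq> Basis" "f = (\<lambda>x. \<Sum>(c, bs)\<leftarrow>ps. c * list_monomial bs x)"
    "\<forall>(c, bs)\<in>set qs. set bs \<subseteq> Basis" "g = (\<lambda>x. \<Sum>(c, bs)\<leftarrow>qs. c * list_monomial bs x)"
    by blast
  then show ?case
    by (intro exI[of _ "ps @ qs"]) auto
next
  case (mult f g)
  then obtain ps qs where pq: "\<forall>(c, bs)\<in>set ps. set bs \<subseteq> Basis" "f = (\<lambda>x. \<Sum>(c, bs)\<leftarrow>ps. c * list_monomial bs x)"
    "\<forall>(c, bs)\<in>set qs. set bs \<subseteq> Basis" "g = (\<lambda>x. \<Sum>(c, bs)\<leftarrow>qs. c * list_monomial bs x)"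
    by blast
  let ?m = "\<lambda>(c, as) (d, bs). (c * d, as @ bs)"
  have row: "sum_list (map ((\<lambda>(c, bs). c * list_monomial bs x) \<circ> (\<lambda>(d, bs). (c * d, as @ bs))) qs) =
      c * (list_monomial as x * (\<Sum>(c, bs)\<leftarrow>qs. c * list_monomial bs x))" for c x and as :: "'a list"
    by (induction qs) (auto simp: algebra_simps split: prod.splits)
  have "(\<Sum>(c, bs)\<leftarrow>concat (map (\<lambda>p. map (?m p) qs) ps). c * list_monomial bs x) =
      (\<Sum>(c, bs)\<leftarrow>ps. c * list_monomial bs x) * (\<Sum>(c, bs)\<leftarrow>qs. c * list_monomial bs x)" for x
    by (induction ps) (auto simp: row algebra_simps split: prod.splits)
  then show ?case
    using pq by (intro exI[of _ "concat (map (\<lambda>p. map (?m p) qs) ps)"]) fastforce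
qed

lemma complex_poly_eq_on_reals:
  fixes p q :: "complex poly" and S :: "real set"
  assumes "infinite S" and "\<And>t. t \<in> S \<Longrightarrow> poly p (of_real t) = poly q (of_real t)"
  shows "p = q"
proof (rule ccontr)
  assume "p \<noteq> q"
  then have "finite {z. poly (p - q) z = 0}"
    by (intro poly_roots_finite) auto
  moreover have "complex_of_real ` S \<subseteq> {z. poly (p - q) z = 0}"
    using assms(2) by auto
  ultimately have "finite (complex_of_real ` S)"
    using finite_subset by blast
  then have "finite S"
    by (rule finite_imageD) (simp add: inj_on_def)
  then show False
    using assms(1) by blast
qed

definition homogeneous_polynomial :: "nat \<Rightarrow> (real ^ 'd \<Rightarrow> complex) \<Rightarrow> bool" where
  "homogeneous_polynomial m h \<longleftrightarrow>
     polynomial_function h \<and> (\<forall>c x. h (c *\<^sub>R x) = of_real c ^ m * h x)"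

text \<open>This is the finite dimension of the space of forms of degree \<open>m\<close>.\<close>

lemma homogeneous_polynomial_list_monomials:
  assumes "homogeneous_polynomial m h"
  shows "\<exists>c. h = (\<lambda>x. \<Sum>bs | set bs \<subseteq> Basis \<and> length bs = m. c bs * of_real (list_monomial bs x))"
proof -
  have "bounded_linear Re" "bounded_linear Im"
    by (simp_all add: bounded_linear_Re bounded_linear_Im)
  then have "real_polynomial_function (\<lambda>x. Re (h x))" and Im: "real_polynomial_function (\<lambda>x. Im (h x))"
    using assms by (auto simp: homogeneous_polynomial_def polynomial_function_def o_def)
  then obtain ps where
    ps: "\<forall>(c, bs)\<in>set ps. set bs \<subseteq> Basis" "(\<lambda>x. Re (h x)) = (\<lambda>x. \<Sum>(c, bs)\<leftarrow>ps. c * list_monomial bs x)"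
    using real_polynomial_function_list_monomials by blast
  obtain qs where
    qs: "\<forall>(c, bs)\<in>set qs. set bs \<subseteq> Basis" "(\<lambda>x. Im (h x)) = (\<lambda>x. \<Sum>(c, bs)\<leftarrow>qs. c * list_monomial bs x)"
    using real_polynomial_function_list_monomials[OF Im] by blast
  define rs where "rs = map (\<lambda>(c, bs). (complex_of_real c, bs)) ps @ map (\<lambda>(c, bs). (\<i> * of_real c, bs)) qs"
  have rs: "\<forall>(c, bs)\<in>set rs. set bs \<subseteq> Basis"
    using ps(1) qs(1) by (auto simp: rs_def)
  have 1: "(\<Sum>(c, bs)\<leftarrow>map (\<lambda>(c, bs). (complex_of_real c, bs)) ps. c * of_real (list_monomial bs x)) =
      of_real (\<Sum>(c, bs)\<leftarrow>ps. c * list_monomial bs x)" for x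
    by (induction ps) auto
  have 2: "(\<Sum>(c, bs)\<leftarrow>map (\<lambda>(c, bs). (\<i> * complex_of_real c, bs)) qs. c * of_real (list_monomial bs x)) =
      \<i> * of_real (\<Sum>(c, bs)\<leftarrow>qs. c * list_monomial bs x)" for x
    by (induction qs) (auto simp: algebra_simps)
  have h: "h x = (\<Sum>(c, bs)\<leftarrow>rs. c * of_real (list_monomial bs x))" for x
  proof -
    have "h x = of_real (Re (h x)) + \<i> * of_real (Im (h x))"
      by (rule complex_eq)
    then show ?thesis
      using fun_cong[OF ps(2), of x] fun_cong[OF qs(2), of x] by (simp only: rs_def map_append sum_list_append 1 2)
  qed
  \<comment> \<open>Comparing the powers of \<open>t\<close> in \<open>h (t x)\<close> leaves only the monomials of degree \<open>m\<close>.\<close>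
  have hm: "h x = (\<Sum>(c, bs)\<leftarrow>rs. if length bs = m then c * of_real (list_monomial bs x) else 0)" for x
  proof -
    define P where "P = (\<Sum>(c, bs)\<leftarrow>rs. monom (c * complex_of_real (list_monomial bs x)) (length bs))"
    have "poly (\<Sum>(c, bs)\<leftarrow>rs'. monom (c * complex_of_real (list_monomial bs x)) (length bs)) (of_real t) =
      (\<Sum>(c, bs)\<leftarrow>rs'. c * of_real (list_monomial bs (t *\<^sub>R x)))" for t rs'
      by (induction rs') (auto simp: poly_monom list_monomial_scaleR algebra_simps)
    then have "poly P (of_real t) = poly (monom (h x) m) (of_real t)" for t
      using assms by (simp add: P_def poly_monom homogeneous_polynomial_def mult.commute flip: h)
    then have "P = monom (h x) m"
      by (intro complex_poly_eq_on_reals[OF infinite_UNIV_char_0]) simp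
    then have "h x = coeff P m"
      by simp
    also have "coeff (\<Sum>(c, bs)\<leftarrow>rs'. monom (c * complex_of_real (list_monomial bs x)) (length bs)) m =
      (\<Sum>(c, bs)\<leftarrow>rs'. if length bs = m then c * of_real (list_monomial bs x) else 0)" for rs'
      by (induction rs') auto
    then have "coeff P m = (\<Sum>(c, bs)\<leftarrow>rs. if length bs = m then c * of_real (list_monomial bs x) else 0)"
      unfolding P_def .
    finally show ?thesis .
  qed
  have fin: "finite {bs :: (real ^ 'a) list. set bs \<subseteq> Basis \<and> length bs = m}"
    by (rule finite_lists_length_eq) simp
  have "\<exists>c. \<forall>x. (\<Sum>(c, bs)\<leftarrow>rs'. if length bs = m then c * of_real (list_monomial bs x) else 0) =
      (\<Sum>bs | set bs \<subseteq> Basis \<and> length bs = m. c bs * complex_of_real (list_monomial bs x))"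
    if "\<forall>(c, bs)\<in>set rs'. set bs \<subseteq> Basis" for rs' :: "(complex \<times> (real ^ 'a) list) list"
    using that
  proof (induction rs')
    case Nil
    show ?case
      by (rule exI[of _ "\<lambda>_. 0"]) simp
  next
    case (Cons r rs')
    obtain d ds where r: "r = (d, ds)" "set ds \<subseteq> Basis"
      using Cons.prems by (cases r) auto
    obtain c where c: "\<And>x. (\<Sum>(c, bs)\<leftarrow>rs'. if length bs = m then c * of_real (list_monomial bs x) else 0) =
      (\<Sum>bs | set bs \<subseteq> Basis \<and> length bs = m. c bs * complex_of_real (list_monomial bs x))"
      using Cons.IH Cons.prems by auto
    show ?case
    proof (cases "length ds = m")
      case True
      have *: "(\<Sum>bs | set bs \<subseteq> Basis \<and> length bs = m. (c bs + (if bs = ds then d else 0)) * complex_of_real (list_monomial bs x))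
        = (\<Sum>bs | set bs \<subseteq> Basis \<and> length bs = m. c bs * complex_of_real (list_monomial bs x)) +
          d * complex_of_real (list_monomial ds x)" for x
      proof -
        have "(\<Sum>bs | set bs \<subseteq> Basis \<and> length bs = m. if bs = ds then d * complex_of_real (list_monomial ds x) else 0)
          = d * complex_of_real (list_monomial ds x)"
          using fin r True by simp
        moreover have "(\<Sum>bs | set bs \<subseteq> Basis \<and> length bs = m. (c bs + (if bs = ds then d else 0)) * complex_of_real (list_monomial bs x))
          = (\<Sum>bs | set bs \<subseteq> Basis \<and> length bs = m. c bs * complex_of_real (list_monomial bs x)) +
            (\<Sum>bs | set bs \<subseteq> Basis \<and> length bs = m. if bs = ds then d * complex_of_real (list_monomial ds x) else 0)"
          unfolding sum.distrib[symmetric] by (rule sum.cong) (auto simp: algebra_simps)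
        ultimately show ?thesis by simp
      qed
      show ?thesis
        using r True c * by (intro exI[of _ "\<lambda>bs. c bs + (if bs = ds then d else 0)"]) simp
    qed (use r c in auto)
  qed
  from this[OF rs] obtain c where
    "\<And>x. (\<Sum>(c, bs)\<leftarrow>rs. if length bs = m then c * of_real (list_monomial bs x) else 0) =
      (\<Sum>bs | set bs \<subseteq> Basis \<and> length bs = m. c bs * complex_of_real (list_monomial bs x))"
    by blast
  then show ?thesis
    unfolding fun_eq_iff hm by (intro exI[of _ c]) blast
qed

lemma list_monomial_bihomogeneous:
  "\<exists>a. \<forall>\<alpha> \<beta>. list_monomial bs (\<alpha> *\<^sub>R u + \<beta> *\<^sub>R w) = (\<Sum>j\<le>length bs. a j * \<alpha> ^ j * \<beta> ^ (length bs - j))"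
proof (induction bs)
  case Nil
  show ?case
    by (rule exI[of _ "\<lambda>_. 1"]) simp
next
  case (Cons b bs)
  then obtain a where a: "\<And>\<alpha> \<beta>. list_monomial bs (\<alpha> *\<^sub>R u + \<beta> *\<^sub>R w) =
      (\<Sum>j\<le>length bs. a j * \<alpha> ^ j * \<beta> ^ (length bs - j))"
    by blast
  let ?n = "length bs"
  define a' where "a' j = (case j of 0 \<Rightarrow> 0 | Suc i \<Rightarrow> (u \<bullet> b) * a i) + (if j \<le> ?n then (w \<bullet> b) * a j else 0)" for j
  have "list_monomial (b # bs) (\<alpha> *\<^sub>R u + \<beta> *\<^sub>R w) = (\<Sum>j\<le>length (b # bs). a' j * \<alpha> ^ j * \<beta> ^ (length (b # bs) - j))" for \<alpha> \<beta>
  proof -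
    have "(\<Sum>j\<le>Suc ?n. (case j of 0 \<Rightarrow> 0 | Suc i \<Rightarrow> (u \<bullet> b) * a i) * \<alpha> ^ j * \<beta> ^ (Suc ?n - j)) =
        \<alpha> * (u \<bullet> b) * (\<Sum>j\<le>?n. a j * \<alpha> ^ j * \<beta> ^ (?n - j))"
      by (simp add: sum.atMost_Suc_shift sum_distrib_left algebra_simps del: sum.atMost_Suc)
    moreover have "(\<Sum>j\<le>Suc ?n. (if j \<le> ?n then (w \<bullet> b) * a j else 0) * \<alpha> ^ j * \<beta> ^ (Suc ?n - j)) =
        \<beta> * (w \<bullet> b) * (\<Sum>j\<le>?n. a j * \<alpha> ^ j * \<beta> ^ (?n - j))"
      by (simp add: sum_distrib_left Suc_diff_le algebra_simps)
    ultimately show ?thesis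
      unfolding a'_def list_monomial_simps a
      by (simp add: sum.distrib inner_add_left distrib_right del: sum.atMost_Suc)
  qed
  then show ?case by blast
qed

lemma homogeneous_polynomial_on_plane:
  assumes "homogeneous_polynomial m h"
  shows "\<exists>a. \<forall>\<alpha> \<beta>. h (\<alpha> *\<^sub>R u + \<beta> *\<^sub>R w) = (\<Sum>j\<le>m. a j * of_real (\<alpha> ^ j * \<beta> ^ (m - j)))"
proof -
  let ?I = "{bs :: (real ^ 'a) list. set bs \<subseteq> Basis \<and> length bs = m}"
  obtain c where c: "h = (\<lambda>x. \<Sum>bs\<in>?I. c bs * of_real (list_monomial bs x))"
    using homogeneous_polynomial_list_monomials[OF assms] by blast
  obtain a where a: "\<And>bs \<alpha> \<beta>. list_monomial bs (\<alpha> *\<^sub>R u + \<beta> *\<^sub>R w) =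
      (\<Sum>j\<le>length bs. a bs j * \<alpha> ^ j * \<beta> ^ (length bs - j))"
    using list_monomial_bihomogeneous[of _ u w] by metis
  have "h (\<alpha> *\<^sub>R u + \<beta> *\<^sub>R w) = (\<Sum>j\<le>m. (\<Sum>bs\<in>?I. c bs * of_real (a bs j)) * of_real (\<alpha> ^ j * \<beta> ^ (m - j)))" for \<alpha> \<beta>
  proof -
    have "h (\<alpha> *\<^sub>R u + \<beta> *\<^sub>R w) = (\<Sum>bs\<in>?I. \<Sum>j\<le>m. c bs * of_real (a bs j) * of_real (\<alpha> ^ j * \<beta> ^ (m - j)))"
      unfolding c by (rule sum.cong) (auto simp: a sum_distrib_left algebra_simps)
    also have "\<dots> = (\<Sum>j\<le>m. \<Sum>bs\<in>?I. c bs * of_real (a bs j) * of_real (\<alpha> ^ j * \<beta> ^ (m - j)))"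
      by (rule sum.swap)
    finally show ?thesis
      by (simp add: sum_distrib_right)
  qed
  then show ?thesis
    by (intro exI[of _ "\<lambda>j. \<Sum>bs\<in>?I. c bs * of_real (a bs j)"]) simp
qed

section \<open>The Laplacian\<close>

text \<open>The witnesses \<open>G\<close> and \<open>H\<close> are the gradient and the Hessian. In a product, the Hessian receives the
  two mixed terms built from the gradients of the factors.\<close>

lemma real_polynomial_function_hessian:
  fixes f :: "real ^ 'd \<Rightarrow> real"
  assumes "real_polynomial_function f"
  shows "\<exists>G H. (\<forall>x. linear (H x)) \<and>
    (\<forall>x v t. ((\<lambda>s. f (x + s *\<^sub>R v)) has_real_derivative (G (x + t *\<^sub>R v) \<bullet> v)) (at t) \<and>
       ((\<lambda>s. G (x + s *\<^sub>R v) \<bullet> v) has_real_derivative (v \<bullet> H (x + t *\<^sub>R v) v)) (at t))"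
  using assms
proof (induction f rule: real_polynomial_function.induct)
  case (linear f)
  then have "linear f"
    by (rule bounded_linear.linear)
  define G where "G = (\<Sum>b\<in>Basis. f b *\<^sub>R b)"
  have f: "f v = G \<bullet> v" for v
  proof -
    have "f v = f (\<Sum>b\<in>Basis. (v \<bullet> b) *\<^sub>R b)"
      by (simp add: euclidean_representation)
    also have "\<dots> = (\<Sum>b\<in>Basis. (v \<bullet> b) * f b)"
      by (simp add: linear_sum[OF \<open>linear f\<close>] linear_scale[OF \<open>linear f\<close>])
    finally show ?thesis
      unfolding G_def inner_sum_left inner_scaleR_left by (simp add: inner_commute mult.commute)
  qed
  show ?case
  proof (intro exI[of _ "\<lambda>_. G"] exI[of _ "\<lambda>_ _. 0"] conjI allI)
    fix x v :: "real ^ 'd" and t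
    show "((\<lambda>s. f (x + s *\<^sub>R v)) has_real_derivative G \<bullet> v) (at t)"
      unfolding f inner_add_right inner_scaleR_right by (auto intro!: derivative_eq_intros)
  qed (auto simp: linear_zero)
next
  case (const c)
  show ?case
    by (intro exI[of _ "\<lambda>_. 0"] exI[of _ "\<lambda>_ _. 0"] conjI allI) (auto simp: linear_zero)
next
  case (add f g)
  then obtain G H G' H' where
    H: "\<And>x. linear (H x)" "\<And>x. linear (H' x)" and
    f: "\<And>x v t. ((\<lambda>s. f (x + s *\<^sub>R v)) has_real_derivative (G (x + t *\<^sub>R v) \<bullet> v)) (at t)"
      "\<And>x v t. ((\<lambda>s. G (x + s *\<^sub>R v) \<bullet> v) has_real_derivative (v \<bullet> H (x + t *\<^sub>R v) v)) (at t)" and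
    g: "\<And>x v t. ((\<lambda>s. g (x + s *\<^sub>R v)) has_real_derivative (G' (x + t *\<^sub>R v) \<bullet> v)) (at t)"
      "\<And>x v t. ((\<lambda>s. G' (x + s *\<^sub>R v) \<bullet> v) has_real_derivative (v \<bullet> H' (x + t *\<^sub>R v) v)) (at t)"
    by metis
  show ?case
  proof (intro exI[of _ "\<lambda>x. G x + G' x"] exI[of _ "\<lambda>x v. H x v + H' x v"] conjI allI)
    show "linear (\<lambda>v. H x v + H' x v)" for x
      by (intro linear_compose_add H)
  qed (auto simp: inner_add_left inner_add_right intro!: DERIV_add f g)
next
  case (mult f g)
  then obtain G H G' H' where
    H: "\<And>x. linear (H x)" "\<And>x. linear (H' x)" and
    f: "\<And>x v t. ((\<lambda>s. f (x + s *\<^sub>R v)) has_real_derivative (G (x + t *\<^sub>R v) \<bullet> v)) (at t)"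
      "\<And>x v t. ((\<lambda>s. G (x + s *\<^sub>R v) \<bullet> v) has_real_derivative (v \<bullet> H (x + t *\<^sub>R v) v)) (at t)" and
    g: "\<And>x v t. ((\<lambda>s. g (x + s *\<^sub>R v)) has_real_derivative (G' (x + t *\<^sub>R v) \<bullet> v)) (at t)"
      "\<And>x v t. ((\<lambda>s. G' (x + s *\<^sub>R v) \<bullet> v) has_real_derivative (v \<bullet> H' (x + t *\<^sub>R v) v)) (at t)"
    by metis
  define H'' where "H'' x v = (f x *\<^sub>R H' x v + g x *\<^sub>R H x v) + ((G x \<bullet> v) *\<^sub>R G' x + (G' x \<bullet> v) *\<^sub>R G x)" for x v
  show ?case
  proof (intro exI[of _ "\<lambda>x. f x *\<^sub>R G' x + g x *\<^sub>R G x"] exI[of _ H''] conjI allI)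
    show "linear (H'' x)" for x
      unfolding H''_def
      by (intro linear_compose_add linear_compose_scale_right H linearI) (auto simp: algebra_simps)
    fix x v :: "real ^ 'd" and t
    show "((\<lambda>s. f (x + s *\<^sub>R v) * g (x + s *\<^sub>R v)) has_real_derivative
        (f (x + t *\<^sub>R v) *\<^sub>R G' (x + t *\<^sub>R v) + g (x + t *\<^sub>R v) *\<^sub>R G (x + t *\<^sub>R v)) \<bullet> v) (at t)"
      by (rule DERIV_cong[OF DERIV_mult[OF f(1) g(1)]]) (simp add: inner_add_left algebra_simps)
    show "((\<lambda>s. (f (x + s *\<^sub>R v) *\<^sub>R G' (x + s *\<^sub>R v) + g (x + s *\<^sub>R v) *\<^sub>R G (x + s *\<^sub>R v)) \<bullet> v)
        has_real_derivative v \<bullet> H'' (x + t *\<^sub>R v) v) (at t)"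
      unfolding inner_add_left inner_scaleR_left
      by (rule DERIV_cong[OF DERIV_add[OF DERIV_mult[OF f(1) g(2)] DERIV_mult[OF g(1) f(2)]]])
         (simp add: H''_def inner_add_right inner_commute[of v] algebra_simps)
  qed
qed

text \<open>The trace of \<open>M\<close> may be computed in the orthonormal basis \<open>g ` Basis\<close>.\<close>

lemma sum_Basis_quadratic_orthogonal:
  fixes g M :: "'a::euclidean_space \<Rightarrow> 'a"
  assumes g: "orthogonal_transformation g" and M: "linear M"
  shows "(\<Sum>b\<in>Basis. g b \<bullet> M (g b)) = (\<Sum>b\<in>Basis. b \<bullet> M b)"
proof -
  have adj: "g b \<bullet> c = b \<bullet> inv g c" for b c
    using g orthogonal_transformation_surj[OF g] by (metis orthogonal_transformation_def surj_f_inv_f)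
  have orth: "(\<Sum>b\<in>Basis. (g b \<bullet> c) * (g b \<bullet> e)) = c \<bullet> e" for c e
  proof -
    have "(\<Sum>b\<in>Basis. (g b \<bullet> c) * (g b \<bullet> e)) = (\<Sum>b\<in>Basis. (inv g c \<bullet> b) * (inv g e \<bullet> b))"
      by (simp only: adj inner_commute[of _ "inv g _"])
    also have "\<dots> = inv g c \<bullet> inv g e"
      by (rule euclidean_inner[symmetric])
    finally show ?thesis
      using orthogonal_transformation_inv[OF g] by (simp add: orthogonal_transformation_def)
  qed
  have "(\<Sum>b\<in>Basis. g b \<bullet> M (g b)) = (\<Sum>b\<in>Basis. \<Sum>c\<in>Basis. (g b \<bullet> c) * (g b \<bullet> M c))"
  proof (rule sum.cong[OF refl])
    fix b :: 'a
    have "M (g b) = (\<Sum>c\<in>Basis. (g b \<bullet> c) *\<^sub>R M c)"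
      by (subst euclidean_representation[of "g b", symmetric])
         (simp only: linear_sum[OF M] linear_scale[OF M])
    then show "g b \<bullet> M (g b) = (\<Sum>c\<in>Basis. (g b \<bullet> c) * (g b \<bullet> M c))"
      by (simp add: inner_sum_right)
  qed
  also have "\<dots> = (\<Sum>c\<in>Basis. \<Sum>b\<in>Basis. (g b \<bullet> c) * (g b \<bullet> M c))"
    by (rule sum.swap)
  finally show ?thesis
    by (simp add: orth)
qed

text \<open>A polynomial function has first and second directional derivatives, and the second ones form
  a quadratic form in the direction; its trace, the Laplacian, can be computed in any orthonormal
  basis.\<close>

lemma polynomial_function_second_derivatives:
  fixes h :: "real ^ 'd \<Rightarrow> complex"
  assumes "polynomial_function h"
  obtains G H where
    "\<And>x v t. ((\<lambda>s. h (x + s *\<^sub>R v)) has_vector_derivative G (x + t *\<^sub>R v) v) (at t)"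
    "\<And>x v t. ((\<lambda>s. G (x + s *\<^sub>R v) v) has_vector_derivative H (x + t *\<^sub>R v) v) (at t)"
    "\<And>x (g :: real ^ 'd \<Rightarrow> real ^ 'd). orthogonal_transformation g \<Longrightarrow> (\<Sum>b\<in>Basis. H x (g b)) = (\<Sum>b\<in>Basis. H x b)"
proof -
  have "real_polynomial_function (\<lambda>x. Re (h x))" "real_polynomial_function (\<lambda>x. Im (h x))"
    using assms bounded_linear_Re bounded_linear_Im unfolding polynomial_function_def o_def by blast+
  from real_polynomial_function_hessian[OF this(1)] real_polynomial_function_hessian[OF this(2)]
  obtain G H G' H' where
    H: "\<And>x. linear (H x)" "\<And>x. linear (H' x)" and
    f: "\<And>x v t. ((\<lambda>s. Re (h (x + s *\<^sub>R v))) has_real_derivative (G (x + t *\<^sub>R v) \<bullet> v)) (at t)"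
      "\<And>x v t. ((\<lambda>s. G (x + s *\<^sub>R v) \<bullet> v) has_real_derivative (v \<bullet> H (x + t *\<^sub>R v) v)) (at t)" and
    g: "\<And>x v t. ((\<lambda>s. Im (h (x + s *\<^sub>R v))) has_real_derivative (G' (x + t *\<^sub>R v) \<bullet> v)) (at t)"
      "\<And>x v t. ((\<lambda>s. G' (x + s *\<^sub>R v) \<bullet> v) has_real_derivative (v \<bullet> H' (x + t *\<^sub>R v) v)) (at t)"
    by metis
  have cplx: "((\<lambda>s. Complex (u s) (w s)) has_vector_derivative Complex u' w') (at t)"
    if "(u has_real_derivative u') (at t)" "(w has_real_derivative w') (at t)" for u w u' w' t
    unfolding Complex_eq
    by (intro has_vector_derivative_add has_vector_derivative_of_real has_vector_derivative_mult_right that)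
  show thesis
  proof (rule that[of "\<lambda>x v. Complex (G x \<bullet> v) (G' x \<bullet> v)" "\<lambda>x v. Complex (v \<bullet> H x v) (v \<bullet> H' x v)"])
    show "((\<lambda>s. h (x + s *\<^sub>R v)) has_vector_derivative Complex (G (x + t *\<^sub>R v) \<bullet> v) (G' (x + t *\<^sub>R v) \<bullet> v)) (at t)" for x v t
      using cplx[OF f(1)[of x v t] g(1)[of x v t]] by simp
    show "((\<lambda>s. Complex (G (x + s *\<^sub>R v) \<bullet> v) (G' (x + s *\<^sub>R v) \<bullet> v)) has_vector_derivative
       Complex (v \<bullet> H (x + t *\<^sub>R v) v) (v \<bullet> H' (x + t *\<^sub>R v) v)) (at t)" for x v t
      by (intro cplx f g)
    show "(\<Sum>b\<in>Basis. Complex (r b \<bullet> H x (r b)) (r b \<bullet> H' x (r b))) = (\<Sum>b\<in>Basis. Complex (b \<bullet> H x b) (b \<bullet> H' x b))"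
      if "orthogonal_transformation r" for x and r :: "real ^ 'd \<Rightarrow> real ^ 'd"
      using sum_Basis_quadratic_orthogonal[OF that H(1)] sum_Basis_quadratic_orthogonal[OF that H(2)]
      by (simp add: complex_eq_iff)
  qed
qed

lemma laplacian_eqI:
  assumes "\<And>b t. b \<in> Basis \<Longrightarrow> ((\<lambda>s. h (x + s *\<^sub>R b)) has_vector_derivative D b t) (at t)"
    and "\<And>b. b \<in> Basis \<Longrightarrow> (D b has_vector_derivative E b) (at 0)"
  shows "laplacian h x = (\<Sum>b\<in>Basis. E b)"
  unfolding laplacian_def
proof (rule sum.cong[OF refl])
  fix b :: "real ^ 'a" assume b: "b \<in> Basis"
  have "(\<lambda>t. vector_derivative (\<lambda>s. h (x + s *\<^sub>R b)) (at t)) = D b"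
    using vector_derivative_at[OF assms(1)[OF b]] by auto
  then show "vector_derivative (\<lambda>t. vector_derivative (\<lambda>s. h (x + s *\<^sub>R b)) (at t)) (at 0) = E b"
    using vector_derivative_at[OF assms(2)[OF b]] by simp
qed

lemma laplacian_add:
  assumes "polynomial_function f" "polynomial_function g"
  shows "laplacian (\<lambda>x. f x + g x) x = laplacian f x + laplacian g x"
proof -
  obtain G H where f: "\<And>x v t. ((\<lambda>s. f (x + s *\<^sub>R v)) has_vector_derivative G (x + t *\<^sub>R v) v) (at t)"
    "\<And>x v t. ((\<lambda>s. G (x + s *\<^sub>R v) v) has_vector_derivative H (x + t *\<^sub>R v) v) (at t)"
    using polynomial_function_second_derivatives[OF assms(1)] by metis
  obtain G' H' where g: "\<And>x v t. ((\<lambda>s. g (x + s *\<^sub>R v)) has_vector_derivative G' (x + t *\<^sub>R v) v) (at t)"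
    "\<And>x v t. ((\<lambda>s. G' (x + s *\<^sub>R v) v) has_vector_derivative H' (x + t *\<^sub>R v) v) (at t)"
    using polynomial_function_second_derivatives[OF assms(2)] by metis
  have "laplacian f x = (\<Sum>b\<in>Basis. H (x + 0 *\<^sub>R b) b)"
    by (rule laplacian_eqI[OF f(1) f(2)])
  moreover have "laplacian g x = (\<Sum>b\<in>Basis. H' (x + 0 *\<^sub>R b) b)"
    by (rule laplacian_eqI[OF g(1) g(2)])
  moreover have "laplacian (\<lambda>x. f x + g x) x = (\<Sum>b\<in>Basis. H (x + 0 *\<^sub>R b) b + H' (x + 0 *\<^sub>R b) b)"
    by (rule laplacian_eqI[OF has_vector_derivative_add[OF f(1) g(1)] has_vector_derivative_add[OF f(2) g(2)]])
  ultimately show ?thesis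
    by (simp add: sum.distrib)
qed

lemma laplacian_mult:
  assumes "polynomial_function f"
  shows "laplacian (\<lambda>x. c * f x) x = c * laplacian f x"
proof -
  obtain G H where f: "\<And>x v t. ((\<lambda>s. f (x + s *\<^sub>R v)) has_vector_derivative G (x + t *\<^sub>R v) v) (at t)"
    "\<And>x v t. ((\<lambda>s. G (x + s *\<^sub>R v) v) has_vector_derivative H (x + t *\<^sub>R v) v) (at t)"
    using polynomial_function_second_derivatives[OF assms(1)] by metis
  have "laplacian f x = (\<Sum>b\<in>Basis. H (x + 0 *\<^sub>R b) b)"
    by (rule laplacian_eqI[OF f(1) f(2)])
  moreover have "laplacian (\<lambda>x. c * f x) x = (\<Sum>b\<in>Basis. c * H (x + 0 *\<^sub>R b) b)"
    by (rule laplacian_eqI[OF has_vector_derivative_mult_right[OF f(1)] has_vector_derivative_mult_right[OF f(2)]])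
  ultimately show ?thesis
    by (simp add: sum_distrib_left)
qed

lemma polynomial_function_complex_mult:
  assumes "polynomial_function (f :: 'a::real_normed_vector \<Rightarrow> complex)"
  shows "polynomial_function (\<lambda>x. c * f x)"
  unfolding polynomial_function_def
proof (intro allI impI)
  fix T :: "complex \<Rightarrow> real" assume "bounded_linear T"
  then have "bounded_linear (\<lambda>z. T (c * z))"
    by (rule bounded_linear_compose) (rule bounded_linear_mult_right)
  then show "real_polynomial_function (T \<circ> (\<lambda>x. c * f x))"
    using assms unfolding polynomial_function_def by (auto simp: o_def)
qed

lemma laplacian_zero: "laplacian (\<lambda>x. 0) x = 0"
  using laplacian_mult[of "\<lambda>x. 0" 0 x] by simp

lemma laplacian_sum:
  assumes "finite I" "\<And>i. i \<in> I \<Longrightarrow> polynomial_function (f i)"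
  shows "laplacian (\<lambda>x. \<Sum>i\<in>I. c i * f i x) x = (\<Sum>i\<in>I. c i * laplacian (f i) x)"
  using assms
proof (induction I rule: finite_induct)
  case (insert i I)
  have "polynomial_function (\<lambda>x. \<Sum>i\<in>I. c i * f i x)"
    using insert by (intro polynomial_function_sum polynomial_function_complex_mult) auto
  then show ?case
    using insert laplacian_add[of "\<lambda>x. c i * f i x" "\<lambda>x. \<Sum>i\<in>I. c i * f i x" x]
    by (simp add: laplacian_mult polynomial_function_complex_mult)
qed (simp add: laplacian_zero)

lemma laplacian_orthogonal:
  fixes g :: "real ^ 'd \<Rightarrow> real ^ 'd"
  assumes h: "polynomial_function h" and g: "orthogonal_transformation g"
  shows "laplacian (\<lambda>x. h (g x)) x = laplacian h (g x)"
proof -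
  obtain G H where D: "\<And>x v t. ((\<lambda>s. h (x + s *\<^sub>R v)) has_vector_derivative G (x + t *\<^sub>R v) v) (at t)"
    "\<And>x v t. ((\<lambda>s. G (x + s *\<^sub>R v) v) has_vector_derivative H (x + t *\<^sub>R v) v) (at t)"
    "\<And>x (g :: real ^ 'd \<Rightarrow> real ^ 'd). orthogonal_transformation g \<Longrightarrow> (\<Sum>b\<in>Basis. H x (g b)) = (\<Sum>b\<in>Basis. H x b)"
    using polynomial_function_second_derivatives[OF h] by metis
  have lg: "linear g"
    by (rule orthogonal_transformation_linear[OF g])
  have "laplacian h (g x) = (\<Sum>b\<in>Basis. H (g x + 0 *\<^sub>R b) b)"
    by (rule laplacian_eqI[OF D(1) D(2)])
  moreover have "laplacian (\<lambda>x. h (g x)) x = (\<Sum>b\<in>Basis. H (g x + 0 *\<^sub>R g b) (g b))"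
  proof (rule laplacian_eqI)
    show "((\<lambda>s. h (g (x + s *\<^sub>R b))) has_vector_derivative G (g x + t *\<^sub>R g b) (g b)) (at t)" for b t
      using D(1)[of "g x" "g b" t] by (simp add: linear_add[OF lg] linear_scale[OF lg])
    show "((\<lambda>t. G (g x + t *\<^sub>R g b) (g b)) has_vector_derivative H (g x + 0 *\<^sub>R g b) (g b)) (at 0)" for b
      by (rule D(2))
  qed
  ultimately show ?thesis
    using D(3)[OF g] by simp
qed

section \<open>Zonal harmonics of a subspace\<close>

definition proj_sq :: "(real ^ 'd) set \<Rightarrow> real ^ 'd \<Rightarrow> real" where
  "proj_sq V x = norm (oproj V x) ^ 2"

lemma proj_sq_nonneg [simp]: "0 \<le> proj_sq V x"
  by (simp add: proj_sq_def)

lemma proj_sq_inner: "proj_sq V x = oproj V x \<bullet> oproj V x"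
  by (simp add: proj_sq_def power2_norm_eq_inner)

lemma oproj_UNIV: "oproj UNIV x = x"
  by (simp add: oproj_ident)

lemma proj_sq_UNIV: "proj_sq UNIV x = norm x ^ 2"
  by (simp add: proj_sq_def oproj_UNIV)

lemma proj_sq_scaleR: "subspace V \<Longrightarrow> proj_sq V (c *\<^sub>R x) = c ^ 2 * proj_sq V x"
  by (simp add: proj_sq_inner linear_scale[OF linear_oproj] power2_eq_square)

lemma proj_sq_image:
  "orthogonal_transformation g \<Longrightarrow> subspace V \<Longrightarrow> proj_sq (g ` V) (g x) = proj_sq V x"
  by (simp add: proj_sq_def oproj_image orthogonal_transformation_norm)

lemma proj_sq_reflection:
  "subspace V \<Longrightarrow> w \<in> V \<union> orthogonal_comp V \<Longrightarrow> proj_sq V (reflection w x) = proj_sq V x"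
  by (simp add: proj_sq_def oproj_reflection orthogonal_transformation_norm[OF orthogonal_transformation_reflection])

lemma polynomial_function_of_real:
  assumes "real_polynomial_function f"
  shows "polynomial_function (\<lambda>x. complex_of_real (f x))"
  unfolding polynomial_function_def
proof (intro allI impI)
  fix T :: "complex \<Rightarrow> real" assume "bounded_linear T"
  then have "T (of_real (f x)) = f x * T 1" for x
    by (simp add: of_real_def linear_scale[OF bounded_linear.linear])
  then show "real_polynomial_function (T \<circ> (\<lambda>x. complex_of_real (f x)))"
    using assms by (auto simp: o_def)
qed

lemma real_polynomial_function_proj_sq:
  assumes "subspace V"
  shows "real_polynomial_function (proj_sq V)"
proof -
  have "proj_sq V = (\<lambda>x. \<Sum>b\<in>Basis. (oproj V x \<bullet> b) * (oproj V x \<bullet> b))"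
    by (rule ext, unfold proj_sq_inner, rule euclidean_inner)
  moreover have "bounded_linear (\<lambda>x. oproj V x \<bullet> b)" for b
    by (intro bounded_linear_inner_left_comp) (simp add: linear_oproj[OF assms] flip: linear_conv_bounded_linear)
  ultimately show ?thesis
    by (simp only:) (intro real_polynomial_function_sum real_polynomial_function.intros(4);
      auto intro: real_polynomial_function.intros(1))
qed

lemma proj_sq_power_second_derivative:
  fixes p q r p' q' r' :: real and i j :: nat
  defines "a \<equiv> \<lambda>s. p + 2 * s * q + s ^ 2 * r" and "c \<equiv> \<lambda>s. p' + 2 * s * q' + s ^ 2 * r'"
  defines "D \<equiv> \<lambda>t. real i * a t ^ (i - 1) * (2 * q + 2 * t * r) * c t ^ j +
      real j * c t ^ (j - 1) * (2 * q' + 2 * t * r') * a t ^ i"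
  shows "((\<lambda>s. a s ^ i * c s ^ j) has_real_derivative D t) (at t)"
    and "(D has_real_derivative
      real i * real (i - 1) * p ^ (i - 1 - 1) * (4 * q ^ 2) * p' ^ j + real i * p ^ (i - 1) * (2 * r) * p' ^ j
      + 8 * real i * real j * (q * q') * p ^ (i - 1) * p' ^ (j - 1)
      + real j * real (j - 1) * p' ^ (j - 1 - 1) * (4 * q' ^ 2) * p ^ i + real j * p' ^ (j - 1) * (2 * r') * p ^ i) (at 0)"
proof -
  have a: "(a has_real_derivative (2 * q + 2 * t * r)) (at t)" for t
    unfolding a_def by (auto intro!: derivative_eq_intros)
  have c: "(c has_real_derivative (2 * q' + 2 * t * r')) (at t)" for t
    unfolding c_def by (auto intro!: derivative_eq_intros)
  have pow: "((\<lambda>s. f s ^ m) has_real_derivative (real m * f t ^ (m - 1) * f')) (at t)"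
    if "(f has_real_derivative f') (at t)" for f :: "real \<Rightarrow> real" and f' t m
    using DERIV_power[OF that, of m] by (simp add: algebra_simps)
  have lin: "((\<lambda>t. 2 * q + 2 * t * r) has_real_derivative (2 * r)) (at t)" for q r t :: real
    by (auto intro!: derivative_eq_intros)
  show "((\<lambda>s. a s ^ i * c s ^ j) has_real_derivative D t) (at t)"
    by (rule DERIV_cong[OF DERIV_mult[OF pow[OF a] pow[OF c]]]) (simp add: D_def algebra_simps)
  have [simp]: "a 0 = p" "c 0 = p'"
    by (simp_all add: a_def c_def)
  show "(D has_real_derivative
      real i * real (i - 1) * p ^ (i - 1 - 1) * (4 * q ^ 2) * p' ^ j + real i * p ^ (i - 1) * (2 * r) * p' ^ j
      + 8 * real i * real j * (q * q') * p ^ (i - 1) * p' ^ (j - 1)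
      + real j * real (j - 1) * p' ^ (j - 1 - 1) * (4 * q' ^ 2) * p ^ i + real j * p' ^ (j - 1) * (2 * r') * p ^ i) (at 0)"
    unfolding D_def
    by (rule DERIV_cong[OF DERIV_add[OF
          DERIV_mult[OF DERIV_mult[OF DERIV_mult[OF DERIV_const pow[OF a]] lin] pow[OF c]]
          DERIV_mult[OF DERIV_mult[OF DERIV_mult[OF DERIV_const pow[OF c]] lin] pow[OF a]]]])
       (simp add: algebra_simps power2_eq_square)
qed

text \<open>The gradient of \<open>proj_sq V\<close> at \<open>x\<close> is \<open>2 oproj V x\<close> and its Laplacian is \<open>2 dim V\<close>; the rest is
  the product rule.\<close>

lemma laplacian_proj_sq_powers:
  fixes V W :: "(real ^ 'd) set"
  assumes V: "subspace V" and W: "subspace W"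
  shows "laplacian (\<lambda>x. of_real (proj_sq V x ^ i * proj_sq W x ^ j)) x = of_real
     ((4 * real i * (real i - 1) + 2 * real i * real (dim V)) * proj_sq V x ^ (i - 1) * proj_sq W x ^ j
      + 8 * real i * real j * (oproj V x \<bullet> oproj W x) * proj_sq V x ^ (i - 1) * proj_sq W x ^ (j - 1)
      + (4 * real j * (real j - 1) + 2 * real j * real (dim W)) * proj_sq V x ^ i * proj_sq W x ^ (j - 1))"
proof -
  have line: "proj_sq U (x + s *\<^sub>R b) = proj_sq U x + 2 * s * (oproj U x \<bullet> b) + s ^ 2 * norm (oproj U b) ^ 2"
    if "subspace U" for U :: "(real ^ 'd) set" and s b
  proof -
    have *: "oproj U b \<bullet> oproj U x = oproj U x \<bullet> b" "oproj U x \<bullet> oproj U b = oproj U x \<bullet> b"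
      using oproj_self_adjoint[OF that, of x b] by (simp_all add: inner_commute)
    show ?thesis
      unfolding proj_sq_inner power2_norm_eq_inner power2_eq_square[of s]
        linear_add[OF linear_oproj[OF that]] linear_scale[OF linear_oproj[OF that]]
        inner_add_left inner_add_right inner_scaleR_left inner_scaleR_right *
      by (simp only: algebra_simps)
  qed
  let ?p = "proj_sq V x" and ?p' = "proj_sq W x"
  have lap: "laplacian (\<lambda>x. of_real (proj_sq V x ^ i * proj_sq W x ^ j)) x = (\<Sum>b\<in>Basis. of_real
     (real i * real (i - 1) * ?p ^ (i - 1 - 1) * (4 * (oproj V x \<bullet> b) ^ 2) * ?p' ^ j
      + real i * ?p ^ (i - 1) * (2 * norm (oproj V b) ^ 2) * ?p' ^ j
      + 8 * real i * real j * ((oproj V x \<bullet> b) * (oproj W x \<bullet> b)) * ?p ^ (i - 1) * ?p' ^ (j - 1)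
      + real j * real (j - 1) * ?p' ^ (j - 1 - 1) * (4 * (oproj W x \<bullet> b) ^ 2) * ?p ^ i
      + real j * ?p' ^ (j - 1) * (2 * norm (oproj W b) ^ 2) * ?p ^ i))"
    by (rule laplacian_eqI, unfold line[OF V] line[OF W];
        rule has_vector_derivative_of_real, rule proj_sq_power_second_derivative)
  have sums: "(\<Sum>b\<in>Basis. (oproj U x \<bullet> b) ^ 2) = proj_sq U x" "(\<Sum>b\<in>Basis. norm (oproj U b) ^ 2) = real (dim U)"
    if "subspace U" for U :: "(real ^ 'd) set"
  proof -
    show "(\<Sum>b\<in>Basis. (oproj U x \<bullet> b) ^ 2) = proj_sq U x"
      unfolding proj_sq_inner power2_eq_square by (rule euclidean_inner[symmetric])
  qed (rule sum_norm_oproj_Basis[OF that])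
  have cross: "(\<Sum>b\<in>Basis. (oproj V x \<bullet> b) * (oproj W x \<bullet> b)) = oproj V x \<bullet> oproj W x"
    by (rule euclidean_inner[symmetric])
  have pow: "real m * real (m - 1) * y ^ (m - 1 - 1) * (4 * y) = 4 * real m * (real m - 1) * y ^ (m - 1)"
    for m and y :: real
    by (cases m rule: nat.exhaust; (case_tac "m - 1")) (auto simp: of_nat_diff)
  have "laplacian (\<lambda>x. of_real (proj_sq V x ^ i * proj_sq W x ^ j)) x = of_real
     (real i * real (i - 1) * ?p ^ (i - 1 - 1) * (4 * ?p) * ?p' ^ j
      + real i * ?p ^ (i - 1) * (2 * real (dim V)) * ?p' ^ j
      + 8 * real i * real j * (oproj V x \<bullet> oproj W x) * ?p ^ (i - 1) * ?p' ^ (j - 1)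
      + real j * real (j - 1) * ?p' ^ (j - 1 - 1) * (4 * ?p') * ?p ^ i
      + real j * ?p' ^ (j - 1) * (2 * real (dim W)) * ?p ^ i)"
    unfolding lap of_real_sum[symmetric] sum.distrib sum_distrib_right[symmetric] sum_distrib_left[symmetric]
      sums[OF V] sums[OF W] cross ..
  then show ?thesis
    unfolding pow by (simp add: algebra_simps)
qed

text \<open>Closed form of the recursion that makes \<open>zonal\<close> harmonic, normalised so that the coefficient of the
  top power of \<open>proj_sq V\<close> is one. Here \<open>d\<close> is the dimension of the ambient space and \<open>k\<close> that of \<open>V\<close>.\<close>

definition zonal_coeff :: "nat \<Rightarrow> nat \<Rightarrow> nat \<Rightarrow> nat \<Rightarrow> real" where
  "zonal_coeff d k l i = (\<Prod>j=i..<l. - ((real j + 1) * (2 * real j + real k)) /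
     ((real l - real j) * (2 * real l + 2 * real j + real d - 2)))"

lemma zonal_coeff_top [simp]: "zonal_coeff d k l l = 1"
  by (simp add: zonal_coeff_def)

lemma zonal_coeff_recursion:
  assumes "i < l" "2 \<le> d"
  shows "zonal_coeff d k l i * ((real l - real i) * (2 * real l + 2 * real i + real d - 2)) =
    - (zonal_coeff d k l (Suc i) * ((real i + 1) * (2 * real i + real k)))"
proof -
  have "zonal_coeff d k l i = - ((real i + 1) * (2 * real i + real k)) /
      ((real l - real i) * (2 * real l + 2 * real i + real d - 2)) * zonal_coeff d k l (Suc i)"
    unfolding zonal_coeff_def by (rule prod.atLeast_Suc_lessThan[OF assms(1)])
  moreover have "(real l - real i) * (2 * real l + 2 * real i + real d - 2) \<noteq> 0"
    using assms by simp
  ultimately show ?thesis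
    by (simp add: field_simps)
qed

text \<open>The second variable is the full squared norm and not that of the complementary component: weighted
  sums over several \<open>V\<close> then involve the different subspaces only through powers of \<open>proj_sq V\<close>.\<close>

definition zonal :: "(real ^ 'd) set \<Rightarrow> nat \<Rightarrow> real ^ 'd \<Rightarrow> real" where
  "zonal V l x = (\<Sum>i\<le>l. zonal_coeff CARD('d) (dim V) l i * (proj_sq V x ^ i * (norm x ^ 2) ^ (l - i)))"

abbreviation czonal :: "(real ^ 'd) set \<Rightarrow> nat \<Rightarrow> real ^ 'd \<Rightarrow> complex" where
  "czonal V l \<equiv> \<lambda>x. of_real (zonal V l x)"

lemma real_polynomial_function_proj_sq_powers:
  assumes "subspace V"
  shows "real_polynomial_function (\<lambda>x. proj_sq V x ^ i * (norm x ^ 2) ^ j)"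
  unfolding proj_sq_UNIV[symmetric]
  by (intro real_polynomial_function.intros(4) real_polynomial_function_power real_polynomial_function_proj_sq assms subspace_UNIV)

lemma polynomial_function_zonal:
  assumes "subspace V"
  shows "polynomial_function (czonal V l)"
  unfolding zonal_def
  by (intro polynomial_function_of_real real_polynomial_function_sum real_polynomial_function.intros(2,4)
      real_polynomial_function_proj_sq_powers assms) simp

lemma zonal_scaleR:
  assumes "subspace V"
  shows "zonal V l (c *\<^sub>R x) = c ^ (2 * l) * zonal V l x"
  unfolding zonal_def sum_distrib_left
proof (rule sum.cong[OF refl])
  fix i assume "i \<in> {..l}"
  then have "(c^2) ^ i * (c^2) ^ (l - i) = c ^ (2 * l)"
    by (simp add: power_add[symmetric] power_mult)
  then show "zonal_coeff CARD('a) (dim V) l i * (proj_sq V (c *\<^sub>R x) ^ i * (norm (c *\<^sub>R x) ^ 2) ^ (l - i)) =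
      c ^ (2 * l) * (zonal_coeff CARD('a) (dim V) l i * (proj_sq V x ^ i * (norm x ^ 2) ^ (l - i)))"
    by (simp add: proj_sq_scaleR[OF assms] power_mult_distrib algebra_simps)
qed

lemma laplacian_zonal:
  fixes V :: "(real ^ 'd) set"
  assumes V: "subspace V" and d: "2 \<le> CARD('d)"
  shows "laplacian (czonal V l) x = 0"
proof -
  let ?e = "zonal_coeff CARD('d) (dim V) l" and ?s = "proj_sq V x" and ?r = "norm x ^ 2"
  let ?A = "\<lambda>i. ?e i * (4 * real i * (real i - 1) + 2 * real i * real (dim V))"
  let ?B = "\<lambda>i. ?e i * (8 * real i * real (l - i) + (4 * real (l - i) * (real (l - i) - 1) + 2 * real (l - i) * real CARD('d)))"
  have lap_term: "laplacian (\<lambda>x. of_real (proj_sq V x ^ i * (norm x ^ 2) ^ (l - i))) x = of_real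
     ((4 * real i * (real i - 1) + 2 * real i * real (dim V)) * ?s ^ (i - 1) * ?r ^ (l - i)
      + (8 * real i * real (l - i) + (4 * real (l - i) * (real (l - i) - 1) + 2 * real (l - i) * real CARD('d))) * ?s ^ i * ?r ^ (l - i - 1))" for i
  proof -
    have "oproj V x \<bullet> oproj UNIV x = ?s"
      using oproj_self_adjoint[OF V, of x x] by (simp add: oproj_UNIV proj_sq_inner)
    moreover have "real i * (?s * ?s ^ (i - 1)) = real i * ?s ^ i"
      by (cases i) auto
    ultimately have "(4 * real i * (real i - 1) + 2 * real i * real (dim V)) * ?s ^ (i - 1) * ?r ^ (l - i)
      + 8 * real i * real (l - i) * (oproj V x \<bullet> oproj UNIV x) * ?s ^ (i - 1) * ?r ^ (l - i - 1)
      + (4 * real (l - i) * (real (l - i) - 1) + 2 * real (l - i) * real (dim (UNIV :: (real ^ 'd) set))) * ?s ^ i * ?r ^ (l - i - 1)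
      = (4 * real i * (real i - 1) + 2 * real i * real (dim V)) * ?s ^ (i - 1) * ?r ^ (l - i)
      + (8 * real i * real (l - i) + (4 * real (l - i) * (real (l - i) - 1) + 2 * real (l - i) * real CARD('d))) * ?s ^ i * ?r ^ (l - i - 1)"
      by (simp add: algebra_simps) auto
    then show ?thesis
      using laplacian_proj_sq_powers[OF V subspace_UNIV, of i "l - i" x]
      unfolding proj_sq_UNIV by (simp only:)
  qed
  have "laplacian (czonal V l) x =
      laplacian (\<lambda>x. \<Sum>i\<le>l. of_real (?e i) * of_real (proj_sq V x ^ i * (norm x ^ 2) ^ (l - i))) x"
    by (simp add: zonal_def)
  also have "\<dots> = (\<Sum>i\<le>l. of_real (?e i) * laplacian (\<lambda>x. of_real (proj_sq V x ^ i * (norm x ^ 2) ^ (l - i))) x)"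
    by (intro laplacian_sum finite_atMost polynomial_function_of_real real_polynomial_function_proj_sq_powers V)
  also have "\<dots> = of_real (\<Sum>i\<le>l. ?A i * ?s ^ (i - 1) * ?r ^ (l - i) + ?B i * ?s ^ i * ?r ^ (l - i - 1))"
    unfolding lap_term of_real_mult[symmetric] of_real_sum[symmetric]
    by (rule arg_cong[where f = of_real], rule sum.cong) (simp_all only: distrib_left distrib_right mult.assoc)
  also have "(\<Sum>i\<le>l. ?A i * ?s ^ (i - 1) * ?r ^ (l - i) + ?B i * ?s ^ i * ?r ^ (l - i - 1)) = 0"
  proof (cases l)
    case (Suc m)
    have "(\<Sum>i\<le>l. ?A i * ?s ^ (i - 1) * ?r ^ (l - i) + ?B i * ?s ^ i * ?r ^ (l - i - 1)) =
        (\<Sum>i\<le>m. ?A (Suc i) * ?s ^ i * ?r ^ (m - i)) + (\<Sum>i\<le>m. ?B i * ?s ^ i * ?r ^ (m - i))"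
    proof -
      have "(\<Sum>i\<le>l. ?A i * ?s ^ (i - 1) * ?r ^ (l - i)) = (\<Sum>i\<le>m. ?A (Suc i) * ?s ^ i * ?r ^ (m - i))"
        unfolding Suc by (subst sum.atMost_Suc_shift) simp
      moreover have "(\<Sum>i\<le>l. ?B i * ?s ^ i * ?r ^ (l - i - 1)) = (\<Sum>i\<le>m. ?B i * ?s ^ i * ?r ^ (m - i))"
        unfolding Suc by (subst sum.atMost_Suc) (auto intro!: sum.cong simp: Suc_diff_le)
      ultimately show ?thesis
        by (simp only: sum.distrib)
    qed
    also have "\<dots> = (\<Sum>i\<le>m. (?A (Suc i) + ?B i) * ?s ^ i * ?r ^ (m - i))"
      by (simp only: sum.distrib[symmetric] distrib_right)
    also have "\<dots> = 0"
    proof (rule sum.neutral, rule ballI)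
      fix i assume "i \<in> {..m}"
      then have "i < l" using Suc by simp
      have "?A (Suc i) = 2 * (?e (Suc i) * ((real i + 1) * (2 * real i + real (dim V))))"
        by (simp add: algebra_simps)
      moreover have "?B i = 2 * (?e i * ((real l - real i) * (2 * real l + 2 * real i + real CARD('d) - 2)))"
        using \<open>i < l\<close> by (simp add: of_nat_diff algebra_simps)
      ultimately have "?A (Suc i) + ?B i = 0"
        using zonal_coeff_recursion[OF \<open>i < l\<close> d, of "dim V"] by linarith
      then show "(?A (Suc i) + ?B i) * ?s ^ i * ?r ^ (m - i) = 0"
        by (simp only: mult_zero_left)
    qed
    finally show ?thesis .
  qed simp
  finally show ?thesis by simp
qed

lemma harmonics_iff: "h \<in> harmonics m \<longleftrightarrow> homogeneous_polynomial m h \<and> (\<forall>x. laplacian h x = 0)"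
  by (auto simp: harmonics_def homogeneous_polynomial_def)

lemma zonal_harmonic:
  fixes V :: "(real ^ 'd) set"
  assumes "subspace V" "2 \<le> CARD('d)"
  shows "czonal V l \<in> harmonics (2 * l)"
  using assms
  by (simp add: harmonics_iff homogeneous_polynomial_def polynomial_function_zonal laplacian_zonal zonal_scaleR)

lemma zonal_image:
  fixes V :: "(real ^ 'd) set" and g :: "real ^ 'd \<Rightarrow> real ^ 'd"
  assumes "orthogonal_transformation g" "subspace V"
  shows "zonal (g ` V) l (g x) = zonal V l x"
proof -
  have "linear g" "inj g"
    using assms(1) orthogonal_transformation_linear orthogonal_transformation_inj by blast+
  then have "dim (g ` V) = dim V"
    by (intro dim_image_eq) (auto simp: inj_def inj_on_def)
  then show ?thesis
    by (simp add: zonal_def proj_sq_image[OF assms] orthogonal_transformation_norm[OF assms(1)])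
qed

lemma zonal_stabilizer_invariant: "subspace V \<Longrightarrow> stabilizer_invariant V (czonal V l)"
  by (simp add: stabilizer_invariant_def zonal_def proj_sq_reflection
      orthogonal_transformation_norm[OF orthogonal_transformation_reflection])

section \<open>Harmonic polynomials\<close>

lemma harmonics_zero: "(\<lambda>x. 0) \<in> harmonics m"
  by (simp add: harmonics_iff homogeneous_polynomial_def laplacian_zero)

lemma harmonics_add: "f \<in> harmonics m \<Longrightarrow> g \<in> harmonics m \<Longrightarrow> (\<lambda>x. f x + g x) \<in> harmonics m"
  by (auto simp: harmonics_iff homogeneous_polynomial_def laplacian_add algebra_simps)

lemma harmonics_mult: "f \<in> harmonics m \<Longrightarrow> (\<lambda>x. c * f x) \<in> harmonics m"
  by (auto simp: harmonics_iff homogeneous_polynomial_def laplacian_mult polynomial_function_complex_mult)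

lemma harmonics_sum:
  "finite I \<Longrightarrow> (\<And>i. i \<in> I \<Longrightarrow> f i \<in> harmonics m) \<Longrightarrow> (\<lambda>x. \<Sum>i\<in>I. f i x) \<in> harmonics m"
  by (induction I rule: finite_induct) (auto intro: harmonics_zero harmonics_add)

lemma harmonics_diff: "f \<in> harmonics m \<Longrightarrow> g \<in> harmonics m \<Longrightarrow> (\<lambda>x. f x - g x) \<in> harmonics m"
  using harmonics_add[of f m "\<lambda>x. (-1) * g x"] harmonics_mult[of g m "-1"] by simp

lemma harmonics_orthogonal:
  fixes g :: "real ^ 'd \<Rightarrow> real ^ 'd"
  assumes h: "h \<in> harmonics m" and g: "orthogonal_transformation g"
  shows "(\<lambda>x. h (g x)) \<in> harmonics m"
proof -
  have "linear g"
    by (rule orthogonal_transformation_linear[OF g])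
  then have "polynomial_function g"
    by (intro polynomial_function_bounded_linear) (simp flip: linear_conv_bounded_linear)
  then have "polynomial_function (h \<circ> g)"
    using h by (intro polynomial_function_compose) (auto simp: harmonics_iff homogeneous_polynomial_def)
  then show ?thesis
    using h \<open>linear g\<close> g
    by (auto simp: harmonics_iff homogeneous_polynomial_def o_def laplacian_orthogonal linear_scale)
qed

lemma harmonics_continuous: "h \<in> harmonics m \<Longrightarrow> continuous_on S h"
  by (auto simp: harmonics_iff homogeneous_polynomial_def intro: continuous_on_polymonial_function)

lemma harmonics_scaleR: "h \<in> harmonics m \<Longrightarrow> h (c *\<^sub>R x) = of_real c ^ m * h x"
  by (simp add: harmonics_iff homogeneous_polynomial_def)

lemma harmonics_definite:
  fixes h :: "real ^ 'd \<Rightarrow> complex"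
  assumes "h \<in> harmonics m" "ball_inner h h = 0"
  shows "h = (\<lambda>x. 0)"
proof
  fix x :: "real ^ 'd"
  have pos: "0 < norm x + 1"
    by (simp add: add_nonneg_pos)
  then have "norm (inverse (norm x + 1) *\<^sub>R x) = norm x / (norm x + 1)"
    by (simp add: divide_inverse)
  also have "\<dots> < 1"
    by (subst divide_less_eq_1_pos[OF pos]) simp
  finally have "norm (inverse (norm x + 1) *\<^sub>R x) < 1" .
  then have "h (inverse (norm x + 1) *\<^sub>R x) = 0"
    by (rule ball_inner_self_eq_0D[OF harmonics_continuous[OF assms(1)] assms(2)])
  moreover have "complex_of_real (inverse (norm x + 1)) ^ m \<noteq> 0"
    unfolding power_eq_0_iff of_real_eq_0_iff using pos by simp
  ultimately show "h x = 0"
    unfolding harmonics_scaleR[OF assms(1)] mult_eq_0_iff by blast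
qed

lemma harmonics_eq_0_on_sphere:
  fixes h :: "real ^ 'd \<Rightarrow> complex"
  assumes "h \<in> harmonics m" "\<And>e. norm e = 1 \<Longrightarrow> h e = 0"
  shows "h = (\<lambda>x. 0)"
proof
  fix x :: "real ^ 'd"
  obtain b :: "real ^ 'd" where b: "norm b = 1"
    using nonempty_Basis norm_Basis by blast
  define e where "e = (if x = 0 then b else inverse (norm x) *\<^sub>R x)"
  have "norm e = 1" "x = norm x *\<^sub>R e"
    using b by (auto simp: e_def)
  then show "h x = 0"
    using harmonics_scaleR[OF assms(1), of "norm x" e] assms(2) by simp
qed

lemma harmonics_riesz:
  fixes F :: "(real ^ 'd \<Rightarrow> complex) set"
  assumes "F \<subseteq> harmonics m" "(\<lambda>x. 0) \<in> F"
    and "\<And>f g. f \<in> F \<Longrightarrow> g \<in> F \<Longrightarrow> (\<lambda>x. f x + g x) \<in> F"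
    and "\<And>c f. f \<in> F \<Longrightarrow> (\<lambda>x. c * f x) \<in> F"
    and "\<And>f g. f \<in> F \<Longrightarrow> g \<in> F \<Longrightarrow> L (\<lambda>x. f x + g x) = L f + L g"
    and "\<And>c f. f \<in> F \<Longrightarrow> L (\<lambda>x. c * f x) = c * L f"
  obtains n where "n \<in> F" "\<And>f. f \<in> F \<Longrightarrow> L f = ball_inner f n"
proof -
  have fin: "finite {bs :: (real ^ 'd) list. set bs \<subseteq> Basis \<and> length bs = m}"
    by (rule finite_lists_length_eq) simp
  have "continuous_on UNIV f" "ball_inner f f = 0 \<Longrightarrow> f = (\<lambda>x. 0)"
    "\<exists>c. f = (\<lambda>x. \<Sum>bs | set bs \<subseteq> Basis \<and> length bs = m. c bs * of_real (list_monomial bs x))"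
    if "f \<in> F" for f
  proof -
    have "f \<in> harmonics m"
      using that assms(1) by blast
    then show "continuous_on UNIV f" "ball_inner f f = 0 \<Longrightarrow> f = (\<lambda>x. 0)"
      "\<exists>c. f = (\<lambda>x. \<Sum>bs | set bs \<subseteq> Basis \<and> length bs = m. c bs * of_real (list_monomial bs x))"
      by (auto intro: harmonics_continuous harmonics_definite simp: homogeneous_polynomial_list_monomials harmonics_iff)
  qed
  note F = this
  have "\<exists>n\<in>F. \<forall>f\<in>F. L f = ball_inner f n"
    by (rule finite_dimensional_riesz[where L = L and I = "{bs :: (real ^ 'd) list. set bs \<subseteq> Basis \<and> length bs = m}"
          and b = "\<lambda>bs x. of_real (list_monomial bs x)"]) (fact fin assms F)+
  then show thesis
    using that by blast
qed

text \<open>The composition \<open>n \<circ> g\<close> represents the same functional as \<open>n\<close>, so it is the same vector.\<close>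

lemma riesz_vector_invariant:
  fixes g :: "real ^ 'd \<Rightarrow> real ^ 'd"
  assumes g: "orthogonal_transformation g" and F: "F \<subseteq> harmonics m"
    and closed: "\<And>f. f \<in> F \<Longrightarrow> (\<lambda>x. f (inv g x)) \<in> F"
    and n: "n \<in> F" "\<And>f. f \<in> F \<Longrightarrow> L f = ball_inner f n"
    and inv: "\<And>f. f \<in> F \<Longrightarrow> L (\<lambda>x. f (inv g x)) = L f"
    and n': "(\<lambda>x. n (g x) - n x) \<in> F"
  shows "n (g x) = n x"
proof -
  define u where "u = (\<lambda>x. n (g x) + (-1) * n x)"
  have u: "u \<in> F"
    using n' by (simp add: u_def)
  have cont: "continuous_on UNIV f" if "f \<in> F" for f
    using that F harmonics_continuous by blast
  have contg: "continuous_on UNIV g"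
    using orthogonal_transformation_linear[OF g] by (intro linear_continuous_on) (simp flip: linear_conv_bounded_linear)
  have contn: "continuous_on UNIV (\<lambda>x. n (g x))" "continuous_on UNIV (\<lambda>x. (-1) * n x)"
    using continuous_on_compose2[OF cont[OF n(1)] contg] continuous_on_minus[OF cont[OF n(1)]] by auto
  have "ball_inner u (\<lambda>x. n (g x)) = ball_inner (\<lambda>x. u (inv g (g x))) (\<lambda>x. n (g x))"
    by (simp add: orthogonal_transformation_inv_apply[OF g])
  also have "\<dots> = ball_inner (\<lambda>x. u (inv g x)) n"
    by (rule ball_inner_orthogonal[where f = "\<lambda>x. u (inv g x)"]) (intro cont closed u n g)+
  also have "\<dots> = ball_inner u n"
    using n(2)[OF closed[OF u]] n(2)[OF u] inv[OF u] by simp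
  finally have "ball_inner u (\<lambda>x. n (g x)) + ball_inner u (\<lambda>x. (-1) * n x) = 0"
    using ball_inner_mult_right[of u "-1" n] by simp
  then have "ball_inner u u = 0"
    by (subst (2) u_def) (simp only: ball_inner_add_right[OF contn cont[OF u]])
  moreover have "u \<in> harmonics m"
    using F u by blast
  ultimately have "u x = 0"
    using harmonics_definite by metis
  then show ?thesis
    by (simp add: u_def)
qed

lemma inv_reflection: "inv (reflection w) = reflection w"
proof (rule inv_equality)
  have "reflection w (reflection w x) = x" for x
  proof (cases "w = 0")
    case False
    have "reflection w x \<bullet> w = - (x \<bullet> w)"
      using False by (simp add: reflection_def inner_diff_left)
    then show ?thesis
      by (simp add: reflection_def[of w "reflection w x"]) (simp add: reflection_def)
  qed (simp add: reflection_def)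
  then show "reflection w (reflection w x) = x" "reflection w (reflection w x) = x" for x
    by blast+
qed

lemma sum_even_part:
  fixes t :: "nat \<Rightarrow> complex"
  shows "(\<Sum>j\<le>2 * l. t j + (-1) ^ j * t j) = 2 * (\<Sum>i\<le>l. t (2 * i))"
  by (induction l) (auto simp: algebra_simps)

text \<open>The space of harmonic polynomials fixed by the stabilizer of \<open>V\<close> is at most one-dimensional:
  evaluation at a unit vector of \<open>V\<close> is injective on it. An invariant polynomial is a form in the
  two squared norms \<open>s\<close> and \<open>t\<close> of the components of its argument, and harmonicity is a two-term
  recursion for the coefficients of this form, starting from the coefficient of \<open>s ^ l\<close>.\<close>

lemma invariant_harmonic_eq_0:
  fixes V :: "(real ^ 'd) set"
  assumes V: "subspace V" and inv: "stabilizer_invariant V f" and f: "f \<in> harmonics (2 * l)"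
    and e: "e \<in> V" "norm e = 1" and e': "e' \<in> orthogonal_comp V" "norm e' = 1" and 0: "f e = 0"
  shows "f = (\<lambda>x. 0)"
proof -
  let ?W = "orthogonal_comp V"
  have W: "subspace ?W"
    by (rule subspace_orthogonal_comp)
  have ee': "e \<bullet> e' = 0" "e' \<bullet> e = 0"
    using e e' by (auto simp: orthogonal_comp_def orthogonal_def inner_commute)
  have "homogeneous_polynomial (2 * l) f"
    using f by (simp add: harmonics_iff)
  then obtain a where a: "\<And>\<alpha> \<beta>. f (\<alpha> *\<^sub>R e + \<beta> *\<^sub>R e') = (\<Sum>j\<le>2*l. a j * of_real (\<alpha> ^ j * \<beta> ^ (2*l - j)))"
    using homogeneous_polynomial_on_plane[of "2*l" f e e'] by blast
  have even: "f (\<alpha> *\<^sub>R e + \<beta> *\<^sub>R e') = (\<Sum>i\<le>l. a (2*i) * of_real ((\<alpha>^2) ^ i * (\<beta>^2) ^ (l - i)))" for \<alpha> \<beta>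
  proof -
    have "reflection e (\<alpha> *\<^sub>R e + \<beta> *\<^sub>R e') = (-\<alpha>) *\<^sub>R e + \<beta> *\<^sub>R e'"
    proof -
      have "reflection e (\<alpha> *\<^sub>R e + \<beta> *\<^sub>R e') = (\<alpha> - 2 * \<alpha>) *\<^sub>R e + \<beta> *\<^sub>R e'"
        using e(2) ee' unfolding scaleR_left_diff_distrib by (simp add: reflection_def inner_add_left norm_eq_1)
      then show ?thesis by simp
    qed
    then have "f (\<alpha> *\<^sub>R e + \<beta> *\<^sub>R e') = f ((-\<alpha>) *\<^sub>R e + \<beta> *\<^sub>R e')"
      using inv e(1) unfolding stabilizer_invariant_def by (metis UnI1)
    then have "2 * f (\<alpha> *\<^sub>R e + \<beta> *\<^sub>R e') =
        (\<Sum>j\<le>2*l. a j * of_real (\<alpha> ^ j * \<beta> ^ (2*l - j)) + (-1) ^ j * (a j * of_real (\<alpha> ^ j * \<beta> ^ (2*l - j))))"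
    proof -
      have "(\<Sum>j\<le>2*l. (-1) ^ j * (a j * of_real (\<alpha> ^ j * \<beta> ^ (2*l - j)))) = f ((-\<alpha>) *\<^sub>R e + \<beta> *\<^sub>R e')"
        unfolding a by (rule sum.cong) (simp_all add: power_minus[of \<alpha>] power_minus[of "of_real \<alpha>"])
      then show ?thesis
        using \<open>f (\<alpha> *\<^sub>R e + \<beta> *\<^sub>R e') = f ((-\<alpha>) *\<^sub>R e + \<beta> *\<^sub>R e')\<close>
        unfolding sum.distrib a[symmetric] by simp
    qed
    also have "\<dots> = 2 * (\<Sum>i\<le>l. a (2*i) * of_real (\<alpha> ^ (2*i) * \<beta> ^ (2*l - 2*i)))"
      by (rule sum_even_part)
    finally show ?thesis
      by (simp add: power_mult[symmetric] right_diff_distrib' del: of_real_power of_real_mult)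
  qed
  define c where "c i = a (2 * i)" for i
  have f_eq: "f x = (\<Sum>i\<le>l. c i * of_real (proj_sq V x ^ i * proj_sq ?W x ^ (l - i)))" for x
  proof -
    have "f x = f (norm (oproj V x) *\<^sub>R e + norm (x - oproj V x) *\<^sub>R e')"
      by (rule stabilizer_invariant_normal_form[OF V inv e e'])
    also have "\<dots> = (\<Sum>i\<le>l. c i * of_real (proj_sq V x ^ i * proj_sq ?W x ^ (l - i)))"
      unfolding even c_def proj_sq_def oproj_orthogonal_comp[OF V] ..
    finally show ?thesis .
  qed
  have lap: "laplacian f x = (\<Sum>i\<le>l. c i * of_real (
      (4 * real i * (real i - 1) + 2 * real i * real (dim V)) * proj_sq V x ^ (i - 1) * proj_sq ?W x ^ (l - i)
      + (4 * real (l - i) * (real (l - i) - 1) + 2 * real (l - i) * real (dim ?W)) * proj_sq V x ^ i * proj_sq ?W x ^ (l - i - 1)))" for x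
  proof -
    have "oproj V x \<bullet> oproj ?W x = 0"
      using oproj_orthogonal[OF V oproj_in[OF V], of x x] by (simp add: oproj_orthogonal_comp[OF V] inner_commute)
    then have t: "laplacian (\<lambda>x. of_real (proj_sq V x ^ i * proj_sq ?W x ^ (l - i))) x = of_real (
      (4 * real i * (real i - 1) + 2 * real i * real (dim V)) * proj_sq V x ^ (i - 1) * proj_sq ?W x ^ (l - i)
      + (4 * real (l - i) * (real (l - i) - 1) + 2 * real (l - i) * real (dim ?W)) * proj_sq V x ^ i * proj_sq ?W x ^ (l - i - 1))" for i
      unfolding laplacian_proj_sq_powers[OF V W] by simp
    have "f = (\<lambda>x. \<Sum>i\<le>l. c i * of_real (proj_sq V x ^ i * proj_sq ?W x ^ (l - i)))"
      using f_eq by blast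
    then show ?thesis
      by (simp only: laplacian_sum[OF finite_atMost polynomial_function_of_real[OF real_polynomial_function.intros(4)[OF
          real_polynomial_function_power[OF real_polynomial_function_proj_sq[OF V]]
          real_polynomial_function_power[OF real_polynomial_function_proj_sq[OF W]]]]] t)
  qed
  define A where "A i = 4 * real i * (real i - 1) + 2 * real i * real (dim V)" for i
  define B where "B i = 4 * real (l - i) * (real (l - i) - 1) + 2 * real (l - i) * real (dim ?W)" for i
  have proj_e: "proj_sq V (\<alpha> *\<^sub>R e + \<beta> *\<^sub>R e') = \<alpha>^2" "proj_sq ?W (\<alpha> *\<^sub>R e + \<beta> *\<^sub>R e') = \<beta>^2" for \<alpha> \<beta>
  proof -
    have "oproj V (\<alpha> *\<^sub>R e + \<beta> *\<^sub>R e') = \<alpha> *\<^sub>R e"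
      by (rule oproj_eqI[OF V]) (use e e' V in \<open>auto simp: subspace_scale orthogonal_comp_def orthogonal_def inner_commute\<close>)
    then show "proj_sq V (\<alpha> *\<^sub>R e + \<beta> *\<^sub>R e') = \<alpha>^2" "proj_sq ?W (\<alpha> *\<^sub>R e + \<beta> *\<^sub>R e') = \<beta>^2"
      using e(2) e'(2) by (simp_all add: proj_sq_def oproj_orthogonal_comp[OF V] power_mult_distrib)
  qed
  have cl: "c l = 0"
  proof -
    have "f e = f (1 *\<^sub>R e + 0 *\<^sub>R e')" by simp
    also have "\<dots> = (\<Sum>i\<le>l. if i = l then c l else 0)"
      unfolding f_eq proj_e by (rule sum.cong) auto
    finally show ?thesis
      using 0 by simp
  qed
  define P where "P = (\<Sum>i<l. monom (c (Suc i) * of_real (A (Suc i)) + c i * of_real (B i)) i)"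
  have "P = 0"
  proof (rule complex_poly_eq_on_reals)
    show "infinite {0 :: real..}"
      by (rule infinite_Ici)
    fix u :: real assume "u \<in> {0..}"
    then have u: "sqrt u ^ 2 = u" by simp
    have "0 = laplacian f (sqrt u *\<^sub>R e + 1 *\<^sub>R e')"
      using f by (simp add: harmonics_iff)
    also have "\<dots> = (\<Sum>i\<le>l. c i * of_real (A i * u ^ (i - 1)) + c i * of_real (B i * u ^ i))"
      unfolding lap proj_e u A_def B_def by (simp add: algebra_simps)
    also have "\<dots> = (\<Sum>i\<le>l. c i * of_real (A i * u ^ (i - 1))) + (\<Sum>i\<le>l. c i * of_real (B i * u ^ i))"
      by (rule sum.distrib)
    also have "(\<Sum>i\<le>l. c i * of_real (A i * u ^ (i - 1))) = (\<Sum>i<l. c (Suc i) * of_real (A (Suc i) * u ^ i))"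
      by (cases l) (simp_all add: A_def sum.atMost_Suc_shift lessThan_Suc_atMost del: sum.atMost_Suc)
    also have "(\<Sum>i\<le>l. c i * of_real (B i * u ^ i)) = (\<Sum>i<l. c i * of_real (B i * u ^ i))"
      by (simp add: lessThan_Suc_atMost[symmetric] B_def)
    finally show "poly P (of_real u) = poly 0 (of_real u)"
      by (simp add: P_def poly_sum poly_monom sum.distrib[symmetric] algebra_simps)
  qed
  have rec: "c (Suc i) * of_real (A (Suc i)) + c i * of_real (B i) = 0" if "i < l" for i
  proof -
    have "c (Suc i) * of_real (A (Suc i)) + c i * of_real (B i) = coeff P i"
      using that by (simp add: P_def coeff_sum)
    then show ?thesis
      using \<open>P = 0\<close> by simp
  qed
  have dimW: "0 < dim ?W"
  proof (rule ccontr)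
    assume "\<not> 0 < dim ?W"
    then have "?W \<subseteq> {0}" by (simp add: dim_eq_0)
    then show False using e' by auto
  qed
  have "c (l - j) = 0" if "j \<le> l" for j
    using that
  proof (induction j)
    case 0
    show ?case using cl by simp
  next
    case (Suc j)
    have "B (l - Suc j) > 0"
      using Suc.prems dimW unfolding B_def by (intro add_nonneg_pos) auto
    then show ?case
      using rec[of "l - Suc j"] Suc by (simp add: Suc_diff_Suc)
  qed
  then have "c i = 0" if "i \<le> l" for i
    using that by (metis diff_diff_cancel diff_le_self)
  then show ?thesis
    using f_eq by (intro ext) simp
qed

lemma unit_vector_in_subspace:
  fixes V :: "(real ^ 'd) set"
  assumes "subspace V" "0 < dim V"
  obtains e where "e \<in> V" "norm e = 1"
proof -
  obtain v where v: "v \<in> V" "v \<noteq> 0"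
    using assms(2) dim_eq_0[of V] by fastforce
  then show thesis
    using that[of "inverse (norm v) *\<^sub>R v"] assms(1) by (simp add: subspace_scale)
qed

lemma unit_vector_in_complement:
  fixes V :: "(real ^ 'd) set"
  assumes "subspace V" "dim V < CARD('d)"
  obtains e where "e \<in> orthogonal_comp V" "norm e = 1"
  using unit_vector_in_subspace[OF subspace_orthogonal_comp, of V] dim_orthogonal_comp[OF assms(1)] assms(2)
  by (metis add.left_neutral less_irrefl neq0_conv)

text \<open>A zero at \<open>e\<close> would make the zonal harmonic vanish identically. But on the unit circle through \<open>e\<close> and
  a unit vector of the complement it is a polynomial with leading coefficient one in the squared
  length of the component along \<open>e\<close>.\<close>

lemma zonal_nonzero:
  fixes V :: "(real ^ 'd) set"
  assumes V: "subspace V" "dim V < CARD('d)" and e: "e \<in> V" "norm e = 1"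
  shows "zonal V l e \<noteq> 0"
proof
  assume 0: "zonal V l e = 0"
  obtain e' where e': "e' \<in> orthogonal_comp V" "norm e' = 1"
    using unit_vector_in_complement[OF V] .
  have ee': "e \<bullet> e' = 0"
    using e e' by (auto simp: orthogonal_comp_def orthogonal_def)
  have "0 < dim V"
    using e by (metis dim_eq_0 neq0_conv norm_zero singletonD subsetD zero_neq_one)
  then have "2 \<le> CARD('d)"
    using V by linarith
  then have "czonal V l = (\<lambda>x. 0)"
    using 0 by (intro invariant_harmonic_eq_0[OF V(1) zonal_stabilizer_invariant zonal_harmonic e e']) (auto simp: V)
  then have z: "zonal V l x = 0" for x
    by (metis of_real_eq_0_iff)
  let ?e = "zonal_coeff CARD('d) (dim V) l"
  define P where "P = (\<Sum>i\<le>l. monom (complex_of_real (?e i)) i)"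
  have "P = 0"
  proof (rule complex_poly_eq_on_reals)
    show "infinite {0..1::real}" by simp
    fix u :: real assume "u \<in> {0..1}"
    then have u: "sqrt u ^ 2 = u" "sqrt (1 - u) ^ 2 = 1 - u" by auto
    let ?x = "sqrt u *\<^sub>R e + sqrt (1 - u) *\<^sub>R e'"
    have "oproj V ?x = sqrt u *\<^sub>R e"
      by (rule oproj_eqI[OF V(1)]) (use e e' V in \<open>auto simp: subspace_scale orthogonal_comp_def orthogonal_def inner_commute\<close>)
    then have s: "proj_sq V ?x = u"
      using e(2) u by (simp add: proj_sq_def power_mult_distrib)
    have r: "norm ?x ^ 2 = 1"
      using e(2) e'(2) ee' u
      by (subst norm_add_Pythagorean) (auto simp: orthogonal_def power_mult_distrib)
    have "(\<Sum>i\<le>l. ?e i * u ^ i) = 0"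
      using z[of ?x] unfolding zonal_def s r by simp
    then have "(\<Sum>i\<le>l. of_real (?e i) * complex_of_real u ^ i) = 0"
      by (metis (mono_tags, lifting) of_real_0 of_real_mult of_real_power of_real_sum sum.cong)
    then show "poly P (of_real u) = poly 0 (of_real u)"
      by (simp add: P_def poly_sum poly_monom)
  qed
  moreover have "coeff P l = 1"
    by (simp add: P_def coeff_sum)
  ultimately show False by simp
qed

lemma reflection_image:
  assumes V: "subspace V" and w: "w \<in> V \<union> orthogonal_comp V"
  shows "reflection w ` V = V"
proof -
  have "reflection w v \<in> V" if "v \<in> V" for v
    using oproj_reflection[OF assms, of v] oproj_ident[OF V that] oproj_in[OF V, of "reflection w v"] by simp
  moreover have "reflection w (reflection w v) = v" for v
    using orthogonal_transformation_inv_apply(2)[OF orthogonal_transformation_reflection, of w v]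
    by (simp add: inv_reflection)
  ultimately show ?thesis
    by (metis imageI image_subsetI subsetI subset_antisym)
qed

lemma harmonics_riesz_whole:
  assumes "\<And>f g. f \<in> harmonics m \<Longrightarrow> g \<in> harmonics m \<Longrightarrow> L (\<lambda>x. f x + g x) = L f + L g"
    and "\<And>c f. f \<in> harmonics m \<Longrightarrow> L (\<lambda>x. c * f x) = c * L f"
  obtains n where "n \<in> harmonics m" "\<And>f. f \<in> harmonics m \<Longrightarrow> L f = ball_inner f n"
proof -
  show thesis
    by (rule harmonics_riesz[where F = "harmonics m" and m = m and L = L])
       (fact subset_refl harmonics_zero harmonics_add harmonics_mult assms that)+
qed

lemma riesz_vector_stabilizer_invariant:
  assumes F: "F \<subseteq> harmonics m"
    and add: "\<And>f g. f \<in> F \<Longrightarrow> g \<in> F \<Longrightarrow> (\<lambda>x. f x + g x) \<in> F"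
    and scale: "\<And>c f. f \<in> F \<Longrightarrow> (\<lambda>x. c * f x) \<in> F"
    and closed: "\<And>f w. f \<in> F \<Longrightarrow> w \<in> V \<union> orthogonal_comp V \<Longrightarrow> (\<lambda>x. f (reflection w x)) \<in> F"
    and n: "n \<in> F" "\<And>f. f \<in> F \<Longrightarrow> L f = ball_inner f n"
    and inv: "\<And>f w. f \<in> F \<Longrightarrow> w \<in> V \<union> orthogonal_comp V \<Longrightarrow> L (\<lambda>x. f (reflection w x)) = L f"
  shows "stabilizer_invariant V n"
  unfolding stabilizer_invariant_def
proof (intro ballI allI)
  fix w x assume w: "w \<in> V \<union> orthogonal_comp V"
  show "n (reflection w x) = n x"
  proof (rule riesz_vector_invariant[OF orthogonal_transformation_reflection F _ n])
    show "(\<lambda>x. n (reflection w x) - n x) \<in> F"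
      using add[OF closed[OF n(1) w] scale[OF n(1), of "-1"]] by simp
  next
    fix f assume "f \<in> F"
    then show "(\<lambda>x. f (inv (reflection w) x)) \<in> F" "L (\<lambda>x. f (inv (reflection w) x)) = L f"
      unfolding inv_reflection using w by (blast intro: closed inv)+
  qed
qed

lemma invariant_harmonics_proportional:
  assumes V: "subspace V" and n: "stabilizer_invariant V n" "n \<in> harmonics (2 * l)"
    and u: "stabilizer_invariant V u" "u \<in> harmonics (2 * l)"
    and e: "e \<in> V" "norm e = 1" and e': "e' \<in> orthogonal_comp V" "norm e' = 1" and ue: "u e \<noteq> 0"
  shows "n x = n e / u e * u x"
proof -
  have "(\<lambda>x. n x - n e / u e * u x) = (\<lambda>x. 0)"
  proof (rule invariant_harmonic_eq_0[OF V _ _ e e'])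
    show "stabilizer_invariant V (\<lambda>x. n x - n e / u e * u x)"
      using n(1) u(1) by (simp add: stabilizer_invariant_def)
    show "(\<lambda>x. n x - n e / u e * u x) \<in> harmonics (2 * l)"
      by (intro harmonics_diff harmonics_mult n u)
  qed (simp add: ue)
  then show ?thesis
    by (metis eq_iff_diff_eq_0)
qed

text \<open>Schur's lemma in the form needed here: the functionals fixed by the stabilizer of \<open>V\<close> form a
  line. The Riesz vector of such a functional is itself fixed by the stabilizer, hence proportional
  to the zonal harmonic.\<close>

lemma stabilizer_invariant_functional:
  fixes V :: "(real ^ 'd) set"
  assumes V: "subspace V" "0 < dim V" "dim V < CARD('d)"
    and add: "\<And>f g. f \<in> harmonics (2 * l) \<Longrightarrow> g \<in> harmonics (2 * l) \<Longrightarrow> L (\<lambda>x. f x + g x) = L f + L g"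
    and scale: "\<And>c f. f \<in> harmonics (2 * l) \<Longrightarrow> L (\<lambda>x. c * f x) = c * L f"
    and inv: "\<And>f w. f \<in> harmonics (2 * l) \<Longrightarrow> w \<in> V \<union> orthogonal_comp V \<Longrightarrow> L (\<lambda>x. f (reflection w x)) = L f"
  obtains c where "\<And>h. h \<in> harmonics (2 * l) \<Longrightarrow> L h = c * ball_inner h (czonal V l)"
proof -
  obtain n where n: "n \<in> harmonics (2 * l)" "\<And>f. f \<in> harmonics (2 * l) \<Longrightarrow> L f = ball_inner f n"
    using harmonics_riesz_whole[of "2 * l" L, OF add scale] by blast
  have sn: "stabilizer_invariant V n"
    by (rule riesz_vector_stabilizer_invariant[OF subset_refl _ _ _ n inv])
       (auto intro: harmonics_add harmonics_mult harmonics_orthogonal orthogonal_transformation_reflection)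
  obtain e where e: "e \<in> V" "norm e = 1"
    using unit_vector_in_subspace V by metis
  obtain e' where e': "e' \<in> orthogonal_comp V" "norm e' = 1"
    using unit_vector_in_complement V by metis
  have "2 \<le> CARD('d)"
    using V by linarith
  then have z: "czonal V l \<in> harmonics (2 * l)"
    by (rule zonal_harmonic[OF V(1)])
  have ne: "czonal V l e \<noteq> 0"
    using zonal_nonzero[OF V(1,3) e] by simp
  have "n = (\<lambda>x. n e / czonal V l e * czonal V l x)"
    using invariant_harmonics_proportional[OF V(1) sn n(1) zonal_stabilizer_invariant[OF V(1)] z e e' ne] by blast
  then obtain c where "n = (\<lambda>x. c * czonal V l x)"
    by blast
  then have "L h = cnj c * ball_inner h (czonal V l)" if "h \<in> harmonics (2 * l)" for h
    using n(2)[OF that] by (simp add: ball_inner_mult_right)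
  then show thesis
    by (rule that)
qed

lemma grassmannian_containing:
  fixes e :: "real ^ 'd"
  assumes "1 \<le> k" "k \<le> CARD('d)" and e: "norm e = 1"
  obtains V where "V \<in> grassmannian k" "e \<in> V"
proof -
  obtain T :: "(real ^ 'd) set" where T: "subspace T" "dim T = k"
    using choose_subspace_of_subspace[of k "UNIV :: (real ^ 'd) set"] assms(2) by auto
  then obtain v where v: "v \<in> T" "norm v = 1"
    using unit_vector_in_subspace assms(1) by (metis One_nat_def Suc_le_eq)
  have "reflection (v - e) ` T \<in> grassmannian k"
    using T by (intro grassmannian_image orthogonal_transformation_reflection) (simp add: grassmannian_def)
  moreover have "e \<in> reflection (v - e) ` T"
    using reflection_swap[of v e] v e by (metis imageI)
  ultimately show thesis
    by (rule that)
qed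

text \<open>Irreducibility enters here. The common zeros \<open>N\<close> of all the pairings form an invariant space.
  If \<open>N\<close> were not zero, evaluation at some unit vector \<open>e\<close> would not vanish on it; its Riesz vector
  in \<open>N\<close> and its Riesz vector in the whole space are both fixed by the stabilizer of the line
  through \<open>e\<close>, hence proportional. So \<open>N\<close> contains the second one, and every zonal harmonic of a
  space \<open>V\<close> containing \<open>e\<close> would vanish at \<open>e\<close>.\<close>

lemma zonal_separates:
  fixes h :: "real ^ 'd \<Rightarrow> complex"
  assumes k: "1 \<le> k" "k < CARD('d)" and h: "h \<in> harmonics (2 * l)"
    and 0: "\<And>V. V \<in> grassmannian k \<Longrightarrow> ball_inner h (czonal V l) = 0"
  shows "h = (\<lambda>x. 0)"
proof (rule harmonics_eq_0_on_sphere[OF h], rule ccontr)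
  fix e :: "real ^ 'd" assume e: "norm e = 1" "h e \<noteq> 0"
  let ?H = "harmonics (2 * l) :: (real ^ 'd \<Rightarrow> complex) set"
  define N where "N = {f \<in> ?H. \<forall>V\<in>grassmannian k. ball_inner f (czonal V l) = 0}"
  have d: "2 \<le> CARD('d)"
    using k by linarith
  have gr: "subspace V" "dim V = k" if "V \<in> grassmannian k" for V :: "(real ^ 'd) set"
    using that by (auto simp: grassmannian_def)
  have z: "czonal V l \<in> ?H" if "V \<in> grassmannian k" for V
    using zonal_harmonic[OF gr(1)[OF that] d] .
  have N: "N \<subseteq> ?H"
    by (auto simp: N_def)
  have N0: "(\<lambda>x. 0) \<in> N"
    using ball_inner_mult_left[of 0 "\<lambda>x :: real ^ 'd. 0"] by (simp add: N_def harmonics_zero)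
  have Nadd: "(\<lambda>x. f x + g x) \<in> N" if "f \<in> N" "g \<in> N" for f g
  proof -
    have "ball_inner (\<lambda>x. f x + g x) (czonal V l) = ball_inner f (czonal V l) + ball_inner g (czonal V l)"
      if "V \<in> grassmannian k" for V
      by (intro ball_inner_add_left harmonics_continuous[OF z[OF that]])
         (use \<open>f \<in> N\<close> \<open>g \<in> N\<close> N harmonics_continuous in blast)+
    then show ?thesis
      using that by (simp add: N_def harmonics_add)
  qed
  have Nscale: "(\<lambda>x. c * f x) \<in> N" if "f \<in> N" for f c
    using that by (simp add: N_def harmonics_mult ball_inner_mult_left)
  have Nrefl: "(\<lambda>x. f (reflection w x)) \<in> N" if "f \<in> N" for f and w :: "real ^ 'd"
  proof -
    have "ball_inner (\<lambda>x. f (reflection w x)) (czonal V l) = 0" if V: "V \<in> grassmannian k" for V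
    proof -
      let ?r = "reflection w"
      have r: "orthogonal_transformation ?r"
        by (rule orthogonal_transformation_reflection)
      have V': "?r ` V \<in> grassmannian k"
        by (rule grassmannian_image[OF r V])
      have "ball_inner (\<lambda>x. f (?r x)) (czonal V l) = ball_inner (\<lambda>x. f (?r x)) (\<lambda>x. czonal (?r ` V) l (?r x))"
        by (simp add: zonal_image[OF r gr(1)[OF V]])
      also have "\<dots> = ball_inner f (czonal (?r ` V) l)"
        using \<open>f \<in> N\<close> N by (intro ball_inner_orthogonal r harmonics_continuous[OF z[OF V']]) (auto intro: harmonics_continuous)
      also have "\<dots> = 0"
        using \<open>f \<in> N\<close> V' by (simp add: N_def)
      finally show ?thesis .
    qed
    then show ?thesis
      using that by (simp add: N_def harmonics_orthogonal orthogonal_transformation_reflection)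
  qed
  obtain n where n: "n \<in> N" "\<And>f. f \<in> N \<Longrightarrow> f e = ball_inner f n"
    using harmonics_riesz[OF N N0 Nadd Nscale, of "\<lambda>f. f e"] by blast
  obtain n' where n': "n' \<in> ?H" "\<And>f. f \<in> ?H \<Longrightarrow> f e = ball_inner f n'"
    using harmonics_riesz_whole[of "2 * l" "\<lambda>f. f e"] by blast
  define E where "E = span {e}"
  have E: "subspace E" "e \<in> E"
    by (simp_all add: E_def span_base)
  have "e \<noteq> 0" using e by auto
  then have "dim E = 1"
    by (simp add: E_def dim_insert)
  then obtain e' where e': "e' \<in> orthogonal_comp E" "norm e' = 1"
    using unit_vector_in_complement[OF E(1)] d by auto
  have refl_e: "f (reflection w e) = f e" if "f \<in> ?H" "w \<in> E \<union> orthogonal_comp E" for f w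
    using that(2)
  proof
    assume "w \<in> orthogonal_comp E"
    then have "e \<bullet> w = 0"
      using E by (auto simp: orthogonal_comp_def orthogonal_def)
    then show ?thesis
      by (simp add: reflection_orthogonal)
  next
    assume "w \<in> E"
    then obtain t where t: "w = t *\<^sub>R e"
      by (auto simp: E_def span_singleton)
    show ?thesis
    proof (cases "t = 0")
      case False
      have "e \<bullet> e = 1"
        using e(1) by (simp add: norm_eq_1)
      then have "reflection w e = (-1) *\<^sub>R e"
        using False by (simp add: reflection_def t) (simp add: scaleR_2)
      then show ?thesis
        using harmonics_scaleR[OF that(1), of "-1" e] by simp
    qed (simp add: t reflection_def)
  qed
  have sn: "stabilizer_invariant E n"
    by (rule riesz_vector_stabilizer_invariant[OF N Nadd Nscale Nrefl n]) (use refl_e N in blast)+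
  have sn': "stabilizer_invariant E n'"
    by (rule riesz_vector_stabilizer_invariant[OF subset_refl harmonics_add harmonics_mult _ n'])
       (auto intro: harmonics_orthogonal orthogonal_transformation_reflection refl_e)
  have hN: "h \<in> N"
    using h 0 by (simp add: N_def)
  have "n e \<noteq> 0"
  proof
    assume "n e = 0"
    then have "n = (\<lambda>x. 0)"
      by (rule invariant_harmonic_eq_0[OF E(1) sn _ E(2) e(1) e', rotated]) (use n N in blast)
    then have "h e = 0"
      using n(2)[OF hN] ball_inner_mult_right[of h 0 "\<lambda>x. 0"] by simp
    then show False
      using e by simp
  qed
  then have "n' = (\<lambda>x. n' e / n e * n x)"
    using invariant_harmonics_proportional[OF E(1) sn' n'(1) sn _ E(2) e(1) e'] n N by blast
  then have "n' \<in> N"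
    using Nscale[OF n(1), of "n' e / n e"] by simp
  obtain V where V: "V \<in> grassmannian k" "e \<in> V"
    using grassmannian_containing[of k e] k e by auto
  have "czonal V l e = ball_inner (czonal V l) n'"
    by (rule n'(2)[OF z[OF V(1)]])
  also have "\<dots> = 0"
    using \<open>n' \<in> N\<close> V(1) by (simp add: N_def ball_inner_commute[of _ n'])
  finally show False
    using zonal_nonzero[OF gr(1)[OF V(1)] _ V(2) e(1)] gr(2)[OF V(1)] k by simp
qed

section \<open>The harmonic summands of the functions on the Grassmann space\<close>

definition zonal_transform :: "nat \<Rightarrow> nat \<Rightarrow> (real ^ 'd \<Rightarrow> complex) \<Rightarrow> (real ^ 'd) set \<Rightarrow> complex" where
  "zonal_transform k l h V = (if V \<in> grassmannian k then ball_inner h (czonal V l) else 0)"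

text \<open>Expanding one factor of the power at a time takes the entries of \<open>M\<close> out of the integral; the function
  is in fact a polynomial in these entries.\<close>

lemma continuous_ball_integral_quadratic_power:
  fixes w :: "real ^ 'd \<Rightarrow> complex"
  assumes "continuous_on UNIV w"
  shows "continuous_on UNIV (\<lambda>M :: real ^ 'd ^ 'd. ball_integral (\<lambda>x. w x * of_real ((x \<bullet> (M *v x)) ^ i)))"
  using assms
proof (induction i arbitrary: w)
  case (Suc i)
  have quad: "x \<bullet> (M *v x) = (\<Sum>(a, b)\<in>UNIV. M $ a $ b * (x $ a * x $ b))" for M :: "real ^ 'd ^ 'd" and x
    by (simp add: inner_vec_def matrix_vector_mult_def sum_distrib_left sum.cartesian_product algebra_simps UNIV_Times_UNIV[symmetric] del: UNIV_Times_UNIV)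
  have cont: "continuous_on UNIV (\<lambda>x :: real ^ 'd. w x * of_real (x $ a * x $ b))" for a b
    by (intro continuous_intros Suc.prems)
  have "ball_integral (\<lambda>x. w x * of_real ((x \<bullet> (M *v x)) ^ Suc i)) =
      (\<Sum>(a, b)\<in>UNIV. of_real (M $ a $ b) * ball_integral (\<lambda>x. w x * of_real (x $ a * x $ b) * of_real ((x \<bullet> (M *v x)) ^ i)))"
    for M :: "real ^ 'd ^ 'd"
  proof -
    have "(\<lambda>x. w x * of_real ((x \<bullet> (M *v x)) ^ Suc i)) =
      (\<lambda>x. \<Sum>p\<in>UNIV. of_real (M $ fst p $ snd p) * (w x * of_real (x $ fst p * x $ snd p) * of_real ((x \<bullet> (M *v x)) ^ i)))"
    proof
      fix x
      have "w x * of_real ((x \<bullet> (M *v x)) ^ Suc i) = w x * of_real (\<Sum>p\<in>UNIV. M $ fst p $ snd p * (x $ fst p * x $ snd p)) * of_real ((x \<bullet> (M *v x)) ^ i)"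
        by (simp add: quad[of x M] split_def)
      also have "\<dots> = (\<Sum>p\<in>UNIV. of_real (M $ fst p $ snd p) * (w x * of_real (x $ fst p * x $ snd p) * of_real ((x \<bullet> (M *v x)) ^ i)))"
        unfolding of_real_sum sum_distrib_left sum_distrib_right by (rule sum.cong) (simp_all add: algebra_simps)
      finally show "w x * of_real ((x \<bullet> (M *v x)) ^ Suc i) = (\<Sum>p\<in>UNIV. of_real (M $ fst p $ snd p) * (w x * of_real (x $ fst p * x $ snd p) * of_real ((x \<bullet> (M *v x)) ^ i)))" .
    qed
    moreover have "continuous_on UNIV (\<lambda>x. of_real (M $ fst p $ snd p) * (w x * of_real (x $ fst p * x $ snd p) * of_real ((x \<bullet> (M *v x)) ^ i)))" for p
      by (intro continuous_intros Suc.prems linear_continuous_on matrix_vector_mul_bounded_linear)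
    ultimately show ?thesis
      by (simp only: ball_integral_sum[OF finite] ball_integral_mult split_def)
  qed
  then show ?case
    unfolding split_def by (simp only:) (intro continuous_intros Suc.IH[OF cont])
qed simp

lemma ball_inner_zonal_eq:
  fixes V :: "(real ^ 'd) set"
  assumes h: "continuous_on UNIV h" and V: "V \<in> grassmannian k"
  shows "ball_inner h (czonal V l) = (\<Sum>i\<le>l. of_real (zonal_coeff CARD('d) k l i) *
     ball_integral (\<lambda>x. h x * of_real ((norm x ^ 2) ^ (l - i)) * of_real ((x \<bullet> (matrix (oproj V) *v x)) ^ i)))"
proof -
  have sV: "subspace V" "dim V = k"
    using V by (auto simp: grassmannian_def)
  have p: "proj_sq V x = x \<bullet> (matrix (oproj V) *v x)" for x
    using oproj_self_adjoint[OF sV(1), of x x] by (simp add: matrix_works linear_oproj sV proj_sq_inner)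
  have "(\<lambda>x. h x * cnj (czonal V l x)) = (\<lambda>x. \<Sum>i\<le>l. of_real (zonal_coeff CARD('d) k l i) *
     (h x * of_real ((norm x ^ 2) ^ (l - i)) * of_real ((x \<bullet> (matrix (oproj V) *v x)) ^ i)))"
    by (simp add: zonal_def sV(2) p sum_distrib_left algebra_simps)
  moreover have "continuous_on UNIV (\<lambda>x. of_real (zonal_coeff CARD('d) k l i) *
     (h x * of_real ((norm x ^ 2) ^ (l - i)) * of_real ((x \<bullet> (matrix (oproj V) *v x)) ^ i)))" for i
    by (intro continuous_intros h linear_continuous_on matrix_vector_mul_bounded_linear)
  ultimately show ?thesis
    unfolding ball_inner_def by (simp only: ball_integral_sum[OF finite_atMost] ball_integral_mult)
qed

lemma zonal_transform_continuous:
  fixes h :: "real ^ 'd \<Rightarrow> complex"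
  assumes h: "continuous_on UNIV h"
  shows "zonal_transform k l h \<in> grassmann_C k"
proof -
  define F :: "real ^ 'd ^ 'd \<Rightarrow> complex" where "F M = (\<Sum>i\<le>l. of_real (zonal_coeff CARD('d) k l i) *
     ball_integral (\<lambda>x. h x * of_real ((norm x ^ 2) ^ (l - i)) * of_real ((x \<bullet> (M *v x)) ^ i)))" for M
  have "continuous_on UNIV F"
    unfolding F_def by (intro continuous_intros continuous_ball_integral_quadratic_power h)
  then have "continuous_map (grassmann_topology k) euclidean (F \<circ> (\<lambda>V. matrix (oproj V)))"
    unfolding grassmann_topology_def by (intro continuous_map_pullback) simp
  then have "continuous_map (grassmann_topology k) euclidean (zonal_transform k l h)"
    by (rule continuous_map_eq)
       (auto simp: grassmann_topology_def topspace_pullback_topology F_def zonal_transform_def ball_inner_zonal_eq[OF h])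
  then show ?thesis
    by (simp add: grassmann_C_def zonal_transform_def)
qed

lemma grassmannianD: "V \<in> grassmannian k \<Longrightarrow> subspace V" "V \<in> grassmannian k \<Longrightarrow> dim V = k"
  by (auto simp: grassmannian_def)

lemma grassmannian_zonal_harmonic:
  fixes V :: "(real ^ 'd) set"
  assumes "1 \<le> k" "k < CARD('d)" "V \<in> grassmannian k"
  shows "czonal V l \<in> harmonics (2 * l)"
  using assms by (intro zonal_harmonic) (auto simp: grassmannian_def)

lemma zonal_transform_add:
  fixes f g :: "real ^ 'd \<Rightarrow> complex"
  assumes "1 \<le> k" "k < CARD('d)" "f \<in> harmonics (2 * l)" "g \<in> harmonics (2 * l)"
  shows "zonal_transform k l (\<lambda>x. f x + g x) = (\<lambda>V. zonal_transform k l f V + zonal_transform k l g V)"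
proof
  fix V :: "(real ^ 'd) set"
  show "zonal_transform k l (\<lambda>x. f x + g x) V = zonal_transform k l f V + zonal_transform k l g V"
  proof (cases "V \<in> grassmannian k")
    case True
    then show ?thesis
      using ball_inner_add_left[OF assms(3,4)[THEN harmonics_continuous]
          harmonics_continuous[OF grassmannian_zonal_harmonic[OF assms(1,2) True]]]
      by (simp add: zonal_transform_def)
  qed (simp add: zonal_transform_def)
qed

lemma zonal_transform_mult:
  "zonal_transform k l (\<lambda>x. c * f x) = (\<lambda>V. c * zonal_transform k l f V)"
  by (simp add: zonal_transform_def fun_eq_iff ball_inner_mult_left)

lemma zonal_transform_orthogonal:
  fixes g :: "real ^ 'd \<Rightarrow> real ^ 'd"
  assumes k: "1 \<le> k" "k < CARD('d)" and g: "orthogonal_transformation g" and h: "continuous_on UNIV h"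
  shows "zonal_transform k l (\<lambda>x. h (g x)) V = zonal_transform k l h (g ` V)"
proof (cases "V \<in> grassmannian k")
  case True
  have gV: "g ` V \<in> grassmannian k"
    by (rule grassmannian_image[OF g True])
  have "ball_inner (\<lambda>x. h (g x)) (czonal V l) = ball_inner (\<lambda>x. h (g x)) (\<lambda>x. czonal (g ` V) l (g x))"
    by (simp add: zonal_image[OF g grassmannianD(1)[OF True]])
  also have "\<dots> = ball_inner h (czonal (g ` V) l)"
    by (rule ball_inner_orthogonal[OF h harmonics_continuous[OF grassmannian_zonal_harmonic[OF k gV]] g])
  finally show ?thesis
    using True gV by (simp add: zonal_transform_def)
next
  case False
  have "inv g ` (g ` V) = V"
    by (simp add: image_comp o_def orthogonal_transformation_inv_apply[OF g])
  then have "g ` V \<notin> grassmannian k"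
    using False grassmannian_image[OF orthogonal_transformation_inv[OF g], of "g ` V" k] by auto
  then show ?thesis
    using False by (simp add: zonal_transform_def)
qed

lemma zonal_transform_injective:
  fixes f g :: "real ^ 'd \<Rightarrow> complex"
  assumes k: "1 \<le> k" "k < CARD('d)" and f: "f \<in> harmonics (2 * l)" and g: "g \<in> harmonics (2 * l)"
    and eq: "zonal_transform k l f = zonal_transform k l g"
  shows "f = g"
proof -
  have g': "(\<lambda>x. (-1) * g x) \<in> harmonics (2 * l)"
    by (rule harmonics_mult[OF g])
  have "(\<lambda>x. f x + (-1) * g x) = (\<lambda>x. 0)"
  proof (rule zonal_separates[OF k harmonics_add[OF f g']])
    fix V :: "(real ^ 'd) set" assume V: "V \<in> grassmannian k"
    have "zonal_transform k l (\<lambda>x. f x + (-1) * g x) V = 0"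
      unfolding zonal_transform_add[OF k f g'] zonal_transform_mult eq by simp
    then show "ball_inner (\<lambda>x. f x + (-1) * g x) (czonal V l) = 0"
      using V by (simp add: zonal_transform_def)
  qed
  then show ?thesis
    by (auto simp: fun_eq_iff)
qed

lemma is_harmonic_copy_zonal_transform:
  assumes k: "1 \<le> k" "k < CARD('d)"
  shows "is_harmonic_copy k (2 * l) (zonal_transform k l ` (harmonics (2 * l) :: (real ^ 'd \<Rightarrow> complex) set))"
  unfolding is_harmonic_copy_def
proof (intro conjI exI[of _ "zonal_transform k l"])
  show "zonal_transform k l ` (harmonics (2 * l) :: (real ^ 'd \<Rightarrow> complex) set) \<subseteq> grassmann_C k"
    using zonal_transform_continuous harmonics_continuous by blast
  show "bij_betw (zonal_transform k l) (harmonics (2 * l) :: (real ^ 'd \<Rightarrow> complex) set) (zonal_transform k l ` harmonics (2 * l))"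
    using zonal_transform_injective[OF k] by (intro inj_on_imp_bij_betw inj_onI)
qed (simp_all add: zonal_transform_add[OF k] zonal_transform_mult fun_eq_iff
      zonal_transform_orthogonal[OF k orthogonal_transformation_inv harmonics_continuous])

lemma zonal_ball_inner_self_nonzero:
  fixes V :: "(real ^ 'd) set"
  assumes k: "1 \<le> k" "k < CARD('d)" and V: "V \<in> grassmannian k"
  shows "ball_inner (czonal V l) (czonal V l) \<noteq> 0"
proof
  assume "ball_inner (czonal V l) (czonal V l) = 0"
  then have "czonal V l = (\<lambda>x. 0)"
    by (rule harmonics_definite[OF grassmannian_zonal_harmonic[OF k V]])
  moreover obtain e where "e \<in> V" "norm e = 1"
    using unit_vector_in_subspace[of V] V k by (auto simp: grassmannian_def)
  ultimately show False
    using zonal_nonzero[of V e l] V k by (auto simp: grassmannian_def fun_eq_iff)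
qed

text \<open>Multiplicity one. Evaluation at \<open>V\<close> of any equivariant embedding is a functional fixed by the
  stabilizer of \<open>V\<close>, hence a multiple of the pairing with the zonal harmonic of \<open>V\<close>; the factor does
  not depend on \<open>V\<close> because the orthogonal group acts transitively.\<close>

lemma harmonic_copy_unique:
  fixes U :: "((real ^ 'd) set \<Rightarrow> complex) set"
  assumes k: "1 \<le> k" "k < CARD('d)" and U: "is_harmonic_copy k (2 * l) U"
  shows "U = zonal_transform k l ` harmonics (2 * l)"
proof -
  let ?H = "harmonics (2 * l) :: (real ^ 'd \<Rightarrow> complex) set"
  obtain T where T: "bij_betw T ?H U"
    and add: "\<And>f g. f \<in> ?H \<Longrightarrow> g \<in> ?H \<Longrightarrow> T (\<lambda>x. f x + g x) = (\<lambda>V. T f V + T g V)"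
    and scale: "\<And>a f. f \<in> ?H \<Longrightarrow> T (\<lambda>x. a * f x) = (\<lambda>V. a * T f V)"
    and equiv: "\<And>g f. orthogonal_transformation g \<Longrightarrow> f \<in> ?H \<Longrightarrow> T (\<lambda>x. f (inv g x)) = (\<lambda>V. T f (inv g ` V))"
    using U unfolding is_harmonic_copy_def by blast
  have vanish: "T f V = 0" if "f \<in> ?H" "V \<notin> grassmannian k" for f V
    using U T that bij_betwE[OF T] by (auto simp: is_harmonic_copy_def grassmann_C_def)
  have "\<exists>c. \<forall>h\<in>?H. T h V = c * ball_inner h (czonal V l)" if V: "V \<in> grassmannian k" for V
  proof -
    have sV: "subspace V" "0 < dim V" "dim V < CARD('d)"
      using V k by (auto simp: grassmannian_def)
    have inv: "T (\<lambda>x. f (reflection w x)) V = T f V" if "f \<in> ?H" "w \<in> V \<union> orthogonal_comp V" for f w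
      using equiv[OF orthogonal_transformation_reflection that(1), of w] reflection_image[OF sV(1) that(2)]
      by (simp add: inv_reflection)
    show ?thesis
    proof (rule stabilizer_invariant_functional[OF sV, of l "\<lambda>h. T h V"])
      fix c assume "\<And>h. h \<in> ?H \<Longrightarrow> T h V = c * ball_inner h (czonal V l)"
      then show ?thesis by blast
    qed (simp_all add: add scale inv)
  qed
  then obtain c where c: "\<And>V h. V \<in> grassmannian k \<Longrightarrow> h \<in> ?H \<Longrightarrow> T h V = c V * ball_inner h (czonal V l)"
    by metis
  obtain b :: "real ^ 'd" where "norm b = 1"
    using nonempty_Basis norm_Basis by blast
  then obtain V0 :: "(real ^ 'd) set" where V0: "V0 \<in> grassmannian k"
    using grassmannian_containing[of k b] k by auto
  have c_const: "c V = c V0" if V: "V \<in> grassmannian k" for V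
  proof -
    obtain g where g: "orthogonal_transformation g" "g ` V0 = V"
      using orthogonal_transformation_transitive[OF V0 V] .
    have z0: "czonal V0 l \<in> ?H" and z: "czonal V l \<in> ?H"
      using grassmannian_zonal_harmonic[OF k] V V0 by blast+
    have eq: "czonal V0 l (inv g x) = czonal V l x" for x
      using zonal_image[OF g(1) grassmannianD(1)[OF V0], of l "inv g x"]
      by (simp add: g(2) orthogonal_transformation_inv_apply[OF g(1)])
    have "inv g ` V = V0"
      by (simp add: g(2)[symmetric] image_comp o_def orthogonal_transformation_inv_apply[OF g(1)])
    then have "T (czonal V l) V = T (czonal V0 l) V0"
      using fun_cong[OF equiv[OF g(1) z0], of V] by (simp add: eq)
    moreover have "ball_inner (czonal V l) (czonal V l) = ball_inner (czonal V0 l) (czonal V0 l)"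
      using ball_inner_orthogonal[OF harmonics_continuous[OF z0] harmonics_continuous[OF z0] orthogonal_transformation_inv[OF g(1)]]
      by (simp add: eq)
    ultimately show ?thesis
      using c[OF V z] c[OF V0 z0] zonal_ball_inner_self_nonzero[OF k V0, of l] by simp
  qed
  have T_eq: "T h = zonal_transform k l (\<lambda>x. c V0 * h x)" if "h \<in> ?H" for h
    using c[OF _ that] c_const vanish[OF that] by (auto simp: zonal_transform_def ball_inner_mult_left fun_eq_iff)
  have c0: "c V0 \<noteq> 0"
  proof
    assume "c V0 = 0"
    then have "T (czonal V0 l) = T (\<lambda>x. 0)"
      using T_eq[OF grassmannian_zonal_harmonic[OF k V0]] T_eq[OF harmonics_zero] by simp
    then have "czonal V0 l = (\<lambda>x. 0)"
      using inj_onD[OF bij_betw_imp_inj_on[OF T]] grassmannian_zonal_harmonic[OF k V0] harmonics_zero by blast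
    moreover have "ball_inner (\<lambda>x. 0) (\<lambda>x :: real ^ 'd. 0) = 0"
      by (simp add: ball_inner_self ball_integral_def)
    ultimately show False
      using zonal_ball_inner_self_nonzero[OF k V0, of l] by simp
  qed
  have "U = T ` ?H"
    using bij_betw_imp_surj_on[OF T] by simp
  also have "\<dots> = zonal_transform k l ` ?H"
  proof
    show "T ` ?H \<subseteq> zonal_transform k l ` ?H"
      using T_eq harmonics_mult by blast
    show "zonal_transform k l ` ?H \<subseteq> T ` ?H"
    proof
      fix f assume "f \<in> zonal_transform k l ` ?H"
      then obtain h where h: "h \<in> ?H" "f = zonal_transform k l h" by blast
      have h': "(\<lambda>x. inverse (c V0) * h x) \<in> ?H"
        by (rule harmonics_mult[OF h(1)])
      have "T (\<lambda>x. inverse (c V0) * h x) = f"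
        unfolding T_eq[OF h'] h(2) using c0 by (simp add: mult.assoc[symmetric])
      then show "f \<in> T ` ?H"
        using h' by blast
    qed
  qed
  finally show ?thesis .
qed

lemma grassmann_H_eq:
  assumes k: "1 \<le> k" "k < CARD('d)"
  shows "grassmann_H k l = zonal_transform k l ` (harmonics (2 * l) :: (real ^ 'd \<Rightarrow> complex) set)"
  unfolding grassmann_H_def
  by (rule harmonic_copy_unique[OF k someI[of "is_harmonic_copy k (2 * l)", OF is_harmonic_copy_zonal_transform[OF k]]])

section \<open>Vanishing of the weighted zonal sums\<close>

definition zonal_sum :: "nat \<Rightarrow> (nat \<Rightarrow> (real ^ 'd) set) \<Rightarrow> (nat \<Rightarrow> real) \<Rightarrow> nat \<Rightarrow> real ^ 'd \<Rightarrow> real" where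
  "zonal_sum n V \<omega> l x = (\<Sum>j=1..n. \<omega> j * zonal (V j) l x)"

lemma zonal_sum_harmonic:
  fixes V :: "nat \<Rightarrow> (real ^ 'd) set"
  assumes k: "1 \<le> k" "k < CARD('d)" and V: "\<And>j. j \<in> {1..n} \<Longrightarrow> V j \<in> grassmannian k"
  shows "(\<lambda>x. of_real (zonal_sum n V \<omega> l x)) \<in> harmonics (2 * l)"
  unfolding zonal_sum_def of_real_sum of_real_mult
  by (intro harmonics_sum harmonics_mult grassmannian_zonal_harmonic[OF k] V) simp_all

lemma ball_inner_zonal_sum:
  fixes V :: "nat \<Rightarrow> (real ^ 'd) set"
  assumes k: "1 \<le> k" "k < CARD('d)" and V: "\<And>j. j \<in> {1..n} \<Longrightarrow> V j \<in> grassmannian k"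
    and h: "continuous_on UNIV h"
  shows "ball_inner h (\<lambda>x. of_real (zonal_sum n V \<omega> l x)) = (\<Sum>j=1..n. of_real (\<omega> j) * ball_inner h (czonal (V j) l))"
proof -
  have "ball_inner h (\<lambda>x. of_real (zonal_sum n V \<omega> l x)) = (\<Sum>j=1..n. ball_inner h (\<lambda>x. of_real (\<omega> j) * czonal (V j) l x))"
    unfolding zonal_sum_def of_real_sum of_real_mult
    by (intro ball_inner_sum_right h continuous_on_mult_left harmonics_continuous[OF grassmannian_zonal_harmonic[OF k V]]) simp_all
  then show ?thesis
    by (simp add: ball_inner_mult_right)
qed

text \<open>The sum for the function that comes from \<open>h\<close> is the inner product of \<open>h\<close> with the weighted zonal sum.\<close>

lemma sum_over_summand_eq_0_iff:
  fixes V :: "nat \<Rightarrow> (real ^ 'd) set"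
  assumes k: "1 \<le> k" "k < CARD('d)" and V: "\<And>j. j \<in> {1..n} \<Longrightarrow> V j \<in> grassmannian k"
  shows "(\<forall>f\<in>grassmann_H k l. (\<Sum>j=1..n. of_real (\<omega> j) * f (V j)) = 0) \<longleftrightarrow> (\<forall>x. zonal_sum n V \<omega> l x = 0)"
proof -
  let ?Z = "\<lambda>x. complex_of_real (zonal_sum n V \<omega> l x)"
  have "(\<Sum>j=1..n. of_real (\<omega> j) * zonal_transform k l h (V j)) = ball_inner h ?Z" if "h \<in> harmonics (2 * l)" for h
  proof -
    have "(\<Sum>j=1..n. of_real (\<omega> j) * zonal_transform k l h (V j)) = (\<Sum>j=1..n. of_real (\<omega> j) * ball_inner h (czonal (V j) l))"
      using V by (intro sum.cong refl) (simp add: zonal_transform_def)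
    also have "\<dots> = ball_inner h ?Z"
      by (rule ball_inner_zonal_sum[OF k V harmonics_continuous[OF that], symmetric])
    finally show ?thesis .
  qed
  then have "(\<forall>f\<in>grassmann_H k l. (\<Sum>j=1..n. of_real (\<omega> j) * f (V j)) = 0) \<longleftrightarrow> (\<forall>h\<in>harmonics (2 * l). ball_inner h ?Z = 0)"
    by (simp add: grassmann_H_eq[OF k])
  also have "\<dots> \<longleftrightarrow> ?Z = (\<lambda>x. 0)"
  proof
    have Z: "?Z \<in> harmonics (2 * l)"
      by (rule zonal_sum_harmonic[OF k V])
    show "?Z = (\<lambda>x. 0)" if "\<forall>h\<in>harmonics (2 * l). ball_inner h ?Z = 0"
      using that Z harmonics_definite[OF Z] by blast
    show "\<forall>h\<in>harmonics (2 * l). ball_inner h ?Z = 0" if "?Z = (\<lambda>x. 0)"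
      unfolding that using ball_inner_mult_right[of _ 0 "\<lambda>x :: real ^ 'd. 0"] by simp
  qed
  finally show ?thesis
    by (simp add: fun_eq_iff)
qed

definition power_sum :: "nat \<Rightarrow> (nat \<Rightarrow> (real ^ 'd) set) \<Rightarrow> (nat \<Rightarrow> real) \<Rightarrow> nat \<Rightarrow> real ^ 'd \<Rightarrow> real" where
  "power_sum n V \<omega> l x = (\<Sum>j=1..n. \<omega> j * proj_sq (V j) x ^ l)"

lemma zonal_sum_eq_power_sums:
  fixes V :: "nat \<Rightarrow> (real ^ 'd) set"
  assumes V: "\<And>j. j \<in> {1..n} \<Longrightarrow> V j \<in> grassmannian k"
  shows "zonal_sum n V \<omega> l x = (\<Sum>i\<le>l. zonal_coeff CARD('d) k l i * (power_sum n V \<omega> i x * (norm x ^ 2) ^ (l - i)))"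
proof -
  have "zonal_sum n V \<omega> l x = (\<Sum>j=1..n. \<Sum>i\<le>l. \<omega> j * (zonal_coeff CARD('d) k l i * (proj_sq (V j) x ^ i * (norm x ^ 2) ^ (l - i))))"
    unfolding zonal_sum_def zonal_def sum_distrib_left using V by (intro sum.cong refl) (simp add: grassmannian_def)
  also have "\<dots> = (\<Sum>i\<le>l. \<Sum>j=1..n. \<omega> j * (zonal_coeff CARD('d) k l i * (proj_sq (V j) x ^ i * (norm x ^ 2) ^ (l - i))))"
    by (rule sum.swap)
  also have "\<dots> = (\<Sum>i\<le>l. zonal_coeff CARD('d) k l i * (power_sum n V \<omega> i x * (norm x ^ 2) ^ (l - i)))"
    unfolding power_sum_def sum_distrib_left sum_distrib_right by (intro sum.cong refl) simp
  finally show ?thesis .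
qed

lemma laplacian_proj_sq_power:
  assumes "subspace V"
  shows "laplacian (\<lambda>x. of_real (proj_sq V x ^ i)) x =
    of_real ((4 * real i * (real i - 1) + 2 * real i * real (dim V)) * proj_sq V x ^ (i - 1))"
  using laplacian_proj_sq_powers[OF assms assms, of i 0 x] by simp

lemma laplacian_norm_power:
  fixes x :: "real ^ 'd"
  shows "laplacian (\<lambda>x. of_real ((norm x ^ 2) ^ i)) x =
    of_real ((4 * real i * (real i - 1) + 2 * real i * real CARD('d)) * (norm x ^ 2) ^ (i - 1))"
  using laplacian_proj_sq_power[OF subspace_UNIV, of i x]
  unfolding proj_sq_UNIV dim_UNIV DIM_cart DIM_real mult_1_right .

lemma polynomial_function_norm_power: "polynomial_function (\<lambda>x :: real ^ 'd. complex_of_real ((norm x ^ 2) ^ i))"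
  unfolding proj_sq_UNIV[symmetric]
  by (intro polynomial_function_of_real real_polynomial_function_power real_polynomial_function_proj_sq subspace_UNIV)

lemma laplacian_factor_pos: "0 < i \<Longrightarrow> 0 < m \<Longrightarrow> 0 < 4 * real i * (real i - 1) + 2 * real i * real m"
  by (intro add_nonneg_pos) auto

text \<open>Applying the Laplacian to both sides lowers the exponents by one and multiplies by positive
  factors.\<close>

lemma power_sum_radial_step:
  fixes V :: "nat \<Rightarrow> (real ^ 'd) set"
  assumes k: "1 \<le> k" and V: "\<And>j. j \<in> {1..n} \<Longrightarrow> V j \<in> grassmannian k"
    and A: "\<And>x. power_sum n V \<omega> (Suc l) x = A * (norm x ^ 2) ^ Suc l"
  shows "\<exists>A'. \<forall>x. power_sum n V \<omega> l x = A' * (norm x ^ 2) ^ l"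
proof -
  let ?a = "\<lambda>m. 4 * real (Suc l) * (real (Suc l) - 1) + 2 * real (Suc l) * real m"
  have "power_sum n V \<omega> l x = A * ?a CARD('d) / ?a k * (norm x ^ 2) ^ l" for x
  proof -
    have "laplacian (\<lambda>x. of_real (power_sum n V \<omega> (Suc l) x)) x =
        (\<Sum>j=1..n. of_real (\<omega> j) * laplacian (\<lambda>x. of_real (proj_sq (V j) x ^ Suc l)) x)"
      unfolding power_sum_def of_real_sum of_real_mult[of "\<omega> _"]
      by (intro laplacian_sum polynomial_function_of_real real_polynomial_function_power real_polynomial_function_proj_sq grassmannianD(1)[OF V])
         simp_all
    also have "\<dots> = (\<Sum>j=1..n. of_real (\<omega> j) * of_real (?a k * proj_sq (V j) x ^ l))"
    proof (rule sum.cong[OF refl])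
      fix j assume "j \<in> {1..n}"
      note Vj = V[OF this]
      show "of_real (\<omega> j) * laplacian (\<lambda>x. of_real (proj_sq (V j) x ^ Suc l)) x =
          of_real (\<omega> j) * of_real (?a k * proj_sq (V j) x ^ l)"
        by (simp only: laplacian_proj_sq_power[OF grassmannianD(1)[OF Vj]] grassmannianD(2)[OF Vj] diff_Suc_1)
    qed
    also have "\<dots> = of_real (?a k * power_sum n V \<omega> l x)"
      unfolding power_sum_def of_real_mult[symmetric] of_real_sum[symmetric] sum_distrib_left
      by (intro arg_cong[where f = of_real] sum.cong refl) (simp only: ac_simps)
    finally have 1: "laplacian (\<lambda>x. of_real (power_sum n V \<omega> (Suc l) x)) x = of_real (?a k * power_sum n V \<omega> l x)" .
    have "laplacian (\<lambda>x. of_real (power_sum n V \<omega> (Suc l) x)) x = of_real A * laplacian (\<lambda>x. of_real ((norm x ^ 2) ^ Suc l)) x"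
      unfolding A of_real_mult[of A] by (rule laplacian_mult[OF polynomial_function_norm_power])
    also have "\<dots> = of_real (A * (?a CARD('d) * (norm x ^ 2) ^ l))"
      unfolding laplacian_norm_power of_real_mult[symmetric] diff_Suc_1 ..
    finally have "?a k * power_sum n V \<omega> l x = A * (?a CARD('d) * (norm x ^ 2) ^ l)"
      unfolding 1 of_real_eq_iff .
    moreover have "?a k \<noteq> 0"
      using laplacian_factor_pos[of "Suc l" k] k by linarith
    moreover have "s = A * b / a * r" if "a * s = A * (b * r)" "a \<noteq> 0" for a b s r :: real
      using that by (simp add: field_simps)
    ultimately show ?thesis
      by blast
  qed
  then show ?thesis by blast
qed

lemma power_sum_radial_below:
  fixes V :: "nat \<Rightarrow> (real ^ 'd) set"
  assumes k: "1 \<le> k" and V: "\<And>j. j \<in> {1..n} \<Longrightarrow> V j \<in> grassmannian k"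
    and p: "\<exists>A. \<forall>x. power_sum n V \<omega> p x = A * (norm x ^ 2) ^ p" and "l \<le> p"
  shows "\<exists>A. \<forall>x. power_sum n V \<omega> l x = A * (norm x ^ 2) ^ l"
  using \<open>l \<le> p\<close>
proof (induction rule: inc_induct)
  case base
  show ?case by (rule p)
next
  case (step m)
  then obtain A where A: "\<And>x. power_sum n V \<omega> (Suc m) x = A * (norm x ^ 2) ^ Suc m"
    by blast
  show ?case
    by (rule power_sum_radial_step[OF k V A])
qed

text \<open>The relation between zonal sums and power sums is triangular with ones on the diagonal. If the zonal
  sums vanish, it expresses each power sum by those of smaller degree, which are radial by
  induction. If the power sums are radial, it makes the zonal sum radial, and a radial harmonic
  polynomial of positive degree is zero.\<close>

lemma zonal_sums_vanish_iff_power_sum_radial: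
  fixes V :: "nat \<Rightarrow> (real ^ 'd) set"
  assumes k: "1 \<le> k" "k < CARD('d)" and V: "\<And>j. j \<in> {1..n} \<Longrightarrow> V j \<in> grassmannian k"
  shows "(\<forall>l\<in>{1..p}. \<forall>x. zonal_sum n V \<omega> l x = 0) \<longleftrightarrow> (\<exists>A. \<forall>x. power_sum n V \<omega> p x = A * (norm x ^ 2) ^ p)"
proof -
  have zonal_eq: "zonal_sum n V \<omega> l x = (\<Sum>i\<le>l. zonal_coeff CARD('d) k l i * (power_sum n V \<omega> i x * (norm x ^ 2) ^ (l - i)))" for l x
    by (rule zonal_sum_eq_power_sums[OF V])
  show ?thesis
  proof
    assume Z: "\<forall>l\<in>{1..p}. \<forall>x. zonal_sum n V \<omega> l x = 0"
    have "\<exists>A. \<forall>x. power_sum n V \<omega> l x = A * (norm x ^ 2) ^ l" if "l \<le> p" for l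
      using that
    proof (induction l rule: less_induct)
      case (less l)
      show ?case
      proof (cases "l = 0")
        case True
        then show ?thesis by (simp add: power_sum_def)
      next
        case False
        obtain A where A: "\<And>i x. i < l \<Longrightarrow> power_sum n V \<omega> i x = A i * (norm x ^ 2) ^ i"
          using less by (metis le_trans less_imp_le)
        have "power_sum n V \<omega> l x = (- (\<Sum>i<l. zonal_coeff CARD('d) k l i * A i)) * (norm x ^ 2) ^ l" for x
        proof -
          have "0 = zonal_sum n V \<omega> l x"
            using Z less.prems False by simp
          also have "\<dots> = (\<Sum>i<l. zonal_coeff CARD('d) k l i * (power_sum n V \<omega> i x * (norm x ^ 2) ^ (l - i))) + power_sum n V \<omega> l x"
            unfolding zonal_eq lessThan_Suc_atMost[symmetric] by simp
          also have "(\<Sum>i<l. zonal_coeff CARD('d) k l i * (power_sum n V \<omega> i x * (norm x ^ 2) ^ (l - i))) =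
              (\<Sum>i<l. zonal_coeff CARD('d) k l i * A i) * (norm x ^ 2) ^ l"
            unfolding sum_distrib_right
          proof (rule sum.cong[OF refl])
            fix i assume "i \<in> {..<l}"
            then have "(norm x ^ 2) ^ i * (norm x ^ 2) ^ (l - i) = (norm x ^ 2) ^ l"
              by (simp add: power_add[symmetric])
            then show "zonal_coeff CARD('d) k l i * (power_sum n V \<omega> i x * (norm x ^ 2) ^ (l - i)) =
                zonal_coeff CARD('d) k l i * A i * (norm x ^ 2) ^ l"
              using A[of i x] \<open>i \<in> {..<l}\<close> by (simp only: lessThan_iff mult.assoc)
          qed
          finally show ?thesis by simp
        qed
        then show ?thesis by blast
      qed
    qed
    then show "\<exists>A. \<forall>x. power_sum n V \<omega> p x = A * (norm x ^ 2) ^ p"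
      by blast
  next
    assume radial: "\<exists>A. \<forall>x. power_sum n V \<omega> p x = A * (norm x ^ 2) ^ p"
    show "\<forall>l\<in>{1..p}. \<forall>x. zonal_sum n V \<omega> l x = 0"
    proof
      fix l assume l: "l \<in> {1..p}"
      have "\<exists>A. \<forall>x. power_sum n V \<omega> i x = A * (norm x ^ 2) ^ i" if "i \<le> l" for i
        by (rule power_sum_radial_below[OF k(1) V radial]) (use l that in auto)
      then obtain A where A: "\<And>i x. i \<le> l \<Longrightarrow> power_sum n V \<omega> i x = A i * (norm x ^ 2) ^ i"
        by metis
      define C where "C = (\<Sum>i\<le>l. zonal_coeff CARD('d) k l i * A i)"
      have ZC: "zonal_sum n V \<omega> l x = C * (norm x ^ 2) ^ l" for x
        unfolding zonal_eq C_def sum_distrib_right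
      proof (rule sum.cong[OF refl])
        fix i assume i: "i \<in> {..l}"
        then have "(norm x ^ 2) ^ i * (norm x ^ 2) ^ (l - i) = (norm x ^ 2) ^ l"
          by (simp add: power_add[symmetric])
        then show "zonal_coeff CARD('d) k l i * (power_sum n V \<omega> i x * (norm x ^ 2) ^ (l - i)) =
            zonal_coeff CARD('d) k l i * A i * (norm x ^ 2) ^ l"
          using A[of i x] i by (simp only: atMost_iff mult.assoc)
      qed
      obtain b :: "real ^ 'd" where b: "norm b = 1"
        using nonempty_Basis norm_Basis by blast
      have "0 = laplacian (\<lambda>x. of_real (zonal_sum n V \<omega> l x)) b"
        using zonal_sum_harmonic[OF k V, where \<omega> = \<omega> and l = l] by (simp add: harmonics_iff)
      also have "\<dots> = of_real C * laplacian (\<lambda>x. of_real ((norm x ^ 2) ^ l)) b"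
        unfolding ZC of_real_mult[of C] by (rule laplacian_mult[OF polynomial_function_norm_power])
      also have "\<dots> = of_real (C * (4 * real l * (real l - 1) + 2 * real l * real CARD('d)))"
        unfolding laplacian_norm_power b of_real_mult[symmetric] by (simp only: power_one mult_1_right)
      finally have "C * (4 * real l * (real l - 1) + 2 * real l * real CARD('d)) = 0"
        by (metis of_real_eq_0_iff)
      then have "C = 0"
        using laplacian_factor_pos[of l "CARD('d)"] l by auto
      then show "\<forall>x. zonal_sum n V \<omega> l x = 0"
        using ZC by simp
    qed
qed
qed

text \<open>The frame constant is positive automatically: at a unit vector of \<open>V 1\<close>, the summand of \<open>V 1\<close> is
  \<open>\<omega> 1\<close>.\<close>

lemma tight_fusion_frame_iff:
  fixes V :: "nat \<Rightarrow> (real ^ 'd) set"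
  assumes k: "1 \<le> k" "k < CARD('d)" and V: "\<And>j. j \<in> {1..n} \<Longrightarrow> V j \<in> grassmannian k"
    and pos: "\<And>j. j \<in> {1..n} \<Longrightarrow> \<omega> j > 0" and sum1: "(\<Sum>j=1..n. \<omega> j) = 1"
  shows "tight_fusion_frame p n V \<omega> \<longleftrightarrow> (\<forall>l\<in>{1..p}. \<forall>x. zonal_sum n V \<omega> l x = 0)"
proof -
  have "n \<noteq> 0"
    using sum1 by (cases n) auto
  then have 1: "1 \<in> {1..n}" by auto
  obtain e where e: "e \<in> V 1" "norm e = 1"
    using unit_vector_in_subspace[of "V 1"] V[OF 1] k by (auto simp: grassmannian_def)
  have "proj_sq (V 1) e = 1"
    unfolding proj_sq_def oproj_ident[OF grassmannianD(1)[OF V[OF 1]] e(1)] e(2) by simp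
  then have "0 < \<omega> 1 * proj_sq (V 1) e ^ p"
    using pos[OF 1] by simp
  also have "\<dots> \<le> power_sum n V \<omega> p e"
    unfolding power_sum_def using 1 pos by (intro member_le_sum) (auto intro!: mult_nonneg_nonneg simp: less_imp_le)
  finally have "0 < power_sum n V \<omega> p e" .
  then have Apos: "0 < A" if "\<And>x. power_sum n V \<omega> p x = A * (norm x ^ 2) ^ p" for A
    using that[of e] e by simp
  have "tight_fusion_frame p n V \<omega> \<longleftrightarrow> (\<exists>A>0. \<forall>x. power_sum n V \<omega> p x = A * (norm x ^ 2) ^ p)"
    by (simp add: tight_fusion_frame_def power_sum_def proj_sq_def power_mult)
  also have "\<dots> \<longleftrightarrow> (\<exists>A. \<forall>x. power_sum n V \<omega> p x = A * (norm x ^ 2) ^ p)"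
    using Apos by blast
  also have "\<dots> \<longleftrightarrow> (\<forall>l\<in>{1..p}. \<forall>x. zonal_sum n V \<omega> l x = 0)"
    by (rule zonal_sums_vanish_iff_power_sum_radial[OF k V, symmetric])
  finally show ?thesis .
qed

section \<open>The invariant measure\<close>

lemma sum_Basis_vec:
  fixes f :: "real ^ 'd \<Rightarrow> 'b::comm_monoid_add"
  shows "(\<Sum>b\<in>Basis. f b) = (\<Sum>i\<in>UNIV. f (axis i 1))"
proof -
  have b: "Basis = (\<lambda>i. axis i 1 :: real ^ 'd) ` UNIV"
    by (auto simp: Basis_vec_def)
  have i: "inj (\<lambda>i. axis i 1 :: real ^ 'd)"
    by (auto simp: inj_on_def axis_eq_axis)
  show ?thesis
    unfolding b by (rule sum.reindex[OF i, unfolded o_def])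
qed

lemma matrix_oproj_vector: "subspace V \<Longrightarrow> matrix (oproj V) *v x = oproj V x"
  by (simp add: matrix_works linear_oproj)

lemma trace_matrix_oproj:
  assumes "subspace V"
  shows "(\<Sum>i\<in>UNIV. matrix (oproj V) $ i $ i) = real (dim V)"
proof -
  have "matrix (oproj V) $ i $ i = norm (oproj V (axis i 1)) ^ 2" for i
    using oproj_self_adjoint(2)[OF assms, of "axis i 1" "axis i 1"]
    by (simp add: matrix_def inner_axis' power2_norm_eq_inner)
  then show ?thesis
    using sum_norm_oproj_Basis[OF assms] by (simp add: sum_Basis_vec)
qed

lemma matrix_oproj_entries:
  assumes "subspace V"
  shows "matrix (oproj V) $ i $ j = matrix (oproj V) $ j $ i" "\<bar>matrix (oproj V) $ i $ j\<bar> \<le> 1"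
proof -
  have entry: "matrix (oproj V) $ i $ j = axis i 1 \<bullet> oproj V (axis j 1)" for i j
    by (simp add: matrix_def inner_axis')
  show "matrix (oproj V) $ i $ j = matrix (oproj V) $ j $ i"
    unfolding entry[of i j] entry[of j i] by (metis oproj_self_adjoint(2)[OF assms] inner_commute)
  have "\<bar>matrix (oproj V) $ i $ j\<bar> \<le> norm (axis i 1 :: real ^ 'a) * norm (oproj V (axis j 1))"
    unfolding entry by (rule Cauchy_Schwarz_ineq2)
  also have "\<dots> \<le> 1"
    using norm_oproj_le[OF assms, of "axis j 1"] by simp
  finally show "\<bar>matrix (oproj V) $ i $ j\<bar> \<le> 1" .
qed

text \<open>A projection matrix is recognised by closed conditions: it is symmetric and idempotent, its
  trace is the dimension of the space, and it fixes the vectors of the space.\<close>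

lemma matrix_oproj_characterization:
  fixes P :: "real ^ 'd ^ 'd"
  assumes V: "subspace V" and sym: "\<And>i j. P $ i $ j = P $ j $ i" and idem: "P ** P = P"
    and tr: "(\<Sum>i\<in>UNIV. P $ i $ i) = real (dim V)" and fixed: "\<And>v. v \<in> V \<Longrightarrow> P *v v = v"
  shows "P = matrix (oproj V)"
proof -
  define R where "R = range ((*v) P)"
  have R: "subspace R"
    unfolding R_def by (rule linear_subspace_image) (simp_all add: subspace_UNIV)
  have PP: "P *v (P *v x) = P *v x" for x
    by (simp add: matrix_vector_mul_assoc idem)
  have "transpose P = P"
    by (simp add: transpose_def vec_eq_iff sym)
  then have adj: "x \<bullet> (P *v y) = (P *v x) \<bullet> y" for x y
    by (metis dot_lmul_matrix inner_commute transpose_matrix_vector)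
  have proj: "oproj R x = P *v x" for x
  proof (rule oproj_eqI[OF R])
    show "P *v x \<in> R"
      by (simp add: R_def)
    fix v assume "v \<in> R"
    then obtain y where "v = P *v y"
      by (auto simp: R_def)
    then show "orthogonal (x - P *v x) v"
      by (simp add: orthogonal_def adj matrix_vector_mult_diff_distrib PP)
  qed
  have PR: "matrix (oproj R) = P"
    unfolding proj[abs_def] by (rule matrix_of_matrix_vector_mul)
  then have "dim R = dim V"
    using trace_matrix_oproj[OF R] tr by simp
  moreover have "V \<subseteq> R"
    using fixed by (metis R_def rangeI subsetI)
  ultimately have "V = R"
    using subspace_dim_equal[OF V R] by simp
  then show ?thesis
    using PR by simp
qed

text \<open>The graph of the map is closed by the characterization above, and its values lie in a compact set.\<close>

lemma continuous_on_matrix_oproj_image: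
  fixes E :: "(real ^ 'd) set"
  assumes E: "subspace E"
  shows "continuous_on {A :: real ^ 'd ^ 'd. det A \<noteq> 0} (\<lambda>A. matrix (oproj ((*v) A ` E)))"
proof -
  let ?U = "{A :: real ^ 'd ^ 'd. det A \<noteq> 0}" and ?f = "\<lambda>A. matrix (oproj ((*v) A ` E))"
  define T :: "(real ^ 'd ^ 'd) set" where "T = {P. \<forall>i j. \<bar>P $ i $ j\<bar> \<le> 1}"
  have sub: "subspace ((*v) A ` E)" for A :: "real ^ 'd ^ 'd"
    by (rule linear_subspace_image) (simp_all add: E)
  have dim: "dim ((*v) A ` E) = dim E" if "det A \<noteq> 0" for A :: "real ^ 'd ^ 'd"
  proof -
    have "inj ((*v) A)"
      using that by (simp add: invertible_det_nz[symmetric] inj_matrix_vector_mult)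
    then show ?thesis
      by (intro dim_image_eq) (auto simp: inj_def inj_on_def)
  qed
  have "closed T"
    unfolding T_def by (intro closed_Collect_all closed_Collect_le continuous_intros)
  moreover have "bounded T"
  proof (rule boundedI)
    fix P :: "real ^ 'd ^ 'd" assume P: "P \<in> T"
    have "norm P \<le> (\<Sum>i\<in>UNIV. norm (P $ i))"
      unfolding norm_vec_def by (rule L2_set_le_sum) simp
    also have "\<dots> \<le> (\<Sum>i\<in>(UNIV :: 'd set). \<Sum>j\<in>(UNIV :: 'd set). 1)"
      using P by (intro sum_mono order_trans[OF norm_le_l1_cart]) (auto simp: T_def)
    finally show "norm P \<le> (\<Sum>i\<in>(UNIV :: 'd set). \<Sum>j\<in>(UNIV :: 'd set). 1)" .
  qed
  ultimately have "compact T"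
    by (simp add: compact_eq_bounded_closed)
  moreover have "?f \<in> ?U \<rightarrow> T"
    using matrix_oproj_entries(2)[OF sub] by (auto simp: T_def)
  moreover have "closedin (top_of_set (?U \<times> T)) ((\<lambda>A. (A, ?f A)) ` ?U)"
  proof -
    define C where "C = {AP :: (real ^ 'd ^ 'd) \<times> (real ^ 'd ^ 'd). (\<forall>i j. snd AP $ i $ j = snd AP $ j $ i) \<and>
        (\<forall>i j. (\<Sum>m\<in>UNIV. snd AP $ i $ m * snd AP $ m $ j) = snd AP $ i $ j) \<and>
        (\<Sum>i\<in>UNIV. snd AP $ i $ i) = real (dim E) \<and>
        (\<forall>e i. e \<in> E \<longrightarrow> (\<Sum>m\<in>UNIV. snd AP $ i $ m * (\<Sum>l\<in>UNIV. fst AP $ m $ l * e $ l)) = (\<Sum>l\<in>UNIV. fst AP $ i $ l * e $ l))}"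
    have "closed C"
      unfolding C_def
      by (intro closed_Collect_conj closed_Collect_all closed_Collect_imp closed_Collect_eq open_Collect_const continuous_intros)
    have C: "(A, P) \<in> C \<longleftrightarrow> (\<forall>i j. P $ i $ j = P $ j $ i) \<and> P ** P = P \<and> (\<Sum>i\<in>UNIV. P $ i $ i) = real (dim E) \<and>
        (\<forall>e\<in>E. P *v (A *v e) = A *v e)" for A P
      by (auto simp: C_def vec_eq_iff matrix_matrix_mult_def matrix_vector_mult_def)
    have "(\<lambda>A. (A, ?f A)) ` ?U = (?U \<times> T) \<inter> C"
    proof
      show "(\<lambda>A. (A, ?f A)) ` ?U \<subseteq> (?U \<times> T) \<inter> C"
      proof
        fix q assume "q \<in> (\<lambda>A. (A, ?f A)) ` ?U"
        then obtain A where A: "det A \<noteq> 0" "q = (A, ?f A)" by blast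
        have "?f A ** ?f A = ?f A"
          using oproj_idem[OF sub]
          by (metis (no_types, lifting) matrix_eq matrix_oproj_vector[OF sub] matrix_vector_mul_assoc)
        then show "q \<in> (?U \<times> T) \<inter> C"
          unfolding A(2) using A(1) matrix_oproj_entries[OF sub] trace_matrix_oproj[OF sub] dim[OF A(1)]
          by (auto simp: C T_def matrix_oproj_vector[OF sub] oproj_ident[OF sub])
      qed
      show "(?U \<times> T) \<inter> C \<subseteq> (\<lambda>A. (A, ?f A)) ` ?U"
      proof
        fix q assume q: "q \<in> (?U \<times> T) \<inter> C"
        obtain A P where AP: "q = (A, P)" by (cases q)
        then have "P = ?f A"
          using q dim[of A] by (intro matrix_oproj_characterization[OF sub]) (auto simp: C)
        then show "q \<in> (\<lambda>A. (A, ?f A)) ` ?U"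
          using q AP by auto
      qed
    qed
    then show ?thesis
      using \<open>closed C\<close> by (simp add: closedin_closed_Int)
  qed
  ultimately show ?thesis
    using continuous_closed_graph_eq by blast
qed

lemma space_sets_grassmann:
  assumes "is_grassmann_measure k M"
  shows "space M = grassmannian k" and "openin (grassmann_topology k) S \<Longrightarrow> S \<in> sets M"
proof -
  have sub: "{U. openin (grassmann_topology k) U} \<subseteq> Pow (grassmannian k)"
    by (auto simp: grassmann_topology_def openin_pullback_topology)
  have sets: "sets M = sets (sigma (grassmannian k) {U. openin (grassmann_topology k) U})"
    using assms by (simp add: is_grassmann_measure_def)
  then show "space M = grassmannian k"
    using sets_eq_imp_space_eq[OF sets] by (simp add: space_measure_of[OF sub])
  show "S \<in> sets M" if "openin (grassmann_topology k) S"
    unfolding sets sets_measure_of[OF sub] using that by (auto intro: sigma_sets.Basic)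
qed

lemma openin_grassmann_vimage_orthogonal:
  fixes g :: "real ^ 'd \<Rightarrow> real ^ 'd" and S :: "(real ^ 'd) set set"
  assumes g: "orthogonal_transformation g" and S: "openin (grassmann_topology k) S"
  shows "openin (grassmann_topology k) ((\<lambda>V. g ` V) -` S \<inter> grassmannian k)"
proof -
  obtain S' where S': "open S'" "S = (\<lambda>V. matrix (oproj V)) -` S' \<inter> grassmannian k"
    using S by (auto simp: grassmann_topology_def openin_pullback_topology)
  let ?c = "\<lambda>P :: real ^ 'd ^ 'd. matrix g ** P ** matrix (inv g)"
  have "continuous_on UNIV ?c"
    unfolding matrix_matrix_mult_def by (intro continuous_on_vec_lambda continuous_intros)
  then have "open (?c -` S')"
    using S'(1) by (simp add: continuous_on_open_vimage)
  moreover have conj: "matrix (oproj (g ` V)) = ?c (matrix (oproj V))" if "V \<in> grassmannian k" for V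
  proof -
    have sV: "subspace V" and lg: "linear g" "linear (inv g)"
      using that orthogonal_transformation_linear[OF g] orthogonal_transformation_linear[OF orthogonal_transformation_inv[OF g]]
      by (auto simp: grassmannian_def)
    have "oproj (g ` V) = g \<circ> oproj V \<circ> inv g"
    proof
      fix x
      show "oproj (g ` V) x = (g \<circ> oproj V \<circ> inv g) x"
        using oproj_image[OF g sV, of "inv g x"] by (simp add: orthogonal_transformation_inv_apply[OF g])
    qed
    then show ?thesis
      using lg linear_oproj[OF sV] by (simp add: matrix_compose linear_compose)
  qed
  have "(\<lambda>V. g ` V) -` S \<inter> grassmannian k = (\<lambda>V. matrix (oproj V)) -` (?c -` S') \<inter> grassmannian k"
    using S'(2) conj grassmannian_image[OF g] by auto
  ultimately show ?thesis
    unfolding grassmann_topology_def openin_pullback_topology by auto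
qed

lemma measurable_orthogonal_image:
  fixes g :: "real ^ 'd \<Rightarrow> real ^ 'd" and M :: "(real ^ 'd) set measure"
  assumes g: "orthogonal_transformation g"
    and M: "sets M = sets (sigma (grassmannian k) {U. openin (grassmann_topology k) U})"
  shows "(\<lambda>V. g ` V) \<in> measurable M M"
proof -
  let ?N = "sigma (grassmannian k) {U :: (real ^ 'd) set set. openin (grassmann_topology k) U}"
  have sub: "{U :: (real ^ 'd) set set. openin (grassmann_topology k) U} \<subseteq> Pow (grassmannian k)"
    by (auto simp: grassmann_topology_def openin_pullback_topology)
  have "(\<lambda>V. g ` V) \<in> measurable ?N ?N"
  proof (rule measurable_measure_of[OF sub])
    show "(\<lambda>V. g ` V) \<in> space ?N \<rightarrow> grassmannian k"
      using grassmannian_image[OF g] by (auto simp: space_measure_of[OF sub])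
    fix S :: "(real ^ 'd) set set" assume "S \<in> {U. openin (grassmann_topology k) U}"
    then show "(\<lambda>V. g ` V) -` S \<inter> space ?N \<in> sets ?N"
      using openin_grassmann_vimage_orthogonal[OF g]
      by (auto simp: space_measure_of[OF sub] sets_measure_of[OF sub] intro: sigma_sets.Basic)
  qed
  then show ?thesis
    using measurable_cong_sets[OF M M] by simp
qed

text \<open>The invariant measure is the distribution of the image of a fixed subspace under a random
  invertible matrix, drawn uniformly from the unit ball of the space of matrices. Left
  multiplication by an orthogonal matrix is an orthogonal transformation of that space, so it does
  not change the distribution.\<close>

lemma grassmann_measure_exists:
  assumes k: "k \<le> CARD('d)"
  shows "\<exists>M :: (real ^ 'd) set measure. is_grassmann_measure k M"
proof -
  obtain E :: "(real ^ 'd) set" where E: "subspace E" "dim E = k"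
    using choose_subspace_of_subspace[of k "UNIV :: (real ^ 'd) set"] k by auto
  then have EG: "E \<in> grassmannian k"
    by (simp add: grassmannian_def)
  define I where "I = {A :: real ^ 'd ^ 'd. det A \<noteq> 0}"
  define U where "U = I \<inter> {A. norm A < 1}"
  have "open I"
    unfolding I_def det_def by (intro open_Collect_neq continuous_intros)
  then have openU: "open U"
    unfolding U_def by (intro open_Int open_Collect_less continuous_intros)
  define c where "c = 1 / (2 * (norm (mat 1 :: real ^ 'd ^ 'd) + 1))"
  have c: "0 < c"
    by (simp add: c_def add_nonneg_pos)
  have "mat c \<in> U"
  proof -
    have "det (mat c :: real ^ 'd ^ 'd) = c ^ CARD('d)"
      by (subst det_diagonal) (auto simp: mat_def)
    moreover have "(mat c :: real ^ 'd ^ 'd) = c *\<^sub>R mat 1"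
      by (simp add: mat_def vec_eq_iff)
    then have "norm (mat c :: real ^ 'd ^ 'd) = norm (mat 1 :: real ^ 'd ^ 'd) / (2 * (norm (mat 1 :: real ^ 'd ^ 'd) + 1))"
      using c by (simp add: c_def)
    then have "norm (mat c :: real ^ 'd ^ 'd) < 1"
      by (simp add: divide_less_eq add_nonneg_pos)
    ultimately show ?thesis
      using c by (simp add: U_def I_def)
  qed
  then have "\<not> negligible U"
    using openU open_not_negligible by blast
  then have U0: "emeasure lborel U \<noteq> 0"
    using openU by (auto simp: negligible_iff_null_sets null_sets_def null_sets_completionI)
  have "U \<subseteq> ball 0 1"
    by (auto simp: U_def)
  then have Ufin: "emeasure lborel U \<noteq> \<infinity>"
    using emeasure_bounded_finite[of U] bounded_subset[OF bounded_ball] by (metis infinity_ennreal_def less_irrefl)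
  have Us [measurable]: "U \<in> sets borel"
    using openU by simp
  define M0 where "M0 = uniform_measure lborel U"
  interpret M0: prob_space M0
    unfolding M0_def by (rule prob_space_uniform_measure[OF U0 Ufin])
  have sets_M0 [measurable_cong]: "sets M0 = sets borel"
    by (simp add: M0_def)
  let ?N = "sigma (grassmannian k) {U :: (real ^ 'd) set set. openin (grassmann_topology k) U}"
  have sub: "{U :: (real ^ 'd) set set. openin (grassmann_topology k) U} \<subseteq> Pow (grassmannian k)"
    by (auto simp: grassmann_topology_def openin_pullback_topology)
  define f where "f A = (if A \<in> U then (*v) A ` E else E)" for A :: "real ^ 'd ^ 'd"
  have fG: "f A \<in> grassmannian k" for A
  proof (cases "A \<in> U")
    case True
    then have "inj ((*v) A)"
      by (simp add: U_def I_def invertible_det_nz[symmetric] inj_matrix_vector_mult)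
    then have "dim ((*v) A ` E) = dim E"
      by (intro dim_image_eq) (auto simp: inj_def inj_on_def)
    moreover have "subspace ((*v) A ` E)"
      by (rule linear_subspace_image) (simp_all add: E)
    ultimately show ?thesis
      using True E by (simp add: f_def grassmannian_def)
  qed (simp add: f_def EG)
  have fm: "f \<in> measurable M0 ?N"
  proof (rule measurable_measure_of[OF sub])
    fix S :: "(real ^ 'd) set set" assume "S \<in> {U. openin (grassmann_topology k) U}"
    then obtain S' where S': "open S'" "S = (\<lambda>V. matrix (oproj V)) -` S' \<inter> grassmannian k"
      by (auto simp: grassmann_topology_def openin_pullback_topology)
    have "continuous_on U (\<lambda>A. matrix (oproj ((*v) A ` E)))"
      using continuous_on_matrix_oproj_image[OF E(1)] by (rule continuous_on_subset) (auto simp: U_def I_def)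
    then have "open (U \<inter> (\<lambda>A. matrix (oproj ((*v) A ` E))) -` S')"
      using continuous_open_preimage openU S'(1) by blast
    moreover have "f -` S \<inter> space M0 = (U \<inter> (\<lambda>A. matrix (oproj ((*v) A ` E))) -` S') \<union> (if E \<in> S then - U else {})"
    proof -
      have "A \<in> f -` S \<longleftrightarrow> A \<in> (U \<inter> (\<lambda>A. matrix (oproj ((*v) A ` E))) -` S') \<union> (if E \<in> S then - U else {})" for A
        using fG[of A] S'(2) by (auto simp: f_def)
      then show ?thesis
        by (auto simp: M0_def)
    qed
    ultimately show "f -` S \<inter> space M0 \<in> sets M0"
      using Us by (simp add: sets_M0)
  qed (use fG in auto)
  define M where "M = distr M0 ?N f"
  have "distr M M (\<lambda>V. g ` V) = M" if g: "orthogonal_transformation g" for g :: "real ^ 'd \<Rightarrow> real ^ 'd"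
  proof -
    define \<gamma> where "\<gamma> A = matrix g ** A" for A :: "real ^ 'd ^ 'd"
    have lg: "linear g"
      by (rule orthogonal_transformation_linear[OF g])
    have mg: "matrix g *v x = g x" for x
      by (simp add: matrix_works lg)
    have inner: "A \<bullet> B = (\<Sum>j\<in>UNIV. column j A \<bullet> column j B)" for A B :: "real ^ 'd ^ 'd"
    proof -
      have "A \<bullet> B = (\<Sum>i\<in>UNIV. \<Sum>j\<in>UNIV. A $ i $ j * B $ i $ j)"
        by (simp add: inner_vec_def)
      also have "\<dots> = (\<Sum>j\<in>UNIV. \<Sum>i\<in>UNIV. A $ i $ j * B $ i $ j)"
        by (rule sum.swap)
      finally show ?thesis
        by (simp add: inner_vec_def column_def)
    qed
    have col: "column j (\<gamma> A) = g (column j A)" for j A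
      unfolding \<gamma>_def by (simp add: mg[symmetric] column_def matrix_matrix_mult_def matrix_vector_mult_def)
    have "linear \<gamma>"
      by (rule linearI) (simp_all add: \<gamma>_def matrix_matrix_mult_def vec_eq_iff sum_distrib_left sum.distrib algebra_simps)
    then have \<gamma>: "orthogonal_transformation \<gamma>"
      using g by (simp add: orthogonal_transformation_def inner col)
    have \<gamma>m [measurable]: "\<gamma> \<in> borel_measurable borel"
      by (rule orthogonal_transformation_measurable[OF \<gamma>])
    have \<gamma>U: "\<gamma> A \<in> U \<longleftrightarrow> A \<in> U" for A
    proof -
      have "det (matrix g) \<noteq> 0"
        using orthogonal_transformation_det[OF g] by auto
      then show ?thesis
        using orthogonal_transformation_norm[OF \<gamma>, of A] by (simp add: U_def I_def \<gamma>_def det_mul)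
    qed
    have M0_inv: "distr M0 borel \<gamma> = M0"
    proof (rule measure_eqI)
      fix X assume "X \<in> sets (distr M0 borel \<gamma>)"
      then have X [measurable]: "X \<in> sets borel" by simp
      have "emeasure lborel (U \<inter> \<gamma> -` X) = emeasure (distr lborel borel \<gamma>) (U \<inter> X)"
        by (subst emeasure_distr) (auto simp: \<gamma>U intro!: arg_cong[where f = "emeasure lborel"])
      then have "emeasure lborel (U \<inter> \<gamma> -` X) = emeasure lborel (U \<inter> X)"
        by (simp add: distr_lborel_orthogonal[OF \<gamma>])
      moreover have "\<gamma> -` X \<in> sets borel"
        using measurable_sets[OF \<gamma>m X] by simp
      ultimately show "emeasure (distr M0 borel \<gamma>) X = emeasure M0 X"
        using X Us by (simp add: emeasure_distr M0_def)
    qed (simp add: sets_M0)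
    have gm: "(\<lambda>V. g ` V) \<in> measurable ?N ?N"
      by (rule measurable_orthogonal_image[OF g refl])
    have "distr M M (\<lambda>V. g ` V) = distr (distr M0 ?N f) ?N (\<lambda>V. g ` V)"
      by (rule distr_cong) (simp_all add: M_def)
    also have "\<dots> = distr M0 ?N ((\<lambda>V. g ` V) \<circ> f)"
      by (rule distr_distr[OF gm fm])
    also have "\<dots> = distr M0 ?N (f \<circ> \<gamma>)"
    proof (rule distr_cong_AE)
      have "g ` f A = f (\<gamma> A)" if "A \<in> U" for A
      proof -
        have "g (A *v x) = \<gamma> A *v x" for x
          by (simp add: \<gamma>_def matrix_vector_mul_assoc[symmetric] mg)
        then show ?thesis
          using that by (simp add: f_def \<gamma>U image_image)
      qed
      then show "AE A in M0. ((\<lambda>V. g ` V) \<circ> f) A = (f \<circ> \<gamma>) A"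
        unfolding M0_def by (intro AE_uniform_measureI) (auto simp: Us)
      show "(\<lambda>V. g ` V) \<circ> f \<in> measurable M0 ?N"
        by (rule measurable_comp[OF fm gm])
      show "f \<circ> \<gamma> \<in> measurable M0 ?N"
        by (rule measurable_comp[OF _ fm]) (simp add: measurable_cong_sets[OF sets_M0 sets_M0] \<gamma>m)
    qed simp_all
    also have "\<dots> = distr (distr M0 M0 \<gamma>) ?N f"
      by (rule distr_distr[symmetric, OF fm]) (simp add: measurable_cong_sets[OF sets_M0 sets_M0] \<gamma>m)
    also have "distr M0 M0 \<gamma> = distr M0 borel \<gamma>"
      by (rule distr_cong) (simp_all add: sets_M0)
    finally show ?thesis
      by (simp add: M0_inv M_def)
  qed
  moreover have "prob_space M"
    unfolding M_def by (rule M0.prob_space_distr[OF fm])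
  moreover have "sets M = sets ?N"
    by (simp add: M_def)
  ultimately have "is_grassmann_measure k M"
    by (simp add: is_grassmann_measure_def)
  then show ?thesis
    by blast
qed

section \<open>Integrals of the harmonic summands\<close>

lemma grassmann_measure_is: "k \<le> CARD('d) \<Longrightarrow> is_grassmann_measure k (grassmann_measure k :: (real ^ 'd) set measure)"
  unfolding grassmann_measure_def by (rule someI_ex[OF grassmann_measure_exists])

lemma zonal_transform_measurable:
  fixes h :: "real ^ 'd \<Rightarrow> complex"
  assumes M: "is_grassmann_measure k M" and h: "continuous_on UNIV h"
  shows "zonal_transform k l h \<in> borel_measurable M"
proof (rule borel_measurableI)
  fix S :: "complex set" assume "open S"
  have "continuous_map (grassmann_topology k) euclidean (zonal_transform k l h)"
    using zonal_transform_continuous[OF h, of k l] by (simp add: grassmann_C_def)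
  moreover have "topspace (grassmann_topology k) = (grassmannian k :: (real ^ 'd) set set)"
    by (simp add: grassmann_topology_def topspace_pullback_topology)
  ultimately have "openin (grassmann_topology k) {V \<in> grassmannian k. zonal_transform k l h V \<in> S}"
    using \<open>open S\<close> by (auto simp: continuous_map_def)
  moreover have "zonal_transform k l h -` S \<inter> space M = {V \<in> grassmannian k. zonal_transform k l h V \<in> S}"
    using space_sets_grassmann(1)[OF M] by auto
  ultimately show "zonal_transform k l h -` S \<inter> space M \<in> sets M"
    using space_sets_grassmann(2)[OF M] by simp
qed

lemma zonal_bounded_on_ball:
  fixes V :: "(real ^ 'd) set"
  assumes V: "V \<in> grassmannian k" and x: "norm x \<le> 1"
  shows "\<bar>zonal V l x\<bar> \<le> (\<Sum>i\<le>l. \<bar>zonal_coeff CARD('d) k l i\<bar>)"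
  unfolding zonal_def grassmannianD(2)[OF V]
proof (rule order_trans[OF sum_abs], rule sum_mono)
  fix i assume "i \<in> {..l}"
  have "proj_sq V x \<le> norm x ^ 2"
    unfolding proj_sq_def by (intro power_mono norm_oproj_le grassmannianD(1)[OF V]) simp
  also have "norm x ^ 2 \<le> 1"
    using x by (simp add: power_le_one)
  finally have "proj_sq V x ^ i * (norm x ^ 2) ^ (l - i) \<le> 1"
    using \<open>norm x ^ 2 \<le> 1\<close> x by (intro mult_le_one power_le_one) auto
  then show "\<bar>zonal_coeff CARD('d) k l i * (proj_sq V x ^ i * (norm x ^ 2) ^ (l - i))\<bar> \<le> \<bar>zonal_coeff CARD('d) k l i\<bar>"
    using mult_left_mono[of "proj_sq V x ^ i * (norm x ^ 2) ^ (l - i)" 1 "\<bar>zonal_coeff CARD('d) k l i\<bar>"] by (simp add: abs_mult)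
qed

lemma zonal_transform_integrable:
  fixes h :: "real ^ 'd \<Rightarrow> complex"
  assumes k: "1 \<le> k" "k < CARD('d)" and M: "is_grassmann_measure k M" and h: "continuous_on UNIV h"
  shows "integrable M (zonal_transform k l h)"
proof -
  interpret prob_space M
    using M by (simp add: is_grassmann_measure_def)
  let ?C = "\<Sum>i\<le>l. \<bar>zonal_coeff CARD('d) k l i\<bar>"
  let ?B = "ball_integral (\<lambda>x. norm (h x) * ?C)"
  have cont: "continuous_on UNIV (\<lambda>x. norm (h x) * ?C)"
    by (intro continuous_intros h)
  have "norm (zonal_transform k l h V) \<le> ?B" for V
  proof (cases "V \<in> grassmannian k")
    case True
    have "continuous_on UNIV (\<lambda>x. h x * cnj (czonal V l x))"
      by (intro continuous_intros h harmonics_continuous[OF grassmannian_zonal_harmonic[OF k True]])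
    then have "norm (ball_inner h (czonal V l)) \<le> ?B"
      unfolding ball_inner_def ball_integral_def
    proof (intro order_trans[OF integral_norm_bound] integral_mono integrable_norm ball_integrable cont)
      fix x :: "real ^ 'd"
      show "norm (indicator (cball 0 1) x *\<^sub>R (h x * cnj (czonal V l x))) \<le> indicator (cball 0 1) x *\<^sub>R (norm (h x) * ?C)"
        using zonal_bounded_on_ball[OF True, of x l]
        by (auto simp: norm_mult indicator_def intro!: mult_left_mono)
    qed
    then show ?thesis
      using True by (simp add: zonal_transform_def)
  next
    case False
    have "0 \<le> ?B"
      by (intro ball_integral_nonneg mult_nonneg_nonneg sum_nonneg) auto
    then show ?thesis
      using False by (simp add: zonal_transform_def)
  qed
  then show ?thesis
    by (intro integrable_const_bound[of _ ?B] zonal_transform_measurable[OF M h]) auto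
qed

text \<open>The integral of the transform of \<open>h\<close> is a functional of \<open>h\<close> that the whole orthogonal group
  fixes. Its Riesz vector is a radial harmonic polynomial, and there is none of positive degree.\<close>

lemma integral_zonal_transform_eq_0:
  fixes h :: "real ^ 'd \<Rightarrow> complex"
  assumes k: "1 \<le> k" "k < CARD('d)" and M: "is_grassmann_measure k M" and l: "1 \<le> l"
    and h: "h \<in> harmonics (2 * l)"
  shows "integral\<^sup>L M (zonal_transform k l h) = 0"
proof -
  let ?H = "harmonics (2 * l) :: (real ^ 'd \<Rightarrow> complex) set"
  define L where "L f = integral\<^sup>L M (zonal_transform k l f)" for f :: "real ^ 'd \<Rightarrow> complex"
  have int: "integrable M (zonal_transform k l f)" if "f \<in> ?H" for f
    by (rule zonal_transform_integrable[OF k M harmonics_continuous[OF that]])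
  have add: "L (\<lambda>x. f x + g x) = L f + L g" if "f \<in> ?H" "g \<in> ?H" for f g
    by (simp only: L_def zonal_transform_add[OF k that] Bochner_Integration.integral_add[OF int[OF that(1)] int[OF that(2)]])
  have scale: "L (\<lambda>x. c * f x) = c * L f" if "f \<in> ?H" for c f
    by (simp add: L_def zonal_transform_mult)
  obtain n where n: "n \<in> ?H" "\<And>f. f \<in> ?H \<Longrightarrow> L f = ball_inner f n"
    using harmonics_riesz_whole[of "2 * l" L, OF add scale] by blast
  have inv: "L (\<lambda>x. f (g x)) = L f" if f: "f \<in> ?H" and g: "orthogonal_transformation g" for f and g :: "real ^ 'd \<Rightarrow> real ^ 'd"
  proof -
    have m: "(\<lambda>V. g ` V) \<in> measurable M M" and d: "distr M M (\<lambda>V. g ` V) = M"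
      using M g measurable_orthogonal_image[OF g] by (auto simp: is_grassmann_measure_def)
    have "L (\<lambda>x. f (g x)) = integral\<^sup>L M (\<lambda>V. zonal_transform k l f (g ` V))"
      unfolding L_def by (intro Bochner_Integration.integral_cong refl zonal_transform_orthogonal[OF k g harmonics_continuous[OF f]])
    also have "\<dots> = integral\<^sup>L (distr M M (\<lambda>V. g ` V)) (zonal_transform k l f)"
      by (rule integral_distr[symmetric, OF m zonal_transform_measurable[OF M harmonics_continuous[OF f]]])
    finally show ?thesis
      by (simp add: d L_def)
  qed
  have n_inv: "n (g x) = n x" if g: "orthogonal_transformation g" for g x
  proof (rule riesz_vector_invariant[OF g subset_refl _ n])
    show "(\<lambda>x. f (inv g x)) \<in> ?H" "L (\<lambda>x. f (inv g x)) = L f" if "f \<in> ?H" for f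
      using that orthogonal_transformation_inv[OF g] by (auto intro: harmonics_orthogonal inv)
    show "(\<lambda>x. n (g x) - n x) \<in> ?H"
      by (rule harmonics_diff[OF harmonics_orthogonal[OF n(1) g] n(1)])
  qed
  obtain e :: "real ^ 'd" where e: "norm e = 1"
    using nonempty_Basis norm_Basis by blast
  have radial: "n x = n e * of_real ((norm x ^ 2) ^ l)" for x
  proof -
    have "reflection (norm x *\<^sub>R e - x) (norm x *\<^sub>R e) = x"
      using e by (intro reflection_swap) simp
    then have "n x = n (norm x *\<^sub>R e)"
      using n_inv[OF orthogonal_transformation_reflection] by metis
    also have "\<dots> = n e * of_real ((norm x ^ 2) ^ l)"
      by (simp add: harmonics_scaleR[OF n(1)] power_mult)
    finally show ?thesis .
  qed
  have "0 = laplacian n e"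
    using n(1) by (simp add: harmonics_iff)
  also have "n = (\<lambda>x. n e * of_real ((norm x ^ 2) ^ l))"
    using radial by blast
  also have "laplacian (\<lambda>x. n e * of_real ((norm x ^ 2) ^ l)) e = n e * of_real (4 * real l * (real l - 1) + 2 * real l * real CARD('d))"
    unfolding laplacian_mult[OF polynomial_function_norm_power] laplacian_norm_power e by (simp only: power_one mult_1_right)
  finally have "n e * of_real (4 * real l * (real l - 1) + 2 * real l * real CARD('d)) = 0" ..
  moreover have "4 * real l * (real l - 1) + 2 * real l * real CARD('d) \<noteq> 0"
    using laplacian_factor_pos[of l "CARD('d)"] l by simp
  ultimately have "n e = 0"
    unfolding mult_eq_0_iff of_real_eq_0_iff by blast
  then have "n x = 0" for x
    by (subst radial) simp
  then have "n = (\<lambda>x. 0)" by blast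
  then show ?thesis
    using n(2)[OF h] ball_inner_mult_right[of h 0 "\<lambda>x :: real ^ 'd. 0"] by (simp add: L_def)
qed

lemma zonal_transform_degree_0: "zonal_transform k 0 h V = (if V \<in> grassmannian k then ball_inner h (\<lambda>x. 1) else 0)"
  by (simp add: zonal_transform_def zonal_def)

text \<open>The summand of degree zero consists of the constant functions, which the cubature formula integrates
  correctly because the weights add up to one. The integrals of the other summands are zero.\<close>

lemma cubature_iff:
  fixes V :: "nat \<Rightarrow> (real ^ 'd) set"
  assumes k: "1 \<le> k" "k < CARD('d)" and V: "\<And>j. j \<in> {1..n} \<Longrightarrow> V j \<in> grassmannian k"
    and sum1: "(\<Sum>j=1..n. \<omega> j) = 1"
  shows "(\<forall>f\<in>Pol1 k p. integral\<^sup>L (grassmann_measure k) f = (\<Sum>j=1..n. of_real (\<omega> j) * f (V j))) \<longleftrightarrow>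
    (\<forall>l\<in>{1..p}. \<forall>f\<in>grassmann_H k l. (\<Sum>j=1..n. of_real (\<omega> j) * f (V j)) = 0)"
proof -
  let ?M = "grassmann_measure k :: (real ^ 'd) set measure"
  have M: "is_grassmann_measure k ?M"
    using k by (intro grassmann_measure_is) simp
  interpret prob_space ?M
    using M by (simp add: is_grassmann_measure_def)
  define Q where "Q f = (\<Sum>j=1..n. of_real (\<omega> j) * f (V j))" for f :: "(real ^ 'd) set \<Rightarrow> complex"
  have int: "integrable ?M f" if "f \<in> grassmann_H k l" for f :: "(real ^ 'd) set \<Rightarrow> complex" and l
    using that by (auto simp: grassmann_H_eq[OF k] intro: zonal_transform_integrable[OF k M] harmonics_continuous)
  have int0: "integral\<^sup>L ?M f = Q f" if f: "f \<in> grassmann_H k 0" for f :: "(real ^ 'd) set \<Rightarrow> complex"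
  proof -
    obtain h where h: "f = zonal_transform k 0 h"
      using f by (auto simp: grassmann_H_eq[OF k])
    have "integral\<^sup>L ?M f = integral\<^sup>L ?M (\<lambda>_. ball_inner h (\<lambda>x. 1))"
      by (intro Bochner_Integration.integral_cong refl) (simp add: h zonal_transform_degree_0 space_sets_grassmann(1)[OF M])
    also have "\<dots> = ball_inner h (\<lambda>x. 1)"
      by (simp add: prob_space)
    also have "\<dots> = (\<Sum>j=1..n. of_real (\<omega> j)) * ball_inner h (\<lambda>x. 1)"
      by (simp only: of_real_sum[symmetric] sum1) simp
    also have "\<dots> = Q f"
      unfolding Q_def h sum_distrib_right by (intro sum.cong refl) (simp add: zonal_transform_degree_0 V)
    finally show ?thesis .
  qed
  have intl: "integral\<^sup>L ?M f = 0" if "f \<in> grassmann_H k l" "1 \<le> l" for f :: "(real ^ 'd) set \<Rightarrow> complex" and l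
    using that by (auto simp: grassmann_H_eq[OF k] intro: integral_zonal_transform_eq_0[OF k M])
  have zero: "(\<lambda>V. 0) \<in> (grassmann_H k l :: ((real ^ 'd) set \<Rightarrow> complex) set)" for l
  proof -
    have "zonal_transform k l (\<lambda>x :: real ^ 'd. 0) = (\<lambda>V. 0)"
      using zonal_transform_mult[of k l 0 "\<lambda>x :: real ^ 'd. 0"] by simp
    then show ?thesis
      using harmonics_zero by (force simp: grassmann_H_eq[OF k])
  qed
  have split: "integral\<^sup>L ?M (\<lambda>V. \<Sum>l\<le>p. f l V) = Q (f 0)" "Q (\<lambda>V. \<Sum>l\<le>p. f l V) = Q (f 0) + (\<Sum>l=1..p. Q (f l))"
    if f: "\<forall>l\<le>p. f l \<in> grassmann_H k l" for f :: "nat \<Rightarrow> (real ^ 'd) set \<Rightarrow> complex"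
  proof -
    have s: "(\<Sum>l\<le>p. u l) = u 0 + (\<Sum>l=1..p. u l)" for u :: "nat \<Rightarrow> complex"
      by (simp add: atMost_atLeast0 sum.atLeast_Suc_atMost)
    have "integral\<^sup>L ?M (\<lambda>V. \<Sum>l\<le>p. f l V) = (\<Sum>l\<le>p. integral\<^sup>L ?M (f l))"
      using f int by (intro Bochner_Integration.integral_sum) auto
    also have "\<dots> = integral\<^sup>L ?M (f 0) + (\<Sum>l=1..p. integral\<^sup>L ?M (f l))"
      by (rule s)
    also have "(\<Sum>l=1..p. integral\<^sup>L ?M (f l)) = 0"
      by (intro sum.neutral ballI) (use f intl in auto)
    also have "integral\<^sup>L ?M (f 0) + 0 = Q (f 0)"
      using f by (simp add: int0)
    finally show "integral\<^sup>L ?M (\<lambda>V. \<Sum>l\<le>p. f l V) = Q (f 0)" .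
    have "Q (\<lambda>V. \<Sum>l\<le>p. f l V) = (\<Sum>l\<le>p. Q (f l))"
      unfolding Q_def sum_distrib_left by (rule sum.swap)
    then show "Q (\<lambda>V. \<Sum>l\<le>p. f l V) = Q (f 0) + (\<Sum>l=1..p. Q (f l))"
      by (simp add: s)
  qed
  have "(\<forall>f\<in>Pol1 k p. integral\<^sup>L ?M f = Q f) \<longleftrightarrow> (\<forall>l\<in>{1..p}. \<forall>f\<in>grassmann_H k l. Q f = 0)"
  proof
    assume "\<forall>l\<in>{1..p}. \<forall>f\<in>grassmann_H k l. Q f = 0"
    then have "(\<Sum>l=1..p. Q (f l)) = 0" if "\<forall>l\<le>p. f l \<in> grassmann_H k l" for f
      using that by (intro sum.neutral) auto
    then show "\<forall>f\<in>Pol1 k p. integral\<^sup>L ?M f = Q f"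
      using split by (auto simp: Pol1_def)
  next
    assume S2: "\<forall>f\<in>Pol1 k p. integral\<^sup>L ?M f = Q f"
    show "\<forall>l\<in>{1..p}. \<forall>f\<in>grassmann_H k l. Q f = 0"
    proof (intro ballI)
      fix l and f :: "(real ^ 'd) set \<Rightarrow> complex" assume l: "l \<in> {1..p}" and f: "f \<in> grassmann_H k l"
      define F where "F i = (if i = l then f else (\<lambda>V. 0))" for i
      have F: "\<forall>i\<le>p. F i \<in> grassmann_H k i"
        using f zero by (simp add: F_def)
      then have "(\<lambda>V. \<Sum>i\<le>p. F i V) \<in> Pol1 k p"
        by (auto simp: Pol1_def)
      then have "(\<Sum>i=1..p. Q (F i)) = 0"
        using S2 split[OF F] by auto
      also have "(\<Sum>i=1..p. Q (F i)) = (\<Sum>i=1..p. if i = l then Q f else 0)"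
        by (intro sum.cong refl) (simp add: F_def Q_def)
      finally show "Q f = 0"
        using l by simp
    qed
  qed
  then show ?thesis
    by (simp only: Q_def)
qed

section \<open>Principal angles\<close>

text \<open>A maximum of the quadratic form on the unit sphere of \<open>S\<close> is an eigenvector: with \<open>c\<close> the
  maximal value, \<open>c * (x \<bullet> x) - x \<bullet> f x\<close> is a nonnegative quadratic form that vanishes at \<open>v\<close>, so
  its linear part at \<open>v\<close> is zero.\<close>

lemma self_adjoint_eigenvector:
  fixes f :: "'a::euclidean_space \<Rightarrow> 'a"
  assumes S: "subspace S" "0 < dim S" and f: "linear f" and inv: "\<And>x. x \<in> S \<Longrightarrow> f x \<in> S"
    and adj: "\<And>x y. x \<in> S \<Longrightarrow> y \<in> S \<Longrightarrow> f x \<bullet> y = x \<bullet> f y"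
  obtains v c where "v \<in> S" "norm v = 1" "f v = c *\<^sub>R v"
proof -
  have "compact (sphere 0 1 \<inter> S)"
    using S(1) by (intro compact_Int_closed closed_subspace) auto
  moreover have "sphere 0 1 \<inter> S \<noteq> {}"
  proof -
    obtain v where v: "v \<in> S" "v \<noteq> 0"
      using S(2) dim_eq_0[of S] by fastforce
    then have "inverse (norm v) *\<^sub>R v \<in> sphere 0 1 \<inter> S"
      using S(1) by (simp add: subspace_scale)
    then show ?thesis by blast
  qed
  moreover have "continuous_on (sphere 0 1 \<inter> S) (\<lambda>x. x \<bullet> f x)"
    using f by (intro continuous_intros linear_continuous_on) (simp flip: linear_conv_bounded_linear)
  ultimately obtain v where v: "v \<in> sphere 0 1 \<inter> S" "\<And>x. x \<in> sphere 0 1 \<inter> S \<Longrightarrow> x \<bullet> f x \<le> v \<bullet> f v"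
    using continuous_attains_sup[of "sphere 0 1 \<inter> S" "\<lambda>x. x \<bullet> f x"] by blast
  define c where "c = v \<bullet> f v"
  have vS: "v \<in> S" and vv: "v \<bullet> v = 1"
    using v(1) by (auto simp: norm_eq_1)
  have bound: "x \<bullet> f x \<le> c * (x \<bullet> x)" if "x \<in> S" for x
  proof (cases "x = 0")
    case False
    let ?u = "inverse (norm x) *\<^sub>R x"
    have "?u \<bullet> f ?u \<le> c"
      unfolding c_def using that False S(1) by (intro v(2)) (auto simp: subspace_scale)
    moreover have "?u \<bullet> f ?u = (x \<bullet> f x) / (norm x) ^ 2"
      by (simp add: linear_scale[OF f] power2_eq_square divide_inverse)
    ultimately show ?thesis
      using False by (simp add: divide_le_eq power2_norm_eq_inner)
  qed simp
  define w where "w = c *\<^sub>R v - f v"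
  have wS: "w \<in> S"
    unfolding w_def using vS S(1) inv by (intro subspace_diff subspace_scale)
  define G where "G = c * (w \<bullet> w) - w \<bullet> f w"
  have G: "0 \<le> G"
    using bound[OF wS] by (simp add: G_def)
  have quad: "0 \<le> 2 * t * (w \<bullet> w) + t ^ 2 * G" for t
  proof -
    have "v + t *\<^sub>R w \<in> S"
      using vS wS S(1) by (intro subspace_add subspace_scale)
    then have "0 \<le> c * ((v + t *\<^sub>R w) \<bullet> (v + t *\<^sub>R w)) - (v + t *\<^sub>R w) \<bullet> f (v + t *\<^sub>R w)"
      using bound by fastforce
    also have "\<dots> = (c * (v \<bullet> v) - v \<bullet> f v) + 2 * t * (c * (v \<bullet> w) - f v \<bullet> w) + t ^ 2 * G"
    proof -
      have e1: "(v + t *\<^sub>R w) \<bullet> (v + t *\<^sub>R w) = v \<bullet> v + 2 * t * (v \<bullet> w) + t ^ 2 * (w \<bullet> w)"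
        by (simp add: inner_add_left inner_add_right inner_commute[of w v] power2_eq_square distrib_left)
      have e2: "(v + t *\<^sub>R w) \<bullet> f (v + t *\<^sub>R w) = v \<bullet> f v + 2 * t * (f v \<bullet> w) + t ^ 2 * (w \<bullet> f w)"
        using adj[OF vS wS] by (simp add: linear_add[OF f] linear_scale[OF f] inner_add_left inner_add_right
            inner_commute[of w "f v"] power2_eq_square distrib_left)
      show ?thesis
        unfolding e1 e2 G_def by (simp add: algebra_simps)
    qed
    also have "c * (v \<bullet> v) - v \<bullet> f v = 0"
      by (simp add: vv c_def)
    also have "c * (v \<bullet> w) - f v \<bullet> w = w \<bullet> w"
      by (simp add: w_def inner_diff_left)
    finally show ?thesis by simp
  qed
  have "w \<bullet> w = 0"
  proof (rule ccontr)
    assume "w \<bullet> w \<noteq> 0"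
    then have b: "0 < w \<bullet> w"
      by simp
    define t where "t = - (w \<bullet> w) / (G + 1)"
    have "2 * t * (w \<bullet> w) + t ^ 2 * G = t * (2 * (w \<bullet> w) + t * G)"
      by (simp add: power2_eq_square algebra_simps)
    also have "\<dots> < 0"
    proof (rule mult_neg_pos)
      show "t < 0"
        using b G by (simp add: t_def)
      have "(w \<bullet> w) * (G / (G + 1)) \<le> (w \<bullet> w) * 1"
        using b G by (intro mult_left_mono) auto
      moreover have "t * G = - ((w \<bullet> w) * (G / (G + 1)))"
        by (simp add: t_def)
      ultimately show "0 < 2 * (w \<bullet> w) + t * G"
        using b by linarith
    qed
    finally show False
      using quad[of t] by simp
  qed
  then have "f v = c *\<^sub>R v"
    by (simp add: w_def)
  then show thesis
    using that vS v(1) by simp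
qed

lemma self_adjoint_eigenbasis:
  fixes f :: "real ^ 'd \<Rightarrow> real ^ 'd"
  assumes f: "linear f" and S: "subspace S" "dim S = k" and inv: "\<And>x. x \<in> S \<Longrightarrow> f x \<in> S"
    and adj: "\<And>x y. x \<in> S \<Longrightarrow> y \<in> S \<Longrightarrow> f x \<bullet> y = x \<bullet> f y"
  shows "\<exists>b y. orthonormal_family k b \<and> (\<forall>i<k. b i \<in> S) \<and> (\<forall>i<k. f (b i) = y i *\<^sub>R b i)"
  using S inv adj
proof (induction k arbitrary: S)
  case 0
  show ?case by (simp add: orthonormal_family_def)
next
  case (Suc k)
  obtain v c where v: "v \<in> S" "norm v = 1" "f v = c *\<^sub>R v"
    using self_adjoint_eigenvector[of S f] f Suc.prems by auto
  define S' where "S' = {y \<in> S. \<forall>x\<in>span {v}. orthogonal x y}"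
  have S'_iff: "y \<in> S' \<longleftrightarrow> y \<in> S \<and> v \<bullet> y = 0" for y
    by (auto simp: S'_def orthogonal_def span_singleton)
  have "v \<noteq> 0"
    using v(2) by auto
  then have "dim (span {v}) = 1"
    by (simp add: dim_insert)
  moreover have "span {v} \<subseteq> S"
    using v(1) Suc.prems(1) by (simp add: span_minimal)
  ultimately have "dim S' = k"
    using dim_subspace_orthogonal_to_vectors[OF subspace_span Suc.prems(1), of "{v}"] Suc.prems(2) by (simp add: S'_def)
  moreover have "subspace S'"
    using Suc.prems(1) by (auto simp: subspace_def S'_iff inner_add_right)
  moreover have "f x \<in> S'" if "x \<in> S'" for x
    using that Suc.prems(3) Suc.prems(4)[of v x] v by (simp add: S'_iff)
  moreover have "f x \<bullet> y = x \<bullet> f y" if "x \<in> S'" "y \<in> S'" for x y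
    using that Suc.prems(4) by (simp add: S'_iff)
  ultimately obtain b y where b: "orthonormal_family k b" "\<forall>i<k. b i \<in> S'" "\<forall>i<k. f (b i) = y i *\<^sub>R b i"
    using Suc.IH[of S'] by blast
  have "orthonormal_family (Suc k) (b(k := v))"
    using b(1,2) v(2) by (auto simp: orthonormal_family_def less_Suc_eq S'_iff norm_eq_1 inner_commute)
  moreover have "\<forall>i<Suc k. (b(k := v)) i \<in> S"
    using b(2) v(1) by (auto simp: less_Suc_eq S'_iff)
  moreover have "\<forall>i<Suc k. f ((b(k := v)) i) = (y(k := c)) i *\<^sub>R (b(k := v)) i"
    using b(3) v(3) by (auto simp: less_Suc_eq)
  ultimately show ?case
    by blast
qed

lemma orthonormal_family_facts:
  assumes "orthonormal_family k b"
  shows "inj_on b {..<k}" and "I \<subseteq> {..<k} \<Longrightarrow> dim (span (b ` I)) = card I"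
    and "subspace V \<Longrightarrow> dim V = k \<Longrightarrow> b ` {..<k} \<subseteq> V \<Longrightarrow> span (b ` {..<k}) = V"
    and "oproj (span (b ` {..<k})) x = (\<Sum>i<k. (x \<bullet> b i) *\<^sub>R b i)"
proof -
  have bb: "b i \<bullet> b j = (if i = j then 1 else 0)" if "i < k" "j < k" for i j
    using assms that by (simp add: orthonormal_family_def)
  show inj: "inj_on b {..<k}"
  proof (rule inj_onI)
    fix i j assume "i \<in> {..<k}" "j \<in> {..<k}" "b i = b j"
    then show "i = j"
      using bb[of i j] bb[of j j] by (auto split: if_splits)
  qed
  have orth: "pairwise orthogonal (b ` {..<k})"
    using bb by (auto simp: pairwise_def orthogonal_def)
  have norm: "norm u = 1" if "u \<in> b ` {..<k}" for u
    using that bb by (auto simp: norm_eq_1)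
  show dim: "dim (span (b ` I)) = card I" if "I \<subseteq> {..<k}" for I
  proof -
    have "independent (b ` I)"
    proof (rule pairwise_orthogonal_independent)
      show "pairwise orthogonal (b ` I)"
        using orth by (rule pairwise_subset) (use that in blast)
      show "0 \<notin> b ` I"
        using norm that by fastforce
    qed
    then show ?thesis
      using card_image[OF inj_on_subset[OF inj that]] by (simp add: dim_span dim_eq_card_independent)
  qed
  show "span (b ` {..<k}) = V" if "subspace V" "dim V = k" "b ` {..<k} \<subseteq> V"
  proof (rule subspace_dim_equal[OF subspace_span that(1)])
    show "span (b ` {..<k}) \<subseteq> V"
      using that by (simp add: span_minimal)
    show "dim V \<le> dim (span (b ` {..<k}))"
      unfolding dim[OF subset_refl] using that by simp
  qed
  show "oproj (span (b ` {..<k})) x = (\<Sum>i<k. (x \<bullet> b i) *\<^sub>R b i)"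
    using oproj_orthonormal_expansion[OF orth norm] by (simp add: sum.reindex[OF inj] o_def)
qed

text \<open>An eigenspace is spanned by the vectors of the eigenbasis with that eigenvalue, since eigenvectors of
  a self-adjoint map for different eigenvalues are orthogonal.\<close>

lemma is_cos2_angles_of_eigenbasis:
  assumes V: "subspace V" and b: "orthonormal_family k b" "span (b ` {..<k}) = V"
    and W: "subspace W" and eig: "\<And>i. i < k \<Longrightarrow> oproj V (oproj W (oproj V (b i))) = y i *\<^sub>R b i"
  shows "is_cos2_angles k V W y"
  unfolding is_cos2_angles_def
proof
  fix c
  let ?A = "\<lambda>v. oproj V (oproj W (oproj V v))"
  let ?I = "{i. i < k \<and> y i = c}"
  have adj: "?A v \<bullet> u = v \<bullet> ?A u" for v u
    using oproj_self_adjoint(1)[OF V, of "oproj W (oproj V v)" u] oproj_self_adjoint(2)[OF V, of v "oproj W (oproj V u)"]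
      oproj_self_adjoint(2)[OF V, of "oproj W (oproj V v)" u] oproj_self_adjoint(1)[OF V, of v "oproj W (oproj V u)"]
      oproj_self_adjoint[OF W, of "oproj V v" "oproj V u"] by linarith
  have lin: "linear ?A"
    using linear_compose[OF linear_compose[OF linear_oproj[OF V] linear_oproj[OF W]] linear_oproj[OF V]] by (simp add: o_def)
  have "{v \<in> V. ?A v = c *\<^sub>R v} = span (b ` ?I)"
  proof
    show "{v \<in> V. ?A v = c *\<^sub>R v} \<subseteq> span (b ` ?I)"
    proof
      fix v assume v: "v \<in> {v \<in> V. ?A v = c *\<^sub>R v}"
      have 0: "v \<bullet> b i = 0" if "i < k" "y i \<noteq> c" for i
        using adj[of v "b i"] v eig[OF that(1)] that(2) by simp
      have "v = (\<Sum>i<k. (v \<bullet> b i) *\<^sub>R b i)"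
        using orthonormal_family_facts(4)[OF b(1), of v] oproj_ident[OF V, of v] v b(2) by simp
      also have "\<dots> \<in> span (b ` ?I)"
      proof (rule span_sum)
        fix i assume i: "i \<in> {..<k}"
        show "(v \<bullet> b i) *\<^sub>R b i \<in> span (b ` ?I)"
        proof (cases "y i = c")
          case True
          then show ?thesis
            using i by (intro span_scale span_base imageI) simp
        qed (use 0[of i] i in \<open>simp add: span_zero\<close>)
      qed
      finally show "v \<in> span (b ` ?I)" .
    qed
    show "span (b ` ?I) \<subseteq> {v \<in> V. ?A v = c *\<^sub>R v}"
    proof (rule span_minimal)
      show "b ` ?I \<subseteq> {v \<in> V. ?A v = c *\<^sub>R v}"
        using eig b(2) by (auto intro: span_base)
      show "subspace {v \<in> V. ?A v = c *\<^sub>R v}"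
        using V by (auto simp: subspace_def linear_0[OF lin] linear_add[OF lin] linear_scale[OF lin] scaleR_add_right)
    qed
  qed
  moreover have "?I \<subseteq> {..<k}" by auto
  ultimately show "card ?I = dim {v \<in> V. ?A v = c *\<^sub>R v}"
    using orthonormal_family_facts(2)[OF b(1)] by simp
qed

lemma cos2_angles_eigenbasis:
  fixes V W :: "(real ^ 'd) set"
  assumes V: "V \<in> grassmannian k" and W: "W \<in> grassmannian k"
  shows "\<exists>b. orthonormal_family k b \<and> span (b ` {..<k}) = V \<and>
    (\<forall>i<k. oproj V (oproj W (oproj V (b i))) = cos2_angles k V W i *\<^sub>R b i)"
proof -
  have sV: "subspace V" "dim V = k" and sW: "subspace W"
    using V W by (auto simp: grassmannian_def)
  let ?A = "\<lambda>v. oproj V (oproj W (oproj V v))"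
  have adj: "?A v \<bullet> u = v \<bullet> ?A u" for v u
    using oproj_self_adjoint(1)[OF sV(1), of "oproj W (oproj V v)" u] oproj_self_adjoint(2)[OF sV(1), of v "oproj W (oproj V u)"]
      oproj_self_adjoint(2)[OF sV(1), of "oproj W (oproj V v)" u] oproj_self_adjoint(1)[OF sV(1), of v "oproj W (oproj V u)"]
      oproj_self_adjoint[OF sW, of "oproj V v" "oproj V u"] by linarith
  have lin: "linear ?A"
    using linear_compose[OF linear_compose[OF linear_oproj[OF sV(1)] linear_oproj[OF sW]] linear_oproj[OF sV(1)]] by (simp add: o_def)
  obtain b y where b: "orthonormal_family k b" "\<And>i. i < k \<Longrightarrow> b i \<in> V" "\<And>i. i < k \<Longrightarrow> ?A (b i) = y i *\<^sub>R b i"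
    using self_adjoint_eigenbasis[OF lin sV oproj_in[OF sV(1)] adj] by blast
  have span: "span (b ` {..<k}) = V"
    using orthonormal_family_facts(3)[OF b(1) sV] b(2) by auto
  have y: "is_cos2_angles k V W y"
    by (rule is_cos2_angles_of_eigenbasis[OF sV(1) b(1) span sW b(3)])
  then have cos2: "is_cos2_angles k V W (cos2_angles k V W)"
    using someI[of "is_cos2_angles k V W" y] by (simp add: cos2_angles_def)
  \<comment> \<open>The chosen angles may be listed in another order than those of the eigenbasis.\<close>
  have "image_mset (cos2_angles k V W) (mset_set {..<k}) = image_mset y (mset_set {..<k})"
  proof (rule multiset_eqI)
    fix c
    have "count (image_mset z (mset_set {..<k})) c = card {i. i < k \<and> z i = c}" for z :: "nat \<Rightarrow> real"
      by (simp add: count_image_mset vimage_def Int_def conj_commute)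
    then show "count (image_mset (cos2_angles k V W) (mset_set {..<k})) c = count (image_mset y (mset_set {..<k})) c"
      using y cos2 by (simp add: is_cos2_angles_def)
  qed
  then obtain \<pi> where \<pi>: "\<pi> permutes {..<k}" "\<forall>i\<in>{..<k}. cos2_angles k V W i = y (\<pi> i)"
    using image_mset_eq_implies_permutes[OF finite_lessThan] by blast
  have lt: "\<pi> i < k \<longleftrightarrow> i < k" for i
    using permutes_in_image[OF \<pi>(1), of i] by simp
  show ?thesis
  proof (intro exI[of _ "b \<circ> \<pi>"] conjI allI impI)
    show "orthonormal_family k (b \<circ> \<pi>)"
      using b(1) lt permutes_inj[OF \<pi>(1)] by (auto simp: orthonormal_family_def inj_eq)
    show "span ((b \<circ> \<pi>) ` {..<k}) = V"
      by (simp only: image_comp[symmetric] permutes_image[OF \<pi>(1)] span)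
    show "?A ((b \<circ> \<pi>) i) = cos2_angles k V W i *\<^sub>R (b \<circ> \<pi>) i" if "i < k" for i
      using b(3)[of "\<pi> i"] \<pi>(2) lt that by simp
  qed
qed

lemma cos2_angles_self:
  fixes V :: "(real ^ 'd) set"
  assumes V: "V \<in> grassmannian k" and "i < k"
  shows "cos2_angles k V V i = 1"
proof -
  have sV: "subspace V"
    using V by (simp add: grassmannian_def)
  obtain b where b: "orthonormal_family k b" "span (b ` {..<k}) = V"
    "\<And>i. i < k \<Longrightarrow> oproj V (oproj V (oproj V (b i))) = cos2_angles k V V i *\<^sub>R b i"
    using cos2_angles_eigenbasis[OF V V] by blast
  have "b i \<in> V"
    using b(2) assms(2) by (auto intro: span_base)
  then have "b i = cos2_angles k V V i *\<^sub>R b i"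
    using b(3)[OF assms(2)] by (simp add: oproj_ident[OF sV])
  moreover have "b i \<bullet> b i = 1"
    using b(1) assms(2) by (simp add: orthonormal_family_def)
  ultimately show ?thesis
    by (metis inner_scaleR_left mult_1_right)
qed

text \<open>An orthogonal transformation carries the eigenspaces along, so both sides are chosen by the same
  description and agree even in the order of the angles.\<close>

lemma cos2_angles_orthogonal:
  fixes V W :: "(real ^ 'd) set" and g :: "real ^ 'd \<Rightarrow> real ^ 'd"
  assumes g: "orthogonal_transformation g" and V: "subspace V" and W: "subspace W"
  shows "cos2_angles k (g ` V) (g ` W) = cos2_angles k V W"
proof -
  have lg: "linear g" and ig: "inj g"
    using g orthogonal_transformation_linear orthogonal_transformation_inj by blast+
  have "dim {v \<in> g ` V. oproj (g ` V) (oproj (g ` W) (oproj (g ` V) v)) = c *\<^sub>R v} =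
      dim {v \<in> V. oproj V (oproj W (oproj V v)) = c *\<^sub>R v}" for c
  proof -
    have "{v \<in> g ` V. oproj (g ` V) (oproj (g ` W) (oproj (g ` V) v)) = c *\<^sub>R v} =
        g ` {v \<in> V. oproj V (oproj W (oproj V v)) = c *\<^sub>R v}"
      by (auto simp: oproj_image[OF g V] oproj_image[OF g W] linear_scale[OF lg, symmetric] inj_eq[OF ig])
    then show ?thesis
      using lg ig by (simp add: dim_image_eq inj_on_subset[OF ig])
  qed
  then have "is_cos2_angles k (g ` V) (g ` W) = is_cos2_angles k V W"
    by (simp add: is_cos2_angles_def fun_eq_iff)
  then show ?thesis
    by (simp add: cos2_angles_def)
qed

section \<open>Polynomials in several variables\<close>

definition exponent_eval :: "(nat \<Rightarrow>\<^sub>0 nat) \<Rightarrow> (nat \<Rightarrow> real) \<Rightarrow> real" where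
  "exponent_eval m y = (\<Prod>i\<in>Poly_Mapping.keys m. y i ^ Poly_Mapping.lookup m i)"

definition exponent_degree :: "(nat \<Rightarrow>\<^sub>0 nat) \<Rightarrow> nat" where
  "exponent_degree m = (\<Sum>i\<in>Poly_Mapping.keys m. Poly_Mapping.lookup m i)"

lemma rpoly_eval_superset:
  assumes "finite S" "Poly_Mapping.keys P \<subseteq> S"
  shows "rpoly_eval P y = (\<Sum>m\<in>S. Poly_Mapping.lookup P m * exponent_eval m y)"
  unfolding rpoly_eval_def exponent_eval_def[symmetric]
  using assms by (intro sum.mono_neutral_left) (auto simp: in_keys_iff)

lemma rpoly_eval_add: "rpoly_eval (P + Q) y = rpoly_eval P y + rpoly_eval Q y"
proof -
  let ?S = "Poly_Mapping.keys P \<union> Poly_Mapping.keys Q"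
  have "rpoly_eval R y = (\<Sum>m\<in>?S. Poly_Mapping.lookup R m * exponent_eval m y)" if "R \<in> {P, Q, P + Q}" for R
    using that Poly_Mapping.keys_add[of P Q] by (intro rpoly_eval_superset) auto
  then show ?thesis
    by (simp add: lookup_add distrib_right sum.distrib)
qed

lemma rpoly_eval_single: "rpoly_eval (Poly_Mapping.single m c) y = c * exponent_eval m y"
  using rpoly_eval_superset[of "{m}" "Poly_Mapping.single m c" y] by simp

lemma rpoly_eval_zero: "rpoly_eval 0 y = 0"
  by (simp add: rpoly_eval_def)

definition rpoly_of_terms :: "(real \<times> (nat \<Rightarrow>\<^sub>0 nat)) list \<Rightarrow> rpoly" where
  "rpoly_of_terms ps = (\<Sum>(c, m)\<leftarrow>ps. Poly_Mapping.single m c)"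

lemma rpoly_eval_of_terms: "rpoly_eval (rpoly_of_terms ps) y = (\<Sum>(c, m)\<leftarrow>ps. c * exponent_eval m y)"
  by (induction ps) (auto simp: rpoly_of_terms_def rpoly_eval_zero rpoly_eval_add rpoly_eval_single)

lemma keys_rpoly_of_terms: "Poly_Mapping.keys (rpoly_of_terms ps) \<subseteq> snd ` set ps"
proof (induction ps)
  case (Cons p ps)
  obtain c m where p: "p = (c, m)" by (cases p)
  have "Poly_Mapping.keys (rpoly_of_terms (p # ps)) \<subseteq> Poly_Mapping.keys (Poly_Mapping.single m c) \<union> Poly_Mapping.keys (rpoly_of_terms ps)"
    unfolding rpoly_of_terms_def p list.map sum_list.Cons prod.case by (rule Poly_Mapping.keys_add)
  also have "\<dots> \<subseteq> {m} \<union> snd ` set ps"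
    using Cons by (intro Un_mono) (auto split: if_splits)
  finally show ?case
    by (simp add: p)
qed (simp add: rpoly_of_terms_def)

lemma exponent_superset:
  assumes "finite S" "Poly_Mapping.keys m \<subseteq> S"
  shows "exponent_eval m y = (\<Prod>i\<in>S. y i ^ Poly_Mapping.lookup m i)"
    and "exponent_degree m = (\<Sum>i\<in>S. Poly_Mapping.lookup m i)"
  unfolding exponent_eval_def exponent_degree_def
  using assms by (auto intro!: prod.mono_neutral_left sum.mono_neutral_left simp: in_keys_iff)

lemma exponent_add_single:
  fixes m :: "nat \<Rightarrow>\<^sub>0 nat" and j :: nat
  defines "m' \<equiv> m + Poly_Mapping.single j 1"
  shows "exponent_eval m' y = y j * exponent_eval m y" and "exponent_degree m' = Suc (exponent_degree m)"
    and "Poly_Mapping.keys m' \<subseteq> insert j (Poly_Mapping.keys m)"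
proof -
  let ?S = "insert j (Poly_Mapping.keys m)"
  show keys: "Poly_Mapping.keys m' \<subseteq> ?S"
    unfolding m'_def using Poly_Mapping.keys_add[of m "Poly_Mapping.single j 1"] by auto
  have look: "Poly_Mapping.lookup m' i = Poly_Mapping.lookup m i + (if i = j then 1 else 0)" for i
    by (simp add: m'_def lookup_add lookup_single when_def)
  have S: "finite ?S" "Poly_Mapping.keys m \<subseteq> ?S"
    by auto
  have "(\<Prod>i\<in>?S. y i ^ Poly_Mapping.lookup m' i) = (\<Prod>i\<in>?S. y i ^ Poly_Mapping.lookup m i * (if i = j then y j else 1))"
    by (rule prod.cong) (auto simp: look)
  also have "\<dots> = (\<Prod>i\<in>?S. y i ^ Poly_Mapping.lookup m i) * y j"
    unfolding prod.distrib using S(1) by (subst prod.delta) auto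
  finally show "exponent_eval m' y = y j * exponent_eval m y"
    by (simp only: exponent_superset(1)[OF S] exponent_superset(1)[OF S(1) keys] mult.commute)
  have "(\<Sum>i\<in>?S. Poly_Mapping.lookup m' i) = (\<Sum>i\<in>?S. Poly_Mapping.lookup m i) + (\<Sum>i\<in>?S. if i = j then 1 else 0)"
    unfolding look by (rule sum.distrib)
  also have "(\<Sum>i\<in>?S. if i = j then 1 else 0) = (1 :: nat)"
    using S(1) by (subst sum.delta) auto
  finally show "exponent_degree m' = Suc (exponent_degree m)"
    by (simp add: exponent_superset(2)[OF S] exponent_superset(2)[OF S(1) keys])
qed

text \<open>A list of terms may repeat monomials, which makes the closure properties below immediate; collecting
  terms is left to \<open>rpoly_of_terms\<close>.\<close>

definition polynomial_of_degree_le :: "nat \<Rightarrow> nat \<Rightarrow> ((nat \<Rightarrow> real) \<Rightarrow> real) \<Rightarrow> bool" where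
  "polynomial_of_degree_le k N F \<longleftrightarrow>
     (\<exists>ps. (\<forall>(c, m)\<in>set ps. Poly_Mapping.keys m \<subseteq> {..<k} \<and> exponent_degree m \<le> N) \<and>
           F = (\<lambda>y. \<Sum>(c, m)\<leftarrow>ps. c * exponent_eval m y))"

lemma polynomial_of_degree_le_const: "polynomial_of_degree_le k N (\<lambda>y. c)"
  unfolding polynomial_of_degree_le_def
  by (rule exI[of _ "[(c, 0)]"]) (simp add: exponent_eval_def exponent_degree_def)

lemma polynomial_of_degree_le_mono:
  "polynomial_of_degree_le k N F \<Longrightarrow> N \<le> N' \<Longrightarrow> polynomial_of_degree_le k N' F"
  unfolding polynomial_of_degree_le_def by (fastforce intro: order_trans)

lemma polynomial_of_degree_le_add:
  assumes "polynomial_of_degree_le k N F" "polynomial_of_degree_le k N G"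
  shows "polynomial_of_degree_le k N (\<lambda>y. F y + G y)"
proof -
  obtain ps qs where
    "\<forall>(c, m)\<in>set ps. Poly_Mapping.keys m \<subseteq> {..<k} \<and> exponent_degree m \<le> N" "F = (\<lambda>y. \<Sum>(c, m)\<leftarrow>ps. c * exponent_eval m y)"
    "\<forall>(c, m)\<in>set qs. Poly_Mapping.keys m \<subseteq> {..<k} \<and> exponent_degree m \<le> N" "G = (\<lambda>y. \<Sum>(c, m)\<leftarrow>qs. c * exponent_eval m y)"
    using assms unfolding polynomial_of_degree_le_def by blast
  then show ?thesis
    unfolding polynomial_of_degree_le_def by (intro exI[of _ "ps @ qs"]) auto
qed

lemma polynomial_of_degree_le_scale:
  assumes "polynomial_of_degree_le k N F"
  shows "polynomial_of_degree_le k N (\<lambda>y. a * F y)"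
proof -
  obtain ps where ps: "\<forall>(c, m)\<in>set ps. Poly_Mapping.keys m \<subseteq> {..<k} \<and> exponent_degree m \<le> N"
      "F = (\<lambda>y. \<Sum>(c, m)\<leftarrow>ps. c * exponent_eval m y)"
    using assms unfolding polynomial_of_degree_le_def by blast
  have "(\<Sum>(c, m)\<leftarrow>map (\<lambda>(c, m). (a * c, m)) ps. c * exponent_eval m y) = a * (\<Sum>(c, m)\<leftarrow>ps. c * exponent_eval m y)" for y
    by (induction ps) (auto simp: algebra_simps)
  then show ?thesis
    unfolding polynomial_of_degree_le_def using ps by (intro exI[of _ "map (\<lambda>(c, m). (a * c, m)) ps"]) auto
qed

lemma polynomial_of_degree_le_times_var:
  assumes "polynomial_of_degree_le k N F" "j < k"
  shows "polynomial_of_degree_le k (Suc N) (\<lambda>y. y j * F y)"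
proof -
  obtain ps where ps: "\<forall>(c, m)\<in>set ps. Poly_Mapping.keys m \<subseteq> {..<k} \<and> exponent_degree m \<le> N"
      "F = (\<lambda>y. \<Sum>(c, m)\<leftarrow>ps. c * exponent_eval m y)"
    using assms unfolding polynomial_of_degree_le_def by blast
  let ?qs = "map (\<lambda>(c, m). (c, m + Poly_Mapping.single j 1)) ps"
  have "(\<Sum>(c, m)\<leftarrow>?qs. c * exponent_eval m y) = y j * (\<Sum>(c, m)\<leftarrow>ps. c * exponent_eval m y)" for y
    using exponent_add_single(1)[of _ j y] by (induction ps) (auto simp: algebra_simps)
  moreover have "\<forall>(c, m)\<in>set ?qs. Poly_Mapping.keys m \<subseteq> {..<k} \<and> exponent_degree m \<le> Suc N"
  proof (clarify)
    fix c m assume "(c, m) \<in> set ?qs"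
    then obtain m0 where m0: "(c, m0) \<in> set ps" "m = m0 + Poly_Mapping.single j 1"
      by auto
    then have "Poly_Mapping.keys m0 \<subseteq> {..<k}" "exponent_degree m0 \<le> N"
      using ps(1) by auto
    then show "Poly_Mapping.keys m \<subseteq> {..<k} \<and> exponent_degree m \<le> Suc N"
      using exponent_add_single(2,3)[of m0 j] assms(2) m0(2) by auto
  qed
  ultimately show ?thesis
    unfolding polynomial_of_degree_le_def using ps(2) by (intro exI[of _ ?qs]) simp
qed

lemma polynomial_of_degree_le_sum:
  "finite I \<Longrightarrow> (\<And>i. i \<in> I \<Longrightarrow> polynomial_of_degree_le k N (F i)) \<Longrightarrow>
    polynomial_of_degree_le k N (\<lambda>y. \<Sum>i\<in>I. F i y)"
  by (induction I rule: finite_induct) (simp_all add: polynomial_of_degree_le_const polynomial_of_degree_le_add)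

lemma polynomial_of_degree_le_rpoly:
  assumes "polynomial_of_degree_le k N F"
  obtains P where "\<forall>m\<in>Poly_Mapping.keys P. Poly_Mapping.keys m \<subseteq> {..<k}" "rpoly_degree P \<le> N" "rpoly_eval P = F"
proof -
  obtain ps where ps: "\<forall>(c, m)\<in>set ps. Poly_Mapping.keys m \<subseteq> {..<k} \<and> exponent_degree m \<le> N"
      "F = (\<lambda>y. \<Sum>(c, m)\<leftarrow>ps. c * exponent_eval m y)"
    using assms unfolding polynomial_of_degree_le_def by blast
  have *: "Poly_Mapping.keys m \<subseteq> {..<k} \<and> exponent_degree m \<le> N" if "m \<in> Poly_Mapping.keys (rpoly_of_terms ps)" for m
    using keys_rpoly_of_terms[of ps] that ps(1) by fastforce
  show thesis
  proof (rule that[of "rpoly_of_terms ps"])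
    show "rpoly_degree (rpoly_of_terms ps) \<le> N"
      unfolding rpoly_degree_def exponent_degree_def[symmetric] using * by (subst Max_le_iff) auto
    show "rpoly_eval (rpoly_of_terms ps) = F"
      unfolding ps(2) rpoly_eval_of_terms[abs_def] ..
  qed (use * in auto)
qed

text \<open>On the diagonal, no power of \<open>t\<close> beyond the degree can occur.\<close>

lemma rpoly_degree_ge:
  assumes "\<And>t. rpoly_eval P (\<lambda>_. t) = (\<Sum>i\<le>l. a i * t ^ i)" and "a l \<noteq> 0"
  shows "l \<le> rpoly_degree P"
proof (rule ccontr)
  assume "\<not> l \<le> rpoly_degree P"
  moreover have "exponent_degree m \<le> rpoly_degree P" if "m \<in> Poly_Mapping.keys P" for m
    unfolding rpoly_degree_def exponent_degree_def[symmetric] using that by (intro Max_ge) auto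
  ultimately have less: "exponent_degree m < l" if "m \<in> Poly_Mapping.keys P" for m
    using that by (meson le_trans not_le)
  define Q where "Q = (\<Sum>m\<in>Poly_Mapping.keys P. monom (Poly_Mapping.lookup P m) (exponent_degree m))"
  define R where "R = (\<Sum>i\<le>l. monom (a i) i)"
  have "poly Q t = poly R t" for t
    using assms(1)[of t]
    by (simp add: Q_def R_def poly_sum poly_monom rpoly_eval_def exponent_degree_def power_sum)
  then have "Q = R"
    by (simp add: poly_eq_poly_eq_iff[symmetric] fun_eq_iff)
  moreover have "coeff Q l = 0"
    unfolding Q_def coeff_sum coeff_monom using less by (intro sum.neutral ballI) (metis less_irrefl)
  moreover have "coeff R l = a l"
    by (simp add: R_def coeff_sum)
  ultimately show False
    using assms(2) by simp
qed

section \<open>The zonal polynomials\<close>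

text \<open>Another functional fixed by the stabilizer of \<open>V\<close>, hence proportional to the pairing with the zonal
  harmonic. Unlike the pairing, it can be computed in terms of the principal angles.\<close>

definition projected_mean :: "(real ^ 'd) set \<Rightarrow> (real ^ 'd \<Rightarrow> complex) \<Rightarrow> complex" where
  "projected_mean V h = ball_integral (\<lambda>x. h (oproj V x))"

lemma continuous_on_oproj: "subspace V \<Longrightarrow> continuous_on S (oproj V)"
  by (intro linear_continuous_on) (simp add: linear_oproj flip: linear_conv_bounded_linear)

lemma projected_mean_eq_ball_inner:
  fixes V :: "(real ^ 'd) set"
  assumes k: "1 \<le> k" "k < CARD('d)" and V: "V \<in> grassmannian k"
  obtains c where "\<And>h. h \<in> harmonics (2 * l) \<Longrightarrow> projected_mean V h = c * ball_inner h (czonal V l)"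
proof -
  let ?H = "harmonics (2 * l) :: (real ^ 'd \<Rightarrow> complex) set"
  have sV: "subspace V" "0 < dim V" "dim V < CARD('d)"
    using V k by (auto simp: grassmannian_def)
  have cont: "continuous_on UNIV (\<lambda>x. h (oproj V x))" if "h \<in> ?H" for h
    by (rule continuous_on_compose2[OF harmonics_continuous[OF that] continuous_on_oproj[OF sV(1)]]) auto
  have add: "projected_mean V (\<lambda>x. f x + g x) = projected_mean V f + projected_mean V g" if "f \<in> ?H" "g \<in> ?H" for f g
    unfolding projected_mean_def by (rule ball_integral_add[OF cont[OF that(1)] cont[OF that(2)]])
  have scale: "projected_mean V (\<lambda>x. c * f x) = c * projected_mean V f" if "f \<in> ?H" for c f
    unfolding projected_mean_def by (rule ball_integral_mult)
  have inv: "projected_mean V (\<lambda>x. f (reflection w x)) = projected_mean V f"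
    if "f \<in> ?H" "w \<in> V \<union> orthogonal_comp V" for f w
    unfolding projected_mean_def oproj_reflection[OF sV(1) that(2), symmetric]
    by (rule ball_integral_orthogonal[OF cont[OF that(1)] orthogonal_transformation_reflection])
  show thesis
    by (rule stabilizer_invariant_functional[OF sV, of l "projected_mean V"]) (fact add scale inv that)+
qed

definition weighted_square_sum :: "nat \<Rightarrow> (nat \<Rightarrow> 'd) \<Rightarrow> (nat \<Rightarrow> real) \<Rightarrow> real ^ 'd \<Rightarrow> real" where
  "weighted_square_sum k \<kappa> y u = (\<Sum>j<k. y j * (u $ \<kappa> j) ^ 2)"

definition angle_moment :: "nat \<Rightarrow> (nat \<Rightarrow> 'd::finite) \<Rightarrow> nat \<Rightarrow> (real ^ 'd \<Rightarrow> real) \<Rightarrow> (nat \<Rightarrow> real) \<Rightarrow> real" where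
  "angle_moment k \<kappa> i w y = ball_integral (\<lambda>u. weighted_square_sum k \<kappa> y u ^ i * w u)"

text \<open>The mean of the zonal harmonic of \<open>W\<close> over the ball projected to \<open>V\<close>, as a function of the
  squared cosines \<open>y\<close>; the coordinates \<open>\<kappa> 0, \<dots>, \<kappa> (k - 1)\<close> take the place of \<open>V\<close>.\<close>

definition angle_polynomial :: "nat \<Rightarrow> nat \<Rightarrow> (nat \<Rightarrow> 'd::finite) \<Rightarrow> (nat \<Rightarrow> real) \<Rightarrow> real" where
  "angle_polynomial k l \<kappa> y = (\<Sum>i\<le>l. zonal_coeff CARD('d) k l i *
     angle_moment k \<kappa> i (\<lambda>u. weighted_square_sum k \<kappa> (\<lambda>_. 1) u ^ (l - i)) y)"

lemma continuous_on_weighted_square_sum [continuous_intros]: "continuous_on S (weighted_square_sum k \<kappa> y)"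
  unfolding weighted_square_sum_def by (intro continuous_intros)

text \<open>Expanding one factor of the power at a time takes the variables out of the integral.\<close>

lemma angle_moment_polynomial:
  fixes \<kappa> :: "nat \<Rightarrow> 'd::finite"
  assumes "continuous_on UNIV w"
  shows "polynomial_of_degree_le k i (angle_moment k \<kappa> i w)"
  using assms
proof (induction i arbitrary: w)
  case 0
  show ?case
    by (simp add: angle_moment_def polynomial_of_degree_le_const)
next
  case (Suc i)
  have "angle_moment k \<kappa> (Suc i) w y = (\<Sum>j<k. y j * angle_moment k \<kappa> i (\<lambda>u. (u $ \<kappa> j) ^ 2 * w u) y)" for y
  proof -
    have "weighted_square_sum k \<kappa> y u ^ Suc i * w u =
        (\<Sum>j<k. y j * (weighted_square_sum k \<kappa> y u ^ i * ((u $ \<kappa> j) ^ 2 * w u)))" for u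
    proof -
      have "weighted_square_sum k \<kappa> y u ^ Suc i * w u = (\<Sum>j<k. y j * (u $ \<kappa> j) ^ 2) * (weighted_square_sum k \<kappa> y u ^ i * w u)"
        by (simp add: weighted_square_sum_def)
      then show ?thesis
        by (simp only: sum_distrib_right) (simp only: ac_simps)
    qed
    then have "angle_moment k \<kappa> (Suc i) w y = ball_integral (\<lambda>u. \<Sum>j<k. y j * (weighted_square_sum k \<kappa> y u ^ i * ((u $ \<kappa> j) ^ 2 * w u)))"
      unfolding angle_moment_def by presburger
    also have "\<dots> = (\<Sum>j<k. ball_integral (\<lambda>u. y j * (weighted_square_sum k \<kappa> y u ^ i * ((u $ \<kappa> j) ^ 2 * w u))))"
      by (intro ball_integral_sum continuous_intros Suc.prems) simp
    finally show ?thesis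
      by (simp only: ball_integral_mult angle_moment_def)
  qed
  then have "angle_moment k \<kappa> (Suc i) w = (\<lambda>y. \<Sum>j<k. y j * angle_moment k \<kappa> i (\<lambda>u. (u $ \<kappa> j) ^ 2 * w u) y)"
    by blast
  moreover have "polynomial_of_degree_le k (Suc i) (\<lambda>y. y j * angle_moment k \<kappa> i (\<lambda>u. (u $ \<kappa> j) ^ 2 * w u) y)" if "j < k" for j
    by (intro polynomial_of_degree_le_times_var Suc.IH that continuous_intros Suc.prems)
  ultimately show ?case
    by (simp only:) (intro polynomial_of_degree_le_sum finite_lessThan, simp)
qed

lemma angle_polynomial_polynomial:
  fixes \<kappa> :: "nat \<Rightarrow> 'd::finite"
  shows "polynomial_of_degree_le k l (angle_polynomial k l \<kappa>)"
  unfolding angle_polynomial_def[abs_def]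
  by (intro polynomial_of_degree_le_sum polynomial_of_degree_le_scale finite_atMost
      polynomial_of_degree_le_mono[OF angle_moment_polynomial] continuous_intros) simp

lemma orthonormal_family_axis:
  assumes "inj_on \<kappa> {..<k}"
  shows "orthonormal_family k (\<lambda>j. axis (\<kappa> j) 1 :: real ^ 'd)"
  unfolding orthonormal_family_def
proof (intro allI impI)
  fix i j assume "i < k" "j < k"
  then show "(axis (\<kappa> i) 1 :: real ^ 'd) \<bullet> axis (\<kappa> j) 1 = (if i = j then 1 else 0)"
    using assms by (auto simp: inner_axis_axis inj_on_def)
qed

text \<open>A permutation of the variables is undone by an orthogonal transformation that permutes the
  coordinates.\<close>

lemma angle_polynomial_symmetric:
  fixes \<kappa> :: "nat \<Rightarrow> 'd::finite"
  assumes \<kappa>: "inj_on \<kappa> {..<k}" and \<pi>: "\<pi> permutes {..<k}"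
  shows "angle_polynomial k l \<kappa> (y \<circ> \<pi>) = angle_polynomial k l \<kappa> y"
proof -
  have inj: "inj_on (\<lambda>j. \<kappa> (\<pi> j)) {..<k}"
    using comp_inj_on[of \<pi> "{..<k}" \<kappa>] \<kappa> permutes_inj_on[OF \<pi>] by (simp add: permutes_image[OF \<pi>] o_def)
  obtain g :: "real ^ 'd \<Rightarrow> real ^ 'd" where g: "orthogonal_transformation g" "\<And>j. j < k \<Longrightarrow> g (axis (\<kappa> j) 1) = (axis (\<kappa> (\<pi> j)) 1 :: real ^ 'd)"
    using orthogonal_transformation_between_orthonormal_families[OF orthonormal_family_axis[OF \<kappa>] orthonormal_family_axis[OF inj]] by blast
  have coord: "g u $ \<kappa> (\<pi> j) = u $ \<kappa> j" if "j < k" for u j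
  proof -
    have "g u \<bullet> g (axis (\<kappa> j) 1) = u \<bullet> axis (\<kappa> j) 1"
      using g(1) by (simp add: orthogonal_transformation_def)
    then show ?thesis
      by (simp add: g(2)[OF that] cart_eq_inner_axis)
  qed
  have ws: "weighted_square_sum k \<kappa> z (g u) = weighted_square_sum k \<kappa> (z \<circ> \<pi>) u" for z u
  proof -
    have "weighted_square_sum k \<kappa> z (g u) = (\<Sum>j<k. z (\<pi> j) * (g u $ \<kappa> (\<pi> j)) ^ 2)"
      unfolding weighted_square_sum_def using sum.permute[OF \<pi>, of "\<lambda>j. z j * (g u $ \<kappa> j) ^ 2"] by (simp add: o_def)
    then show ?thesis
      by (simp add: weighted_square_sum_def coord)
  qed
  have "angle_moment k \<kappa> i (\<lambda>u. weighted_square_sum k \<kappa> (\<lambda>_. 1) u ^ m) (y \<circ> \<pi>) =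
      angle_moment k \<kappa> i (\<lambda>u. weighted_square_sum k \<kappa> (\<lambda>_. 1) u ^ m) y" for i m
  proof -
    have "angle_moment k \<kappa> i (\<lambda>u. weighted_square_sum k \<kappa> (\<lambda>_. 1) u ^ m) (y \<circ> \<pi>) =
        ball_integral (\<lambda>u. weighted_square_sum k \<kappa> y (g u) ^ i * weighted_square_sum k \<kappa> (\<lambda>_. 1) (g u) ^ m)"
      by (simp add: angle_moment_def ws o_def)
    also have "\<dots> = ball_integral (\<lambda>u. weighted_square_sum k \<kappa> y u ^ i * weighted_square_sum k \<kappa> (\<lambda>_. 1) u ^ m)"
      by (rule ball_integral_orthogonal[where f = "\<lambda>u. weighted_square_sum k \<kappa> y u ^ i * weighted_square_sum k \<kappa> (\<lambda>_. 1) u ^ m", OF _ g(1)])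
         (intro continuous_intros)
    finally show ?thesis
      by (simp add: angle_moment_def)
  qed
  then show ?thesis
    by (simp add: angle_polynomial_def)
qed

text \<open>In coordinates with respect to an eigenbasis of \<open>oproj V \<circ> oproj W \<circ> oproj V\<close> on \<open>V\<close>, the form \<open>proj_sq W\<close>
  restricted to \<open>V\<close> is diagonal with the squared cosines as entries.\<close>

lemma projected_mean_zonal:
  fixes V W :: "(real ^ 'd) set" and \<kappa> :: "nat \<Rightarrow> 'd"
  assumes k: "1 \<le> k" "k < CARD('d)" and \<kappa>: "inj_on \<kappa> {..<k}" and V: "V \<in> grassmannian k" and W: "W \<in> grassmannian k"
  shows "projected_mean V (czonal W l) = of_real (angle_polynomial k l \<kappa> (cos2_angles k V W))"
proof -
  have sV: "subspace V" and sW: "subspace W"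
    using V W by (auto simp: grassmannian_def)
  let ?y = "cos2_angles k V W"
  obtain b where b: "orthonormal_family k b" "span (b ` {..<k}) = V"
    "\<And>i. i < k \<Longrightarrow> oproj V (oproj W (oproj V (b i))) = ?y i *\<^sub>R b i"
    using cos2_angles_eigenbasis[OF V W] by blast
  obtain g :: "real ^ 'd \<Rightarrow> real ^ 'd" where g: "orthogonal_transformation g" "\<And>j. j < k \<Longrightarrow> g (axis (\<kappa> j) 1) = b j"
    using orthogonal_transformation_between_orthonormal_families[OF orthonormal_family_axis[OF \<kappa>] b(1)] by blast
  have lin: "linear (\<lambda>v. oproj V (oproj W (oproj V v)))"
    using linear_compose[OF linear_compose[OF linear_oproj[OF sV] linear_oproj[OF sW]] linear_oproj[OF sV]] by (simp add: o_def)
  have pair: "(\<Sum>i<k. s i *\<^sub>R b i) \<bullet> (\<Sum>i<k. t i *\<^sub>R b i) = (\<Sum>i<k. s i * t i)" for s t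
  proof -
    have "(\<Sum>i<k. s i *\<^sub>R b i) \<bullet> (\<Sum>i<k. t i *\<^sub>R b i) = (\<Sum>i<k. \<Sum>j<k. if j = i then s i * t j else 0)"
      unfolding inner_sum_left inner_sum_right
      using b(1) by (intro sum.cong refl) (auto simp: orthonormal_family_def)
    then show ?thesis by simp
  qed
  have coords: "oproj V (g u) = (\<Sum>i<k. (u $ \<kappa> i) *\<^sub>R b i)" for u
  proof -
    have "g u \<bullet> b i = u $ \<kappa> i" if "i < k" for i
    proof -
      have "g u \<bullet> g (axis (\<kappa> i) 1) = u \<bullet> axis (\<kappa> i) 1"
        using g(1) by (simp add: orthogonal_transformation_def)
      then show ?thesis
        by (simp add: g(2)[OF that] cart_eq_inner_axis)
    qed
    then show ?thesis
      using orthonormal_family_facts(4)[OF b(1), of "g u"] b(2) by simp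
  qed
  have r: "norm (oproj V (g u)) ^ 2 = weighted_square_sum k \<kappa> (\<lambda>_. 1) u" for u
    unfolding power2_norm_eq_inner coords pair weighted_square_sum_def by (simp add: power2_eq_square)
  have s: "proj_sq W (oproj V (g u)) = weighted_square_sum k \<kappa> ?y u" for u
  proof -
    let ?v = "oproj V (g u)"
    have "proj_sq W ?v = ?v \<bullet> oproj W ?v"
      using oproj_self_adjoint(2)[OF sW, of ?v ?v] by (simp add: proj_sq_inner)
    also have "\<dots> = ?v \<bullet> oproj V (oproj W (oproj V ?v))"
      using oproj_self_adjoint(1)[OF sV, of "g u" "oproj W ?v"] by (simp add: oproj_idem[OF sV])
    also have "oproj V (oproj W (oproj V ?v)) = (\<Sum>i<k. (?y i * u $ \<kappa> i) *\<^sub>R b i)"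
      unfolding coords linear_sum[OF lin] linear_scale[OF lin] using b(3) by (intro sum.cong refl) (simp add: mult.commute)
    also have "?v \<bullet> \<dots> = weighted_square_sum k \<kappa> ?y u"
      unfolding coords pair weighted_square_sum_def by (simp add: power2_eq_square ac_simps)
    finally show ?thesis .
  qed
  have "continuous_on UNIV (\<lambda>x. czonal W l (oproj V x))"
    by (rule continuous_on_compose2[OF harmonics_continuous[OF grassmannian_zonal_harmonic[OF k W]] continuous_on_oproj[OF sV]]) auto
  then have "projected_mean V (czonal W l) = ball_integral (\<lambda>u. czonal W l (oproj V (g u)))"
    unfolding projected_mean_def by (rule ball_integral_orthogonal[OF _ g(1), symmetric])
  also have "\<dots> = ball_integral (\<lambda>u. complex_of_real (\<Sum>i\<le>l. zonal_coeff CARD('d) k l i *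
      (weighted_square_sum k \<kappa> ?y u ^ i * weighted_square_sum k \<kappa> (\<lambda>_. 1) u ^ (l - i))))"
    by (simp add: zonal_def grassmannianD(2)[OF W] r s)
  also have "\<dots> = of_real (ball_integral (\<lambda>u. \<Sum>i\<le>l. zonal_coeff CARD('d) k l i *
      (weighted_square_sum k \<kappa> ?y u ^ i * weighted_square_sum k \<kappa> (\<lambda>_. 1) u ^ (l - i))))"
    unfolding ball_integral_def integral_complex_of_real[symmetric] by (simp add: scaleR_conv_of_real)
  also have "\<dots> = of_real (angle_polynomial k l \<kappa> ?y)"
    unfolding angle_polynomial_def angle_moment_def ball_integral_mult[symmetric]
    by (intro arg_cong[where f = of_real] ball_integral_sum continuous_intros) simp
  finally show ?thesis .
qed

text \<open>On the diagonal all moments reduce to one positive integral. This yields the degree of the zonal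
  polynomial and the fact that it can be normalised at \<open>(1, \<dots>, 1)\<close>.\<close>

lemma angle_polynomial_diagonal:
  fixes \<kappa> :: "nat \<Rightarrow> 'd::finite"
  assumes k: "1 \<le> k"
  obtains G where "0 < G" "\<And>t. angle_polynomial k l \<kappa> (\<lambda>_. t) = (\<Sum>i\<le>l. G * zonal_coeff CARD('d) k l i * t ^ i)"
proof -
  let ?w = "weighted_square_sum k \<kappa> (\<lambda>_. 1)"
  define G where "G = ball_integral (\<lambda>u. ?w u ^ l)"
  have cont: "continuous_on UNIV (\<lambda>u. ?w u ^ l)"
    by (intro continuous_intros)
  have nonneg: "0 \<le> ?w u ^ l" for u
    by (simp add: weighted_square_sum_def sum_nonneg)
  have "G \<noteq> 0"
  proof
    assume 0: "G = 0"
    let ?u = "(1 / 2) *\<^sub>R axis (\<kappa> 0) 1 :: real ^ 'd"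
    have "?w ?u ^ l = 0"
      by (rule ball_integral_eq_0D[OF cont nonneg 0[unfolded G_def]]) simp
    then have "?w ?u = 0" by simp
    moreover have "(?u $ \<kappa> 0) ^ 2 \<le> ?w ?u"
      unfolding weighted_square_sum_def using k
      by (intro order_trans[OF _ member_le_sum[of 0]]) auto
    ultimately show False
      by (simp add: axis_def)
  qed
  moreover have "0 \<le> G"
    unfolding G_def by (rule ball_integral_nonneg[OF nonneg])
  ultimately have "0 < G" by simp
  moreover have "angle_polynomial k l \<kappa> (\<lambda>_. t) = (\<Sum>i\<le>l. G * zonal_coeff CARD('d) k l i * t ^ i)" for t
    unfolding angle_polynomial_def
  proof (rule sum.cong[OF refl])
    fix i assume i: "i \<in> {..l}"
    have "weighted_square_sum k \<kappa> (\<lambda>_. t) u ^ i * ?w u ^ (l - i) = t ^ i * ?w u ^ l" for u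
    proof -
      have "weighted_square_sum k \<kappa> (\<lambda>_. t) u = t * ?w u"
        by (simp add: weighted_square_sum_def sum_distrib_left)
      moreover have "?w u ^ i * ?w u ^ (l - i) = ?w u ^ l"
        using i by (simp add: power_add[symmetric])
      ultimately show ?thesis
        by (simp add: power_mult_distrib)
    qed
    then have "angle_moment k \<kappa> i (\<lambda>u. ?w u ^ (l - i)) (\<lambda>_. t) = t ^ i * G"
      by (simp add: angle_moment_def G_def ball_integral_mult)
    then show "zonal_coeff CARD('d) k l i * angle_moment k \<kappa> i (\<lambda>u. ?w u ^ (l - i)) (\<lambda>_. t) = G * zonal_coeff CARD('d) k l i * t ^ i"
      by simp
  qed
  ultimately show thesis
    by (rule that)
qed

lemma zonal_coeff_sum_nonzero:
  assumes k: "1 \<le> k" "k < CARD('d::finite)"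
  shows "(\<Sum>i\<le>l. zonal_coeff CARD('d) k l i) \<noteq> 0"
proof -
  obtain b :: "real ^ 'd" where b: "norm b = 1"
    using nonempty_Basis norm_Basis by blast
  obtain V :: "(real ^ 'd) set" where V: "V \<in> grassmannian k" "b \<in> V"
    using grassmannian_containing[of k b] k b by auto
  have "proj_sq V b = 1"
    using V b by (simp add: proj_sq_def oproj_ident grassmannian_def)
  then have "zonal V l b = (\<Sum>i\<le>l. zonal_coeff CARD('d) k l i)"
    using V(1) b by (simp add: zonal_def grassmannian_def)
  then show ?thesis
    using zonal_nonzero[of V b l] V b k by (simp add: grassmannian_def)
qed

text \<open>The choice of \<open>V\<close> is immaterial, because the orthogonal group acts transitively.\<close>

definition zonal_norm :: "'d::finite itself \<Rightarrow> nat \<Rightarrow> nat \<Rightarrow> complex" where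
  "zonal_norm d k l = (let V = (SOME V :: (real ^ 'd) set. V \<in> grassmannian k) in ball_inner (czonal V l) (czonal V l))"

lemma ball_inner_zonal_self:
  fixes V :: "(real ^ 'd) set"
  assumes k: "1 \<le> k" "k < CARD('d)" and V: "V \<in> grassmannian k"
  shows "ball_inner (czonal V l) (czonal V l) = zonal_norm TYPE('d) k l"
proof -
  define V0 where "V0 = (SOME V :: (real ^ 'd) set. V \<in> grassmannian k)"
  have V0: "V0 \<in> grassmannian k"
    unfolding V0_def using V by (rule someI)
  obtain g where g: "orthogonal_transformation g" "g ` V = V0"
    using orthogonal_transformation_transitive[OF V V0] .
  have "ball_inner (czonal V l) (czonal V l) = ball_inner (\<lambda>x. czonal V0 l (g x)) (\<lambda>x. czonal V0 l (g x))"
    using zonal_image[OF g(1) grassmannianD(1)[OF V], of l] by (simp add: g(2))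
  also have "\<dots> = ball_inner (czonal V0 l) (czonal V0 l)"
    using harmonics_continuous[OF grassmannian_zonal_harmonic[OF k V0]] by (intro ball_inner_orthogonal g)
  finally show ?thesis
    by (simp add: zonal_norm_def V0_def Let_def)
qed

text \<open>The projected mean over \<open>V\<close> and the pairing with \<open>zonal V l\<close> are proportional; the unknown factor
  cancels in the quotient by the value for \<open>W = V\<close>.\<close>

lemma zonal_kernel_angle_polynomial:
  fixes V W :: "(real ^ 'd) set" and \<kappa> :: "nat \<Rightarrow> 'd"
  assumes k: "1 \<le> k" "k < CARD('d)" and \<kappa>: "inj_on \<kappa> {..<k}" and V: "V \<in> grassmannian k" and W: "W \<in> grassmannian k"
  shows "of_real (angle_polynomial k l \<kappa> (cos2_angles k V W) / angle_polynomial k l \<kappa> (\<lambda>_. 1)) =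
    ball_inner (czonal W l) (czonal V l) / zonal_norm TYPE('d) k l"
proof -
  obtain c where c: "\<And>h. h \<in> harmonics (2 * l) \<Longrightarrow> projected_mean V h = c * ball_inner h (czonal V l)"
    using projected_mean_eq_ball_inner[OF k V] by blast
  obtain G where G: "0 < G" "\<And>t. angle_polynomial k l \<kappa> (\<lambda>_. t) = (\<Sum>i\<le>l. G * zonal_coeff CARD('d) k l i * t ^ i)"
    using angle_polynomial_diagonal[OF k(1), of l \<kappa>] by blast
  have nz: "angle_polynomial k l \<kappa> (\<lambda>_. 1) \<noteq> 0"
    using G(1) zonal_coeff_sum_nonzero[OF k, of l] by (simp add: G(2) sum_distrib_left[symmetric])
  have ang: "angle_polynomial k l \<kappa> (cos2_angles k V V) = angle_polynomial k l \<kappa> (\<lambda>_. 1)"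
    by (simp add: angle_polynomial_def angle_moment_def weighted_square_sum_def cos2_angles_self[OF V])
  have 1: "of_real (angle_polynomial k l \<kappa> (cos2_angles k V W)) = c * ball_inner (czonal W l) (czonal V l)"
    using c[OF grassmannian_zonal_harmonic[OF k W]] projected_mean_zonal[OF k \<kappa> V W] by simp
  have 2: "of_real (angle_polynomial k l \<kappa> (\<lambda>_. 1)) = c * zonal_norm TYPE('d) k l"
    using c[OF grassmannian_zonal_harmonic[OF k V]] projected_mean_zonal[OF k \<kappa> V V]
    by (simp add: ang ball_inner_zonal_self[OF k V])
  have "c \<noteq> 0"
    using 2 nz by auto
  then show ?thesis
    unfolding of_real_divide 1 2 by simp
qed

lemma rpoly_eval_cong:
  assumes "rpoly_symmetric k P" "\<And>i. i < k \<Longrightarrow> y i = z i"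
  shows "rpoly_eval P y = rpoly_eval P z"
  unfolding rpoly_eval_def
proof (rule sum.cong[OF refl])
  fix m assume "m \<in> Poly_Mapping.keys P"
  then have "Poly_Mapping.keys m \<subseteq> {..<k}"
    using assms(1) by (simp add: rpoly_symmetric_def)
  then show "Poly_Mapping.lookup P m * (\<Prod>i\<in>Poly_Mapping.keys m. y i ^ Poly_Mapping.lookup m i) =
      Poly_Mapping.lookup P m * (\<Prod>i\<in>Poly_Mapping.keys m. z i ^ Poly_Mapping.lookup m i)"
    using assms(2) by (intro arg_cong[where f = "\<lambda>q. _ * q"] prod.cong) auto
qed

lemma zonal_poly_exists:
  assumes k: "1 \<le> k" "k < CARD('d::finite)"
  shows "\<exists>P. is_zonal_poly TYPE('d) k l P"
proof -
  obtain K where "card K = k" "K \<subseteq> (UNIV :: 'd set)" "finite K"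
    using obtain_subset_with_card_n[of k "UNIV :: 'd set"] k by auto
  then obtain \<kappa> where "bij_betw \<kappa> {..<k} K"
    using ex_bij_betw_nat_finite[of K] by (auto simp: atLeast0LessThan)
  then have \<kappa>: "inj_on \<kappa> {..<k}"
    by (rule bij_betw_imp_inj_on)
  let ?N = "angle_polynomial k l \<kappa> (\<lambda>_. 1)"
  obtain G where G: "0 < G" "\<And>t. angle_polynomial k l \<kappa> (\<lambda>_. t) = (\<Sum>i\<le>l. G * zonal_coeff CARD('d) k l i * t ^ i)"
    using angle_polynomial_diagonal[OF k(1), of l \<kappa>] by blast
  have nz: "?N \<noteq> 0"
    using G(1) zonal_coeff_sum_nonzero[OF k, of l] by (simp add: G(2) sum_distrib_left[symmetric])
  obtain P where P: "\<forall>m\<in>Poly_Mapping.keys P. Poly_Mapping.keys m \<subseteq> {..<k}" "rpoly_degree P \<le> l"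
    "rpoly_eval P = (\<lambda>y. inverse ?N * angle_polynomial k l \<kappa> y)"
    by (rule polynomial_of_degree_le_rpoly[OF polynomial_of_degree_le_scale[OF angle_polynomial_polynomial]])
  have "l \<le> rpoly_degree P"
  proof (rule rpoly_degree_ge)
    show "rpoly_eval P (\<lambda>_. t) = (\<Sum>i\<le>l. inverse ?N * G * zonal_coeff CARD('d) k l i * t ^ i)" for t
      unfolding P(3) G(2)[of t] by (simp only: sum_distrib_left mult.assoc)
    show "inverse ?N * G * zonal_coeff CARD('d) k l l \<noteq> 0"
      using nz G(1) by simp
  qed
  moreover have "(\<lambda>V. if V \<in> grassmannian k then of_real (rpoly_eval P (cos2_angles k V W)) else 0) \<in> grassmann_H k l"
    if W: "W \<in> grassmannian k" for W :: "(real ^ 'd) set"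
  proof -
    have "(\<lambda>V. if V \<in> grassmannian k then of_real (rpoly_eval P (cos2_angles k V W)) else 0) =
        zonal_transform k l (\<lambda>x. inverse (zonal_norm TYPE('d) k l) * czonal W l x)"
    proof
      fix V :: "(real ^ 'd) set"
      show "(if V \<in> grassmannian k then of_real (rpoly_eval P (cos2_angles k V W)) else 0) =
        zonal_transform k l (\<lambda>x. inverse (zonal_norm TYPE('d) k l) * czonal W l x) V"
        using zonal_kernel_angle_polynomial[OF k \<kappa> _ W, of V l]
        by (simp add: zonal_transform_def ball_inner_mult_left P(3) divide_inverse mult.commute)
    qed
    then show ?thesis
      using harmonics_mult[OF grassmannian_zonal_harmonic[OF k W]] by (simp add: grassmann_H_eq[OF k])
  qed
  ultimately have "is_zonal_poly TYPE('d) k l P"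
    using P(1,2) nz by (simp add: is_zonal_poly_def rpoly_symmetric_def P(3) angle_polynomial_symmetric[OF \<kappa>])
  then show ?thesis by blast
qed

text \<open>The zonal polynomial is determined by its defining property: the polynomial representing
  \<open>V \<mapsto> P (y (V, W))\<close> is fixed by the stabilizer of \<open>W\<close>, because the transform is injective, so it
  is a multiple of the zonal harmonic of \<open>W\<close>, and the value at \<open>V = W\<close> gives the factor.\<close>

lemma zonal_poly_eval:
  fixes V W :: "(real ^ 'd) set"
  assumes k: "1 \<le> k" "k < CARD('d)" and V: "V \<in> grassmannian k" and W: "W \<in> grassmannian k"
  shows "of_real (rpoly_eval (zonal_poly TYPE('d) k l) (cos2_angles k V W)) =
    ball_inner (czonal W l) (czonal V l) / zonal_norm TYPE('d) k l"
proof -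
  let ?P = "zonal_poly TYPE('d) k l"
  have P: "is_zonal_poly TYPE('d) k l ?P"
    unfolding zonal_poly_def by (rule someI_ex[OF zonal_poly_exists[OF k]])
  then have "(\<lambda>V. if V \<in> grassmannian k then of_real (rpoly_eval ?P (cos2_angles k V W)) else 0) \<in> grassmann_H k l"
    using W by (simp add: is_zonal_poly_def)
  then obtain h where h: "h \<in> harmonics (2 * l)"
    "(\<lambda>V. if V \<in> grassmannian k then of_real (rpoly_eval ?P (cos2_angles k V W)) else 0) = zonal_transform k l h"
    by (auto simp: grassmann_H_eq[OF k])
  have sW: "subspace W" "0 < dim W" "dim W < CARD('d)"
    using W k by (auto simp: grassmannian_def)
  have "stabilizer_invariant W h"
    unfolding stabilizer_invariant_def
  proof (intro ballI allI)
    fix w x assume w: "w \<in> W \<union> orthogonal_comp W"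
    let ?r = "reflection w"
    have r: "orthogonal_transformation ?r"
      by (rule orthogonal_transformation_reflection)
    have "(\<lambda>x. h (?r x)) = h"
    proof (rule zonal_transform_injective[OF k harmonics_orthogonal[OF h(1) r] h(1)], rule ext)
      fix U :: "(real ^ 'd) set"
      show "zonal_transform k l (\<lambda>x. h (?r x)) U = zonal_transform k l h U"
      proof (cases "U \<in> grassmannian k")
        case True
        have "cos2_angles k (?r ` U) W = cos2_angles k U W"
          using cos2_angles_orthogonal[OF r grassmannianD(1)[OF True] sW(1)] by (simp add: reflection_image[OF sW(1) w])
        then show ?thesis
          using True grassmannian_image[OF r True] fun_cong[OF h(2), of U] fun_cong[OF h(2), of "?r ` U"]
          by (simp add: zonal_transform_orthogonal[OF k r harmonics_continuous[OF h(1)]])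
      qed (simp add: zonal_transform_def)
    qed
    then show "h (?r x) = h x"
      by (rule fun_cong)
  qed
  moreover obtain e where e: "e \<in> W" "norm e = 1"
    using unit_vector_in_subspace sW by metis
  moreover obtain e' where e': "e' \<in> orthogonal_comp W" "norm e' = 1"
    using unit_vector_in_complement sW by metis
  moreover have "czonal W l e \<noteq> 0"
    using zonal_nonzero[OF sW(1,3) e] by simp
  ultimately have "h = (\<lambda>x. h e / czonal W l e * czonal W l x)"
    using invariant_harmonics_proportional[OF sW(1) _ h(1) zonal_stabilizer_invariant[OF sW(1)] grassmannian_zonal_harmonic[OF k W]]
    by blast
  then obtain a where a: "h = (\<lambda>x. a * czonal W l x)"
    by blast
  have val: "of_real (rpoly_eval ?P (cos2_angles k U W)) = a * ball_inner (czonal W l) (czonal U l)"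
    if "U \<in> grassmannian k" for U
    using fun_cong[OF h(2), of U] that by (simp add: a zonal_transform_def ball_inner_mult_left)
  have "rpoly_eval ?P (cos2_angles k W W) = rpoly_eval ?P (\<lambda>_. 1)"
    using P by (intro rpoly_eval_cong[of k]) (simp_all add: is_zonal_poly_def cos2_angles_self[OF W])
  also have "\<dots> = 1"
    using P by (simp add: is_zonal_poly_def)
  finally have "1 = a * zonal_norm TYPE('d) k l"
    using val[OF W] by (simp add: ball_inner_zonal_self[OF k W])
  then have "a = 1 / zonal_norm TYPE('d) k l"
    by (metis mult_zero_right nonzero_eq_divide_eq zero_neq_one)
  then show ?thesis
    using val[OF V] by simp
qed

text \<open>Up to a nonzero factor, the double sum is the squared norm of the weighted zonal sum.\<close>

lemma zonal_poly_sum_eq_0_iff: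
  fixes V :: "nat \<Rightarrow> (real ^ 'd) set"
  assumes k: "1 \<le> k" "k < CARD('d)" and V: "\<And>j. j \<in> {1..n} \<Longrightarrow> V j \<in> grassmannian k" and n: "n \<noteq> 0"
  shows "(\<Sum>i=1..n. \<Sum>j=1..n. \<omega> i * \<omega> j * rpoly_eval (zonal_poly TYPE('d) k l) (cos2_angles k (V i) (V j))) = 0 \<longleftrightarrow>
    (\<forall>x. zonal_sum n V \<omega> l x = 0)"
proof -
  let ?S = "\<Sum>i=1..n. \<Sum>j=1..n. \<omega> i * \<omega> j * rpoly_eval (zonal_poly TYPE('d) k l) (cos2_angles k (V i) (V j))"
  let ?Z = "\<lambda>x. complex_of_real (zonal_sum n V \<omega> l x)" and ?\<nu> = "zonal_norm TYPE('d) k l"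
  have Z: "?Z \<in> harmonics (2 * l)"
    by (rule zonal_sum_harmonic[OF k V])
  have "V 1 \<in> grassmannian k"
    using n by (intro V) auto
  then have \<nu>: "?\<nu> \<noteq> 0"
    using zonal_ball_inner_self_nonzero[OF k] ball_inner_zonal_self[OF k] by metis
  have inner: "ball_inner h ?Z = (\<Sum>j=1..n. of_real (\<omega> j) * ball_inner h (czonal (V j) l))" if "h \<in> harmonics (2 * l)" for h
    by (rule ball_inner_zonal_sum[OF k V harmonics_continuous[OF that]])
  have "of_real ?S = (\<Sum>i=1..n. of_real (\<omega> i) * (\<Sum>j=1..n. of_real (\<omega> j) * ball_inner (czonal (V j) l) (czonal (V i) l))) / ?\<nu>"
    unfolding of_real_sum sum_divide_distrib sum_distrib_left
  proof (intro sum.cong refl)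
    fix i j assume "i \<in> {1..n}" "j \<in> {1..n}"
    then show "complex_of_real (\<omega> i * \<omega> j * rpoly_eval (zonal_poly TYPE('d) k l) (cos2_angles k (V i) (V j))) =
        of_real (\<omega> i) * (of_real (\<omega> j) * ball_inner (czonal (V j) l) (czonal (V i) l)) / ?\<nu>"
      by (simp add: zonal_poly_eval[OF k V V])
  qed
  also have "(\<Sum>i=1..n. of_real (\<omega> i) * (\<Sum>j=1..n. of_real (\<omega> j) * ball_inner (czonal (V j) l) (czonal (V i) l))) = ball_inner ?Z ?Z"
    unfolding inner[OF Z]
  proof (intro sum.cong refl arg_cong2[where f = "(*)"])
    fix i assume "i \<in> {1..n}"
    then have "czonal (V i) l \<in> harmonics (2 * l)"
      by (intro grassmannian_zonal_harmonic[OF k] V)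
    then have "ball_inner ?Z (czonal (V i) l) = cnj (\<Sum>j=1..n. of_real (\<omega> j) * ball_inner (czonal (V i) l) (czonal (V j) l))"
      by (subst ball_inner_commute) (simp only: inner)
    also have "\<dots> = (\<Sum>j=1..n. of_real (\<omega> j) * ball_inner (czonal (V j) l) (czonal (V i) l))"
      unfolding cnj_sum by (intro sum.cong refl) (simp add: ball_inner_commute[of "czonal (V i) l"])
    finally show "(\<Sum>j=1..n. of_real (\<omega> j) * ball_inner (czonal (V j) l) (czonal (V i) l)) = ball_inner ?Z (czonal (V i) l)" ..
  qed
  finally have S: "complex_of_real ?S = ball_inner ?Z ?Z / ?\<nu>" .
  have "?S = 0 \<longleftrightarrow> complex_of_real ?S = 0"
    by (rule of_real_eq_0_iff[symmetric])
  also have "\<dots> \<longleftrightarrow> ball_inner ?Z ?Z = 0"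
    unfolding S divide_eq_0_iff using \<nu> by blast
  also have "\<dots> \<longleftrightarrow> ?Z = (\<lambda>x. 0)"
  proof
    show "ball_inner ?Z ?Z = 0" if "?Z = (\<lambda>x. 0)"
      unfolding that using ball_inner_mult_right[of _ 0 "\<lambda>x :: real ^ 'd. 0"] by simp
  qed (rule harmonics_definite[OF Z])
  finally show ?thesis
    by (simp add: fun_eq_iff)
qed

theorem theorem5p3:
  fixes p k n :: nat
    and V :: "nat \<Rightarrow> (real ^ 'd) set"
    and \<omega> :: "nat \<Rightarrow> real"
  assumes "p \<ge> 1"
    and "k \<ge> 1"
    and "2 * k \<le> CARD('d)"
    and "\<And>j. j \<in> {1..n} \<Longrightarrow> V j \<in> grassmannian k"
    and "\<And>j. j \<in> {1..n} \<Longrightarrow> \<omega> j > 0"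
    and "(\<Sum>j=1..n. \<omega> j) = 1"
  defines "S1 \<equiv> tight_fusion_frame p n V \<omega>"
    and "S2 \<equiv> (\<forall>f\<in>Pol1 k p.
           integral\<^sup>L (grassmann_measure k) f = (\<Sum>j=1..n. of_real (\<omega> j) * f (V j)))"
    and "S3 \<equiv> (\<forall>l\<in>{1..p}. \<forall>f\<in>grassmann_H k l. (\<Sum>j=1..n. of_real (\<omega> j) * f (V j)) = 0)"
    and "S4 \<equiv> (\<forall>l\<in>{1..p}.
           (\<Sum>i=1..n. \<Sum>j=1..n. \<omega> i * \<omega> j *
              rpoly_eval (zonal_poly TYPE('d) k l) (cos2_angles k (V i) (V j))) = 0)"
  shows "(S1 \<longleftrightarrow> S2) \<and> (S2 \<longleftrightarrow> S3) \<and> (S3 \<longleftrightarrow> S4)"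
proof -
  have k: "1 \<le> k" "k < CARD('d)"
    using assms(2,3) by simp_all
  have n: "n \<noteq> 0"
    using assms(6) by (cases n) auto
  let ?Z = "\<forall>l\<in>{1..p}. \<forall>x. zonal_sum n V \<omega> l x = 0"
  have "S1 \<longleftrightarrow> ?Z"
    unfolding S1_def by (rule tight_fusion_frame_iff[OF k assms(4,5,6)])
  moreover have "S2 \<longleftrightarrow> S3"
    unfolding S2_def S3_def by (rule cubature_iff[OF k assms(4,6)])
  moreover have "S3 \<longleftrightarrow> ?Z"
    unfolding S3_def by (intro ball_cong refl sum_over_summand_eq_0_iff[OF k assms(4)])
  moreover have "S4 \<longleftrightarrow> ?Z"
    unfolding S4_def by (intro ball_cong refl zonal_poly_sum_eq_0_iff[OF k assms(4) n])
  ultimately show ?thesis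
    by blast
qed

end
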